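(* Let $\Psi\in\mathscr{S}_m$ be arbitrary. Then the map $$\omega\colon \mathscr{L}_+^\Gamma\to \mathrm{Range}_+\Gamma,\qquad \omega(\Lambda)=\int G\,W_\Lambda^{-1}\,\Psi\,W_\Lambda^{-*}\,G^*$$ is surjective. That is, for every $\Sigma\in\mathrm{Range}_+\Gamma$ there exists $\Lambda\in\mathscr{L}_+^\Gamma$ such that $\int G\,W_\Lambda^{-1}\Psi W_\Lambda^{-*}G^*=\Sigma$.
   Context: Let $n\ge m\ge 1$. Let $A\in\mathbb{C}^{n\times n}$ have all its eigenvalues in the open unit disk $\mathbb{D}=\{z\in\mathbb{C}:|z|<1\}$, let $B\in\mathbb{C}^{n\times m}$ have full column rank, and assume $(A,B)$ is reachable, i.e. $[B, AB,\dots,A^{n-1}B]$ has rank $n$. Put $G(z)=(zI-A)^{-1}B$. Let $\mathbb{T}$ be the unit circle. All integrals without an explicit measure are over $\mathbb{T}$ with respect to the normalized Lebesgue measure $\frac{d\theta}{2\pi}$, $z=e^{j\theta}$ ($j$ the imaginary unit). $(\cdot)^*$ denotes complex conjugate transpose; for a rational matrix function $F$, $F^*(z)$ is the analytic continuation of the function which equals the conjugate transpose of $F(z)$ on $\mathbb{T}$. $(\cdot)^{-*}$ means $[(\cdot)^{-1}]^*$. $\mathfrak{H}_n$ is the real vector space of $n\times n$ Hermitian matrices, $\mathfrak{H}_{+,n}$ its subset of positive definite matrices, $C(\mathbb{T};\mathfrak{H}_m)$ the space of continuous $\mathfrak{H}_m$-valued functions on $\mathbb{T}$. $\mathscr{S}_m$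 is the family of (measurable) functions $\Psi\colon\mathbb{T}\to\mathfrak{H}_{+,m}$ that are bounded and coercive, i.e. there are constants $0<c\le C<\infty$ with $cI\le\Psi(z)\le CI$ on $\mathbb{T}$. The linear operator $\Gamma\colon C(\mathbb{T};\mathfrak{H}_m)\to\mathfrak{H}_n$ is $\Gamma(\Phi)=\int G\Phi G^*$; $\mathrm{Range}\,\Gamma\subset\mathfrak{H}_n$ is its range and $\mathrm{Range}_+\Gamma:=\mathrm{Range}\,\Gamma\cap\mathfrak{H}_{+,n}$. $\mathscr{L}_+:=\{\Lambda\in\mathfrak{H}_n: G^*(z)\Lambda G(z)>0\ \text{for all } z\in\mathbb{T}\}$ and $\mathscr{L}_+^\Gamma:=\mathscr{L}_+\cap\mathrm{Range}\,\Gamma$. For $\Lambda\in\mathscr{L}_+$, $W_\Lambda$ is the unique stable and minimum phase right spectral factor of $G^*\Lambda G$: the rational $m\times m$ matrix function with $G^*\Lambda G=W_\Lambda^*W_\Lambda$ such that $W_\Lambda$ and $W_\Lambda^{-1}$ are analytic on $\{|z|\ge1\}\cup\{\infty\}$, normalized so that $W_\Lambda(\infty)$ is lower triangular with real positive diagonal entries. *)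

theory Defs
  imports
    "HOL-Analysis.Analysis"
    "HOL-Computational_Algebra.Polynomial"
begin

section \<open>Matrices\<close>

definition conj_transpose :: "complex^'n^'m \<Rightarrow> complex^'m^'n" where
  "conj_transpose M = (\<chi> i j. cnj (M $ j $ i))"

definition hermitian :: "complex^'n^'n \<Rightarrow> bool" where
  "hermitian M \<longleftrightarrow> conj_transpose M = M"

text \<open>The real inner product \<open>x \<bullet> y\<close> on complex vectors is the real part of
  \<open>x\<^sup>* y\<close>; for Hermitian \<open>M\<close> the number \<open>x\<^sup>* M x\<close> is real.\<close>

definition pos_def :: "complex^'n^'n \<Rightarrow> bool" where
  "pos_def M \<longleftrightarrow> hermitian M \<and> (\<forall>x. x \<noteq> 0 \<longrightarrow> 0 < x \<bullet> (M *v x))"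

definition pos_semidef :: "complex^'n^'n \<Rightarrow> bool" where
  "pos_semidef M \<longleftrightarrow> hermitian M \<and> (\<forall>x. 0 \<le> x \<bullet> (M *v x))"

definition loewner_le :: "complex^'n^'n \<Rightarrow> complex^'n^'n \<Rightarrow> bool" where
  "loewner_le M N \<longleftrightarrow> pos_semidef (N - M)"

definition eigenvalue :: "complex^'n^'n \<Rightarrow> complex \<Rightarrow> bool" where
  "eigenvalue A z \<longleftrightarrow> (\<exists>v. v \<noteq> 0 \<and> A *v v = z *s v)"

text \<open>The type class of the index type provides the order of rows and columns.\<close>

definition lower_triangular :: "complex^('m::{finite,linorder})^('m::{finite,linorder}) \<Rightarrow> bool" where
  "lower_triangular M \<longleftrightarrow> (\<forall>i j. i < j \<longrightarrow> M $ i $ j = 0)"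

text \<open>Rank of the block matrix \<open>[B, A B, \<dots>, A\<^sup>n\<^sup>-\<^sup>1 B]\<close> as the dimension of the span of its columns,
  where \<open>A\<^sup>k B\<close> is written as iterated left multiplication (\<open>A ^ k\<close> would be the entrywise power).\<close>

definition reachable :: "complex^'n^'n \<Rightarrow> complex^'m^'n \<Rightarrow> bool" where
  "reachable A B \<longleftrightarrow>
     vec.dim (\<Union>k<CARD('n). columns ((((**) A) ^^ k) B)) = CARD('n)"


section \<open>The unit circle and the operator \<open>\<Gamma>\<close>\<close>

abbreviation unit_circle :: "complex set" where
  "unit_circle \<equiv> sphere 0 1"

definition circle_integral ::
    "(complex \<Rightarrow> 'a::{banach,second_countable_topology}) \<Rightarrow> 'a" where
  "circle_integral F =
     (1 / (2 * pi)) *\<^sub>R integral\<^sup>L (lebesgue_on {0..2 * pi}) (\<lambda>t. F (cis t))"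

definition transfer_fun :: "complex^'n^'n \<Rightarrow> complex^'m^'n \<Rightarrow> complex \<Rightarrow> complex^'m^'n" where
  "transfer_fun A B z = matrix_inv (mat z - A) ** B"

definition Gamma_op ::
    "complex^'n^'n \<Rightarrow> complex^'m^'n \<Rightarrow> (complex \<Rightarrow> complex^'m^'m) \<Rightarrow> complex^'n^'n" where
  "Gamma_op A B \<Phi> = circle_integral
     (\<lambda>z. transfer_fun A B z ** \<Phi> z ** conj_transpose (transfer_fun A B z))"

definition range_Gamma :: "complex^'n^'n \<Rightarrow> complex^'m^'n \<Rightarrow> (complex^'n^'n) set" where
  "range_Gamma A B = {Gamma_op A B \<Phi> | \<Phi>.
     continuous_on unit_circle \<Phi> \<and> (\<forall>z\<in>unit_circle. hermitian (\<Phi> z))}"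

definition range_Gamma_plus :: "complex^'n^'n \<Rightarrow> complex^'m^'n \<Rightarrow> (complex^'n^'n) set" where
  "range_Gamma_plus A B = range_Gamma A B \<inter> {M. pos_def M}"

definition spectral_densities :: "(complex \<Rightarrow> complex^'m^'m) set" where
  "spectral_densities = {\<Psi>.
     (\<lambda>t. \<Psi> (cis t)) \<in> borel_measurable (lebesgue_on {0..2 * pi}) \<and>
     (\<forall>z\<in>unit_circle. pos_def (\<Psi> z)) \<and>
     (\<exists>c C. 0 < c \<and> c \<le> C \<and>
        (\<forall>z\<in>unit_circle. loewner_le (mat (complex_of_real c)) (\<Psi> z) \<and>
                          loewner_le (\<Psi> z) (mat (complex_of_real C))))}"

definition L_plus :: "complex^'n^'n \<Rightarrow> complex^'m^'n \<Rightarrow> (complex^'n^'n) set" where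
  "L_plus A B = {\<Lambda>. hermitian \<Lambda> \<and> (\<forall>z\<in>unit_circle.
     pos_def (conj_transpose (transfer_fun A B z) ** \<Lambda> ** transfer_fun A B z))}"

definition L_plus_Gamma :: "complex^'n^'n \<Rightarrow> complex^'m^'n \<Rightarrow> (complex^'n^'n) set" where
  "L_plus_Gamma A B = L_plus A B \<inter> range_Gamma A B"


section \<open>Spectral factors\<close>

text \<open>A rational function is represented by the function on \<open>\<complex>\<close> that takes the value \<open>0\<close> at its
  poles: the fraction is reduced and division by zero gives zero. This makes
  the representing function unique.\<close>

definition rational_fun :: "(complex \<Rightarrow> complex) \<Rightarrow> bool" where
  "rational_fun f \<longleftrightarrow>
     (\<exists>p q. q \<noteq> 0 \<and> coprime p q \<and> (\<forall>z. f z = poly p z / poly q z))"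

definition rational_matrix_fun :: "(complex \<Rightarrow> complex^'n^'m) \<Rightarrow> bool" where
  "rational_matrix_fun F \<longleftrightarrow> (\<forall>i j. rational_fun (\<lambda>z. F z $ i $ j))"

text \<open>Entrywise analyticity on \<open>{z. 1 \<le> \<bar>z\<bar>} \<union> {\<infinity>}\<close> with value \<open>L\<close> at \<open>\<infinity>\<close>, expressed in the
  coordinate \<open>w = 1 / z\<close>.\<close>

definition analytic_outside :: "(complex \<Rightarrow> complex^'n^'m) \<Rightarrow> complex^'n^'m \<Rightarrow> bool" where
  "analytic_outside F L \<longleftrightarrow>
     (\<forall>i j. (\<lambda>w. if w = 0 then L $ i $ j else F (inverse w) $ i $ j) analytic_on cball 0 1)"

text \<open>Both sides of \<open>G\<^sup>* \<Lambda> G = W\<^sup>* W\<close> are rational, so the identity is the one on the circle,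
  where \<open>\<^sup>*\<close> is the pointwise conjugate transpose.\<close>

definition is_spectral_factor ::
    "complex^'n^'n \<Rightarrow> complex^('m::{finite,linorder})^'n \<Rightarrow> complex^'n^'n \<Rightarrow>
     (complex \<Rightarrow> complex^('m::{finite,linorder})^('m::{finite,linorder})) \<Rightarrow> bool" where
  "is_spectral_factor A B \<Lambda> W \<longleftrightarrow>
     rational_matrix_fun W \<and>
     (\<forall>z\<in>unit_circle.
        conj_transpose (transfer_fun A B z) ** \<Lambda> ** transfer_fun A B z
          = conj_transpose (W z) ** W z) \<and>
     (\<exists>L. analytic_outside W L \<and>
        (\<forall>z. 1 \<le> norm z \<longrightarrow> invertible (W z)) \<and> invertible L \<and>
        analytic_outside (\<lambda>z. matrix_inv (W z)) (matrix_inv L) \<and>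
        lower_triangular L \<and> (\<forall>i. L $ i $ i \<in> \<real> \<and> 0 < Re (L $ i $ i)))"

definition spectral_factor ::
    "complex^'n^'n \<Rightarrow> complex^('m::{finite,linorder})^'n \<Rightarrow> complex^'n^'n \<Rightarrow>
     complex \<Rightarrow> complex^('m::{finite,linorder})^('m::{finite,linorder})" where
  "spectral_factor A B \<Lambda> = (THE W. is_spectral_factor A B \<Lambda> W)"

definition omega ::
    "complex^'n^'n \<Rightarrow> complex^('m::{finite,linorder})^'n \<Rightarrow>
     (complex \<Rightarrow> complex^('m::{finite,linorder})^('m::{finite,linorder})) \<Rightarrow>
     complex^'n^'n \<Rightarrow> complex^'n^'n" where
  "omega A B \<Psi> \<Lambda> = circle_integral (\<lambda>z.
     transfer_fun A B z ** matrix_inv (spectral_factor A B \<Lambda> z) ** \<Psi> z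
       ** conj_transpose (matrix_inv (spectral_factor A B \<Lambda> z))
       ** conj_transpose (transfer_fun A B z))"

end

theory Submission
  imports Defs "HOL-Complex_Analysis.Complex_Analysis"
    "HOL-Computational_Algebra.Polynomial_Factorial" "HOL-Computational_Algebra.Field_as_Ring"
begin


text \<open>
  The values of \<open>\<omega>\<close> lie in the range of \<open>\<Gamma>\<close> and are positive definite by direct estimates; the substance is
  that every \<open>\<Sigma>\<close> is attained. This follows from Brouwer's fixed point theorem, because the multipliers
  form an open convex cone on which \<open>\<omega>\<close> has three properties.

  First, \<open>\<langle>\<Lambda>, \<omega>(\<Lambda>)\<rangle> = \<integral> tr \<Psi>\<close> for every \<open>\<Lambda>\<close>, since the spectral factors cancel
  (\<open>inner_omega_self\<close>). Hence on the slice \<open>\<langle>\<Lambda>, \<Sigma>\<rangle> = \<integral> tr \<Psi>\<close> of the cone the vector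
  field \<open>v(\<Lambda>) = \<omega>(\<Lambda>) - \<Sigma>\<close> is orthogonal to \<open>\<Lambda>\<close>. Secondly, this slice is bounded: with \<open>W\<^sub>\<Lambda> = z C G\<close> the
  pairing \<open>\<langle>\<Lambda>, \<Sigma>\<rangle>\<close> is the trace of \<open>C \<Sigma> C\<^sup>*\<close>, so \<open>C\<close> and with it \<open>\<Lambda>\<close> are bounded
  (\<open>outer_factor_norm_bound\<close>, \<open>outer_factor_multiplier_bound\<close>). Thirdly, \<open>\<omega>\<close> blows up at the boundary of the
  cone: \<open>tr \<omega>(\<Lambda>)\<close> dominates the mean of the reciprocal of \<open>x\<^sup>* G\<^sup>* \<Lambda> G x\<close>, and this form is Lipschitz on the circle,
  so the mean grows like the logarithm of the reciprocal of its smallest value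
  (\<open>uniform_positivity_of_trace_bound\<close>).
  A variational inequality for \<open>v\<close>, solved on the part of the slice where \<open>G\<^sup>* \<Lambda> G \<ge> \<epsilon>\<close>, therefore has its
  solution in the relative interior once \<open>\<epsilon>\<close> is small. There \<open>v(\<Lambda>)\<close> is normal to the slice, that is, a multiple
  of \<open>\<Sigma>\<close>, and orthogonality to \<open>\<Lambda>\<close> makes it zero (\<open>omega_surjective\<close>).

  Existence of the spectral factor is obtained in state space form. A Hermitian \<open>\<Lambda>\<close> matters only
  modulo the matrices \<open>M\<close> with \<open>G\<^sup>* M G = 0\<close> on the circle, which form the orthogonal complement of the range of
  \<open>\<Gamma>\<close> among the Hermitian matrices. A separation argument shows that modulo these matrices every multiplier is positive
  definite (\<open>pos_def_representative\<close>); it rests on the pairing of multipliers with positive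
  semidefinite members of the range being positive, which comes from an explicit maximum entropy density
  for positive definite members (\<open>inner_nonneg_pos_def\<close>). For a positive definite representative the Riccati
  equation has a solution by Brouwer's theorem on an order interval (\<open>riccati_solution\<close>), and its solution
  yields the constant matrix \<open>C\<close> (\<open>outer_factor_exists\<close>). Uniqueness of the factor is a maximum principle
  argument (\<open>outer_functions_eq\<close>), and it also gives continuity of \<open>\<Lambda> \<mapsto> C\<close> through closedness of the graph
  (\<open>continuous_outer_factor\<close>).

  Throughout, the outside of the circle is mapped to the unit disc by \<open>w = 1/z\<close>, and \<open>H(w) = z G(z)\<close>.
\<close>

(* The symbol is reserved for the components of vectors. *)
no_notation fps_nth (infixl "$" 75)

notation conj_transpose ("_\<dagger>" [1000] 1000)

section \<open>Adjoints and the real inner product of matrices\<close>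

lemma adj_nth [simp]: "M\<dagger> $ i $ j = cnj (M $ j $ i)"
  by (simp add: conj_transpose_def)

lemma adj_adj [simp]: "(M\<dagger>)\<dagger> = M"
  by (simp add: vec_eq_iff)

lemma adj_mult: "(M ** N)\<dagger> = N\<dagger> ** M\<dagger>"
  by (simp add: vec_eq_iff matrix_matrix_mult_def mult.commute)

lemma adj_add: "(M + N)\<dagger> = M\<dagger> + N\<dagger>"
  and adj_diff: "(M - N)\<dagger> = M\<dagger> - N\<dagger>"
  and adj_scaleR: "(r *\<^sub>R M)\<dagger> = r *\<^sub>R M\<dagger>"
  and adj_0 [simp]: "0\<dagger> = 0"
  by (simp_all add: vec_eq_iff)

lemma adj_mat [simp]: "(mat c)\<dagger> = mat (cnj c)"
  by (simp add: vec_eq_iff mat_def)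

lemma bounded_linear_adj: "bounded_linear (conj_transpose :: complex^'n^'m \<Rightarrow> _)"
  by (intro linear_conv_bounded_linear[THEN iffD1] linearI) (auto simp: adj_add adj_scaleR)

lemma inner_complex_Re: "(x::complex) \<bullet> y = Re (cnj x * y)"
  by (simp add: inner_complex_def)

lemma inner_vec_Re: "(x::complex^'n) \<bullet> y = Re (\<Sum>i\<in>UNIV. cnj (x$i) * y$i)"
  unfolding inner_vec_def inner_complex_Re by simp

lemma inner_mat_Re: "(M::complex^'n^'m) \<bullet> N = Re (\<Sum>i\<in>UNIV. \<Sum>j\<in>UNIV. cnj (M$i$j) * N$i$j)"
  by (simp add: inner_vec_def inner_complex_Re)

lemma inner_mv_adj: "x \<bullet> (M *v y) = (M\<dagger> *v x) \<bullet> y"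
  unfolding inner_vec_Re
  apply (simp only: matrix_vector_mult_def vec_lambda_beta sum_distrib_left cnj_sum sum_distrib_right)
  apply (subst sum.swap)
  apply (simp add: algebra_simps)
  done

lemma inner_mult_left_adj: "M \<bullet> (P ** N) = (P\<dagger> ** M) \<bullet> (N::complex^'n^'m)"
proof -
  have "(\<Sum>i\<in>UNIV. \<Sum>j\<in>UNIV. \<Sum>k\<in>UNIV. cnj (M$i$j) * (P$i$k * N$k$j))
    = (\<Sum>k\<in>UNIV. \<Sum>j\<in>UNIV. \<Sum>i\<in>UNIV. cnj (M$i$j) * (P$i$k * N$k$j))"
    by (subst sum.swap, subst (2) sum.swap, subst sum.swap) (rule refl)
  thus ?thesis
    unfolding inner_mat_Re
    by (simp only: matrix_matrix_mult_def vec_lambda_beta sum_distrib_left cnj_sum sum_distrib_right)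
       (simp add: algebra_simps)
qed

lemma inner_adj_adj: "M\<dagger> \<bullet> N\<dagger> = M \<bullet> (N::complex^'n^'m)"
  unfolding inner_mat_Re by (subst sum.swap) (simp add: algebra_simps)

lemma inner_mult_right_adj: "M \<bullet> (N ** P) = (M ** P\<dagger>) \<bullet> (N::complex^'n^'m)"
proof -
  have "M \<bullet> (N ** P) = M\<dagger> \<bullet> (P\<dagger> ** N\<dagger>)"
    by (metis inner_adj_adj adj_mult)
  also have "\<dots> = (M ** P\<dagger>)\<dagger> \<bullet> N\<dagger>"
    by (simp add: inner_mult_left_adj adj_mult)
  finally show ?thesis by (simp add: inner_adj_adj)
qed

text \<open>The real inner product of matrices is \<open>Re (tr (M\<^sup>* N))\<close>, so factors move across it as adjoints.
  Every pairing below between a multiplier and a moment matrix is evaluated by this rule.\<close>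

lemma inner_sandwich: "M \<bullet> (X ** N ** X\<dagger>) = (X\<dagger> ** M ** X) \<bullet> N"
  using inner_mult_right_adj[of M "X ** N" "X\<dagger>"] inner_mult_left_adj[of "M ** X" X N]
  by (simp add: matrix_mul_assoc)

lemma norm_adj: "norm (M\<dagger>) = norm M"
  by (simp add: norm_eq_sqrt_inner inner_adj_adj)

lemma norm_sq_mat: "(norm (M::complex^'n^'m))\<^sup>2 = (\<Sum>i\<in>UNIV. \<Sum>j\<in>UNIV. (norm (M$i$j))\<^sup>2)"
  by (simp add: power2_norm_eq_inner inner_vec_def)

lemma norm_sq_vec: "(norm (x::complex^'n))\<^sup>2 = (\<Sum>i\<in>UNIV. (norm (x$i))\<^sup>2)"
  by (simp add: power2_norm_eq_inner inner_vec_def)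

lemma norm_sq_mat_columns:
  "(norm (M::complex^'n^'m))\<^sup>2 = (\<Sum>j\<in>UNIV. (norm (M *v axis j 1))\<^sup>2)"
  by (simp add: norm_sq_mat norm_sq_vec
      matrix_vector_mult_def axis_def if_distrib cong: if_cong) (rule sum.swap)

lemma inner_mat_columns:
  "(M::complex^'n^'m) \<bullet> N = (\<Sum>j\<in>UNIV. (M *v axis j 1) \<bullet> (N *v axis j 1))"
  by (simp add: inner_vec_def matrix_vector_mult_def axis_def if_distrib cong: if_cong) (rule sum.swap)

text \<open>The Euclidean norm of a matrix is its Frobenius norm, which is submultiplicative by Cauchy-Schwarz.\<close>

lemma norm_mv_le: "norm ((M::complex^'n^'m) *v x) \<le> norm M * norm x"
proof -
  have "norm ((M *v x) $ i) \<le> norm (M$i) * norm x" for i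
  proof -
    have "norm ((M *v x) $ i) \<le> (\<Sum>j\<in>UNIV. \<bar>norm (M$i$j)\<bar> * \<bar>norm (x$j)\<bar>)"
      unfolding matrix_vector_mult_def by (simp add: sum_norm_le norm_mult)
    also have "\<dots> \<le> L2_set (\<lambda>j. norm (M$i$j)) UNIV * L2_set (\<lambda>j. norm (x$j)) UNIV"
      by (rule L2_set_mult_ineq)
    finally show ?thesis by (simp add: norm_vec_def)
  qed
  hence "(\<Sum>i\<in>UNIV. (norm ((M *v x) $ i))\<^sup>2) \<le> (\<Sum>i\<in>UNIV. (norm (M$i) * norm x)\<^sup>2)"
    by (intro sum_mono power_mono) auto
  hence "(norm (M *v x))\<^sup>2 \<le> (norm M * norm x)\<^sup>2"
    by (simp add: norm_sq_vec[of "M *v x"] power_mult_distrib sum_distrib_right[symmetric]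
        norm_sq_mat norm_sq_vec[of "M $ _"])
  thus ?thesis by (rule power2_le_imp_le) simp
qed

lemma norm_mm_le: "norm ((M::complex^'n^'m) ** (N::complex^'k^'n)) \<le> norm M * norm N"
proof -
  have "(norm (M ** N))\<^sup>2 \<le> (\<Sum>j\<in>UNIV. (norm M * norm (N *v axis j 1))\<^sup>2)"
    unfolding norm_sq_mat_columns[of "M ** N"] matrix_vector_mul_assoc[symmetric]
    by (intro sum_mono power_mono norm_mv_le) auto
  also have "\<dots> = (norm M * norm N)\<^sup>2"
    by (simp add: power_mult_distrib sum_distrib_left[symmetric] norm_sq_mat_columns[of N])
  finally show ?thesis by (rule power2_le_imp_le) simp
qed

lemma scaleR_mm_left: "(r *\<^sub>R (M::complex^'n^'m)) ** N = r *\<^sub>R (M ** N)"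
  and scaleR_mm_right: "M ** (r *\<^sub>R (K::complex^'k^'n)) = r *\<^sub>R (M ** K)"
  and scaleR_mv_left: "(r *\<^sub>R M) *v x = r *\<^sub>R (M *v x)"
  and scaleR_mv_right: "M *v (r *\<^sub>R x) = r *\<^sub>R (M *v x)"
  by (simp_all add: vec_eq_iff matrix_matrix_mult_def matrix_vector_mult_def scaleR_sum_right)

lemma mm_add_left: "((M::complex^'n^'m) + N) ** (K::complex^'k^'n) = M ** K + N ** K"
  by (simp add: vec_eq_iff matrix_matrix_mult_def sum.distrib distrib_right)

lemma bounded_bilinear_mm:
  "bounded_bilinear ((**) :: complex^'n^'m \<Rightarrow> complex^'k^'n \<Rightarrow> _)"
  by (rule bounded_bilinear.intro)
     (auto simp: matrix_add_ldistrib mm_add_left scaleR_mm_left scaleR_mm_right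
       intro!: exI[of _ 1] norm_mm_le)

lemma bounded_bilinear_mv:
  "bounded_bilinear ((*v) :: complex^'n^'m \<Rightarrow> complex^'n \<Rightarrow> _)"
  by (rule bounded_bilinear.intro)
     (auto simp: matrix_vector_right_distrib matrix_vector_mult_add_rdistrib scaleR_mv_left scaleR_mv_right
       intro!: exI[of _ 1] norm_mv_le)

lemmas mm_diff_left = bounded_bilinear.diff_left[OF bounded_bilinear_mm]
lemmas mm_diff_right = bounded_bilinear.diff_right[OF bounded_bilinear_mm]
lemmas mm_zero_left [simp] = bounded_bilinear.zero_left[OF bounded_bilinear_mm]
lemmas mm_zero_right [simp] = bounded_bilinear.zero_right[OF bounded_bilinear_mm]
lemmas mv_diff_left = bounded_bilinear.diff_left[OF bounded_bilinear_mv]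
lemmas mv_zero_left [simp] = bounded_bilinear.zero_left[OF bounded_bilinear_mv]

lemmas mm_continuous [continuous_intros] = bounded_bilinear.continuous_on[OF bounded_bilinear_mm]
lemmas mv_continuous [continuous_intros] = bounded_bilinear.continuous_on[OF bounded_bilinear_mv]
lemmas adj_continuous [continuous_intros] = bounded_linear.continuous_on[OF bounded_linear_adj]
lemmas mm_tendsto [tendsto_intros] = bounded_bilinear.tendsto[OF bounded_bilinear_mm]
lemmas adj_tendsto [tendsto_intros] = bounded_linear.tendsto[OF bounded_linear_adj]

lemma mat_mm_nth: "(mat c ** (M::complex^'n^'m)) $ i $ j = c * M $ i $ j"
proof -
  have "(\<Sum>k\<in>UNIV. (if i = k then c else 0) * M $ k $ j) = (\<Sum>k\<in>UNIV. if i = k then c * M $ k $ j else 0)"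
    by (rule sum.cong) auto
  thus ?thesis by (simp add: matrix_matrix_mult_def mat_def)
qed

lemma mm_mat_nth: "((M::complex^'n^'m) ** mat c) $ i $ j = c * M $ i $ j"
proof -
  have "(\<Sum>k\<in>UNIV. M $ i $ k * (if k = j then c else 0)) = (\<Sum>k\<in>UNIV. if k = j then c * M $ i $ k else 0)"
    by (rule sum.cong) auto
  thus ?thesis by (simp add: matrix_matrix_mult_def mat_def)
qed

lemma mat_commute: "mat c ** (M::complex^'n^'m) = M ** mat c"
  by (simp add: vec_eq_iff mat_mm_nth mm_mat_nth)

lemma mat_mult_mat: "mat a ** mat b = (mat (a * b) :: complex^'n^'n)"
  by (simp add: vec_eq_iff mat_mm_nth) (simp add: mat_def)

lemma mat_mv: "mat c *v (x::complex^'n) = c *s x"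
proof -
  have "(\<Sum>k\<in>UNIV. (if i = k then c else 0) * x $ k) = (\<Sum>k\<in>UNIV. if i = k then c * x $ k else 0)" for i
    by (rule sum.cong) auto
  thus ?thesis by (simp add: vec_eq_iff matrix_vector_mult_def mat_def)
qed

lemma matrix_eq_0I: "(\<And>x. (M::complex^'m^'n) *v x = 0) \<Longrightarrow> M = 0"
  by (simp add: matrix_eq)

lemma norm_mat_mult: "norm (mat c ** (M::complex^'n^'m)) = norm c * norm M"
proof -
  have "(norm (mat c ** M))\<^sup>2 = (norm c * norm M)\<^sup>2"
    by (simp add: norm_sq_mat mat_mm_nth norm_mult power_mult_distrib sum_distrib_left)
  thus ?thesis by simp
qed

lemma inner_mat1: "M \<bullet> mat 1 = (\<Sum>j\<in>UNIV. axis j 1 \<bullet> ((M::complex^'n^'n) *v axis j 1))"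
  by (simp add: inner_mat_columns inner_commute)

lemma inner_mat1_left: "mat 1 \<bullet> M = (\<Sum>j\<in>UNIV. axis j 1 \<bullet> ((M::complex^'n^'n) *v axis j 1))"
  using inner_mat1[of M] by (simp add: inner_commute)

section \<open>Positive definite matrices\<close>

lemma hermitian_sandwich: "hermitian M \<Longrightarrow> hermitian (X\<dagger> ** M ** X)"
  by (simp add: hermitian_def adj_mult matrix_mul_assoc)

lemma hermitian_sandwich': "hermitian M \<Longrightarrow> hermitian (X ** M ** X\<dagger>)"
  by (simp add: hermitian_def adj_mult matrix_mul_assoc)

lemma hermitian_add: "hermitian M \<Longrightarrow> hermitian N \<Longrightarrow> hermitian (M + N)"
  and hermitian_diff: "hermitian M \<Longrightarrow> hermitian N \<Longrightarrow> hermitian (M - N)"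
  and hermitian_scaleR: "hermitian M \<Longrightarrow> hermitian (r *\<^sub>R M)"
  and hermitian_0: "hermitian 0"
  and hermitian_mat1: "hermitian (mat 1)"
  and hermitian_gram: "hermitian (X\<dagger> ** X)"
  by (auto simp: hermitian_def adj_add adj_diff adj_scaleR adj_mult)

lemma quad_sandwich: "x \<bullet> ((X\<dagger> ** M ** X) *v x) = (X *v x) \<bullet> (M *v (X *v x))"
  by (simp add: inner_mv_adj matrix_vector_mul_assoc[symmetric] adj_mult)

lemma quad_sandwich': "x \<bullet> ((X ** M ** X\<dagger>) *v x) = (X\<dagger> *v x) \<bullet> (M *v (X\<dagger> *v x))"
  using quad_sandwich[of x "X\<dagger>" M] by simp

lemma quad_gram: "x \<bullet> ((X\<dagger> ** X) *v x) = (norm (X *v x))\<^sup>2"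
  by (simp add: inner_mv_adj matrix_vector_mul_assoc[symmetric] adj_mult power2_norm_eq_inner)

lemma pos_def_imp_psd: "pos_def M \<Longrightarrow> pos_semidef M"
  unfolding pos_def_def pos_semidef_def by (metis inner_zero_left order_le_less)

lemma pos_def_hermitian: "pos_def M \<Longrightarrow> hermitian M"
  by (simp add: pos_def_def)

lemma pos_def_pos: "pos_def M \<Longrightarrow> x \<noteq> 0 \<Longrightarrow> 0 < x \<bullet> (M *v x)"
  by (simp add: pos_def_def)

lemma pos_def_nonneg: "pos_def M \<Longrightarrow> 0 \<le> x \<bullet> (M *v x)"
  using pos_def_imp_psd[of M] by (simp add: pos_semidef_def)

lemma inj_invertible:
  fixes M :: "complex^'n^'n"
  assumes "\<And>x. M *v x = 0 \<Longrightarrow> x = 0"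
  shows "invertible M"
  using assms by (simp add: invertible_left_inverse matrix_left_invertible_ker)

lemma invertible_inj: "invertible (M::complex^'n^'n) \<Longrightarrow> M *v x = 0 \<Longrightarrow> x = 0"
  by (metis invertible_def matrix_left_invertible_ker)

lemma pos_def_invertible: "pos_def M \<Longrightarrow> invertible M"
  by (rule inj_invertible) (metis pos_def_pos inner_zero_right less_irrefl)

lemma pos_def_sandwich:
  fixes X :: "complex^'m^'n"
  assumes "pos_def M" "\<And>x. X *v x = 0 \<Longrightarrow> x = 0"
  shows "pos_def (X\<dagger> ** M ** X)"
  using assms unfolding pos_def_def
  by (auto simp: quad_sandwich hermitian_sandwich)

lemma quad_bound_of_unit:
  fixes M :: "complex^'n^'n"
  assumes "\<And>x. norm x = 1 \<Longrightarrow> c \<le> x \<bullet> (M *v x)"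
  shows "c * (norm x)\<^sup>2 \<le> x \<bullet> (M *v x)"
proof (cases "x = 0")
  case False
  define y where "y = (1 / norm x) *\<^sub>R x"
  have "c \<le> y \<bullet> (M *v y)" by (rule assms) (use False in \<open>simp add: y_def\<close>)
  also have "\<dots> = (x \<bullet> (M *v x)) / (norm x)\<^sup>2"
    by (simp add: y_def scaleR_mv_right power2_eq_square)
  finally show ?thesis using False by (simp add: field_simps)
qed simp

text \<open>The form attains its minimum over the compact product of the circle and the unit sphere.\<close>

lemma sphere_pos_def_bound:
  fixes Q :: "complex \<Rightarrow> complex^'n^'n"
  assumes cont: "continuous_on (sphere 0 1) Q" and pd: "\<And>z. z \<in> sphere 0 1 \<Longrightarrow> pos_def (Q z)"
  obtains c where "c > 0" "\<And>z x. z \<in> sphere 0 1 \<Longrightarrow> c * (norm x)\<^sup>2 \<le> x \<bullet> (Q z *v x)"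
proof -
  let ?S = "sphere (0::complex) 1 \<times> sphere (0::complex^'n) 1"
  let ?f = "\<lambda>p. snd p \<bullet> (Q (fst p) *v snd p)"
  have "continuous_on ?S ?f"
    by (intro continuous_intros continuous_on_compose2[OF cont]) auto
  moreover have "compact ?S" "?S \<noteq> {}" by (auto intro!: compact_Times)
  ultimately obtain p where p: "p \<in> ?S" "\<And>q. q \<in> ?S \<Longrightarrow> ?f p \<le> ?f q"
    using continuous_attains_inf[of ?S ?f] by blast
  show thesis
  proof
    have "snd p \<noteq> 0" using p(1) by auto
    thus "?f p > 0" using p(1) pd by (intro pos_def_pos) auto
    fix z :: complex and x :: "complex^'n" assume z: "z \<in> sphere 0 1"
    have "?f p \<le> x \<bullet> (Q z *v x)" if "norm x = 1" for x
      using p(2)[of "(z, x)"] z that by simp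
    thus "?f p * (norm x)\<^sup>2 \<le> x \<bullet> (Q z *v x)" by (rule quad_bound_of_unit)
  qed
qed

lemma pos_def_bound:
  fixes M :: "complex^'n^'n"
  assumes "pos_def M"
  obtains c where "c > 0" "\<And>x. c * (norm x)\<^sup>2 \<le> x \<bullet> (M *v x)"
proof (rule sphere_pos_def_bound[of "\<lambda>_. M"])
  fix c assume c: "c > 0" "\<And>(z::complex) x. z \<in> sphere 0 1 \<Longrightarrow> c * (norm x)\<^sup>2 \<le> x \<bullet> (M *v x)"
  show thesis by (rule that[OF c(1)]) (rule c(2)[of 1], simp)
qed (use assms in auto)

lemma pos_def_of_bound:
  assumes "hermitian M" "c > 0" "\<And>x. c * (norm x)\<^sup>2 \<le> x \<bullet> (M *v x)"
  shows "pos_def M"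
  unfolding pos_def_def
proof (intro conjI allI impI assms)
  fix x :: "complex^'a" assume "x \<noteq> 0"
  thus "0 < x \<bullet> (M *v x)" using assms(2) assms(3)[of x]
    by (meson less_le_trans mult_pos_pos zero_less_norm_iff zero_less_power)
qed

lemma quad_le_norm: "x \<bullet> ((M::complex^'n^'n) *v x) \<le> norm M * (norm x)\<^sup>2"
proof -
  have "x \<bullet> (M *v x) \<le> norm x * norm (M *v x)" by (rule norm_cauchy_schwarz)
  also have "\<dots> \<le> norm x * (norm M * norm x)" by (intro mult_left_mono norm_mv_le) auto
  finally show ?thesis by (simp add: power2_eq_square ac_simps)
qed

text \<open>The rank-one matrix \<open>x x\<^sup>*\<close>.\<close>

definition dyad :: "complex^'n \<Rightarrow> complex^'n^'n" where
  "dyad x = (\<chi> i j. x $ i * cnj (x $ j))"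

lemma inner_dyad: "M \<bullet> dyad x = x \<bullet> (M\<dagger> *v x)"
proof -
  have "M \<bullet> dyad x = Re (\<Sum>i\<in>UNIV. \<Sum>j\<in>UNIV. cnj (M$i$j) * (x$i * cnj (x$j)))"
    by (simp add: inner_mat_Re dyad_def)
  also have "\<dots> = Re (\<Sum>j\<in>UNIV. \<Sum>i\<in>UNIV. cnj (M$i$j) * (x$i * cnj (x$j)))"
    by (subst sum.swap) simp
  also have "\<dots> = x \<bullet> (M\<dagger> *v x)"
    unfolding inner_vec_Re matrix_vector_mult_def
    by (simp add: sum_distrib_left algebra_simps)
  finally show ?thesis .
qed

lemma dyad_mv: "dyad x *v y = (\<Sum>j\<in>UNIV. cnj (x$j) * y$j) *s x"
  by (simp add: vec_eq_iff dyad_def matrix_vector_mult_def sum_distrib_left sum_distrib_right ac_simps)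

lemma quad_dyad: "y \<bullet> (dyad x *v y) = (norm (\<Sum>j\<in>UNIV. cnj (x$j) * y$j))\<^sup>2"
proof -
  define c where "c = (\<Sum>j\<in>UNIV. cnj (x$j) * y$j)"
  have "dyad x *v y = c *s x" by (simp add: c_def dyad_mv)
  hence "y \<bullet> (dyad x *v y) = Re (c * (\<Sum>j\<in>UNIV. cnj (y$j) * x$j))"
    unfolding inner_vec_Re by (simp only: sum_distrib_left vector_smult_component mult.left_commute)
  also have "(\<Sum>j\<in>UNIV. cnj (y$j) * x$j) = cnj c"
    by (simp add: c_def ac_simps)
  finally show ?thesis by (simp add: c_def [symmetric] cmod_power2) (simp add: power2_eq_square)
qed

lemma hermitian_dyad: "hermitian (dyad x)"
  by (simp add: hermitian_def dyad_def vec_eq_iff)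

lemma quad_smult: "(z *s v) \<bullet> (M *v (z *s v)) = (norm z)\<^sup>2 * (v \<bullet> (M *v v))"
  for v :: "complex^'k"
proof -
  have "(z *s v) \<bullet> (M *v (z *s v)) = v \<bullet> (((mat z)\<dagger> ** M ** mat z) *v v)"
    unfolding quad_sandwich by (simp add: mat_mv)
  also have "(mat z)\<dagger> ** M ** mat z = mat (cnj z) ** (mat z ** M)"
    by (simp add: mat_commute matrix_mul_assoc)
  also have "\<dots> = mat (of_real ((norm z)\<^sup>2)) ** M"
    unfolding matrix_mul_assoc mat_mult_mat complex_norm_square by (simp only: mult.commute)
  also have "\<dots> = (norm z)\<^sup>2 *\<^sub>R M"
    by (simp only: vec_eq_iff mat_mm_nth vector_scaleR_component) (simp add: scaleR_conv_of_real)
  finally show ?thesis by (simp add: scaleR_mv_left)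
qed

lemma pos_def_add_psd: "pos_semidef M \<Longrightarrow> pos_def N \<Longrightarrow> pos_def (M + N)"
  unfolding pos_def_def pos_semidef_def
  by (auto simp: hermitian_add matrix_vector_mult_add_rdistrib inner_add_right add_nonneg_pos)

lemma pos_def_scaleR: "pos_def M \<Longrightarrow> r > 0 \<Longrightarrow> pos_def (r *\<^sub>R M)"
  unfolding pos_def_def by (auto simp: hermitian_scaleR scaleR_mv_left)

lemma trace_pos: "pos_def (M::complex^'n^'n) \<Longrightarrow> 0 < mat 1 \<bullet> M"
  unfolding inner_mat1_left by (intro sum_pos pos_def_pos) (auto simp: axis_eq_0_iff)

lemma quad_scalar_matrix: "x \<bullet> (mat (complex_of_real r) *v x) = r * (norm x)\<^sup>2"
proof -
  have "complex_of_real r *s x = r *\<^sub>R x" by (simp add: vec_eq_iff) (simp add: scaleR_conv_of_real)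
  thus ?thesis by (simp add: mat_mv power2_norm_eq_inner)
qed

text \<open>For a nonnegative form, expanding \<open>(x - y)\<^sup>* P (x - y) \<ge> 0\<close> bounds the off-diagonal values by
  the diagonal ones; here \<open>y\<close> is the multiple of \<open>P x\<close> of the same length as \<open>x\<close>.\<close>

lemma psd_norm_mv:
  fixes P :: "complex^'n^'n"
  assumes P: "pos_semidef P" and K: "\<And>x. x \<bullet> (P *v x) \<le> K * (norm x)\<^sup>2"
  shows "norm (P *v x) \<le> K * norm x"
proof (cases "P *v x = 0")
  case True
  have "0 \<le> x \<bullet> (P *v x)" using P by (simp add: pos_semidef_def)
  hence k: "0 \<le> K * (norm x)\<^sup>2" using K[of x] by linarith
  show ?thesis
  proof (cases "x = 0")
    case False
    hence "0 \<le> K" using k by (simp add: zero_le_mult_iff)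
    thus ?thesis using True by simp
  qed simp
next
  case False
  hence x: "x \<noteq> 0" by auto
  define y where "y = (norm x / norm (P *v x)) *\<^sub>R (P *v x)"
  have ny: "norm y = norm x" using False by (simp add: y_def)
  have sym: "x \<bullet> (P *v y) = y \<bullet> (P *v x)"
    using P inner_mv_adj[of x P y] by (simp add: pos_semidef_def hermitian_def inner_commute)
  have "y \<bullet> (P *v x) = norm x * norm (P *v x)"
    using False by (simp add: y_def power2_norm_eq_inner[symmetric] power2_eq_square)
  moreover have "0 \<le> (x - y) \<bullet> (P *v (x - y))" using P by (simp add: pos_semidef_def)
  hence "2 * (y \<bullet> (P *v x)) \<le> x \<bullet> (P *v x) + y \<bullet> (P *v y)"
    by (simp add: matrix_vector_mult_diff_distrib inner_diff_left inner_diff_right sym)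
  moreover have "x \<bullet> (P *v x) \<le> K * (norm x)\<^sup>2" "y \<bullet> (P *v y) \<le> K * (norm x)\<^sup>2"
    using K[of x] K[of y] ny by auto
  moreover have "norm x * (K * norm x) = K * (norm x)\<^sup>2" by (simp add: power2_eq_square)
  ultimately have "norm x * norm (P *v x) \<le> norm x * (K * norm x)" by linarith
  thus ?thesis using x by simp
qed

lemma norm_le_of_operator_bound:
  fixes M :: "complex^'n^'m"
  assumes "\<And>x. norm (M *v x) \<le> K * norm x"
  shows "norm M \<le> real CARD('n) * K"
proof -
  have b: "norm (M *v axis j 1) \<le> K" for j using assms[of "axis j 1"] by simp
  have K: "0 \<le> K" using order_trans[OF norm_ge_zero b] .
  have "(norm M)\<^sup>2 \<le> (\<Sum>j\<in>(UNIV::'n set). K\<^sup>2)"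
    unfolding norm_sq_mat_columns[of M] by (intro sum_mono power_mono b) auto
  also have "\<dots> = real CARD('n) * K\<^sup>2" by simp
  also have "\<dots> \<le> (real CARD('n))\<^sup>2 * K\<^sup>2"
    by (intro mult_right_mono self_le_power) (auto simp: Suc_leI)
  finally show ?thesis
    using K by (intro power2_le_imp_le[of "norm M"]) (auto simp: power_mult_distrib)
qed

text \<open>Polarization, as the case \<open>K = 0\<close> of the preceding operator bound.\<close>

lemma hermitian_quad_eq_0:
  assumes "hermitian M" "\<And>x. x \<bullet> (M *v x) = 0"
  shows "M = 0"
proof (rule matrix_eq_0I)
  fix x
  have "norm (M *v x) \<le> 0 * norm x"
    by (rule psd_norm_mv) (use assms in \<open>auto simp: pos_semidef_def\<close>)
  thus "M *v x = 0" by simp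
qed

lemma hermitian_eq_of_quad:
  assumes "hermitian M" "hermitian N" "\<And>x. x \<bullet> (M *v x) = x \<bullet> (N *v x)"
  shows "M = N"
  using hermitian_quad_eq_0[OF hermitian_diff[OF assms(1,2)]] assms(3)
  by (simp add: mv_diff_left inner_diff_right)

lemma norm_of_gram_eq:
  assumes "F\<dagger> ** F = G\<dagger> ** G" shows "norm (F *v x) = norm (G *v x)"
proof -
  have "(norm (F *v x))\<^sup>2 = (norm (G *v x))\<^sup>2" using assms by (simp add: quad_gram[symmetric])
  thus ?thesis by simp
qed

section \<open>Inverses\<close>

lemma matrix_inv_right: "invertible M \<Longrightarrow> M ** matrix_inv M = mat 1"
  and matrix_inv_left: "invertible M \<Longrightarrow> matrix_inv M ** M = mat 1"
  unfolding invertible_def matrix_inv_def by (metis (mono_tags, lifting) someI_ex)+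

lemma matrix_inv_unique:
  fixes M :: "complex^'n^'n"
  assumes "M ** N = mat 1"
  shows "invertible M" "matrix_inv M = N"
proof -
  show i: "invertible M" using assms invertible_right_inverse by blast
  have "matrix_inv M = matrix_inv M ** (M ** N)" by (simp add: assms)
  also have "\<dots> = N" by (simp add: matrix_mul_assoc matrix_inv_left[OF i])
  finally show "matrix_inv M = N" .
qed

lemma invertible_adj: "invertible (M::complex^'n^'n) \<Longrightarrow> invertible (M\<dagger>)"
  and matrix_inv_adj: "invertible M \<Longrightarrow> matrix_inv (M\<dagger>) = (matrix_inv M)\<dagger>"
  using matrix_inv_unique[of "M\<dagger>" "(matrix_inv M)\<dagger>"]
  by (simp_all add: adj_mult[symmetric] matrix_inv_left)

lemma matrix_inv_mult:
  fixes M N :: "complex^'n^'n"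
  assumes "invertible M" "invertible N"
  shows "matrix_inv (M ** N) = matrix_inv N ** matrix_inv M"
proof (rule matrix_inv_unique)
  have "M ** N ** (matrix_inv N ** matrix_inv M) = M ** (N ** matrix_inv N) ** matrix_inv M"
    by (simp add: matrix_mul_assoc)
  thus "M ** N ** (matrix_inv N ** matrix_inv M) = mat 1"
    using assms by (simp add: matrix_inv_right)
qed

lemma invertible_matrix_inv: "invertible (M::complex^'n^'n) \<Longrightarrow> invertible (matrix_inv M)"
  using matrix_inv_unique matrix_inv_left by blast

text \<open>Cramer's rule makes the entries of an inverse quotients of determinants; continuity,
  holomorphy and rationality of inverses all come from it.\<close>

lemma matrix_inv_cramer:
  fixes M :: "complex^'n^'n"
  assumes "invertible M"
  shows "matrix_inv M $ i $ j = det (\<chi> k l. if l = i then axis j 1 $ k else M $ k $ l) / det M"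
proof -
  have "M *v (matrix_inv M *v axis j 1) = axis j 1"
    by (simp add: matrix_vector_mul_assoc matrix_inv_right[OF assms])
  hence "matrix_inv M *v axis j 1 = (\<chi> i. det (\<chi> k l. if l = i then axis j 1 $ k else M $ k $ l) / det M)"
    using assms by (subst (asm) cramer) (auto simp: invertible_det_nz)
  moreover have "(matrix_inv M *v axis j 1) $ i = matrix_inv M $ i $ j"
    by (simp add: matrix_vector_mult_def axis_def if_distrib cong: if_cong)
  ultimately show ?thesis by simp
qed

lemma continuous_on_det:
  fixes M :: "'a::topological_space \<Rightarrow> complex^'n^'n"
  assumes "\<And>i j. continuous_on S (\<lambda>x. M x $ i $ j)"
  shows "continuous_on S (\<lambda>x. det (M x))"
  unfolding det_def by (intro continuous_intros assms)

lemma holomorphic_on_det: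
  fixes M :: "complex \<Rightarrow> complex^'n^'n"
  assumes "\<And>i j. (\<lambda>x. M x $ i $ j) holomorphic_on S"
  shows "(\<lambda>x. det (M x)) holomorphic_on S"
  unfolding det_def by (intro holomorphic_intros assms)

lemma continuous_on_matrix_inv:
  fixes M :: "'a::topological_space \<Rightarrow> complex^'n^'n"
  assumes "continuous_on S M" "\<And>x. x \<in> S \<Longrightarrow> invertible (M x)"
  shows "continuous_on S (\<lambda>x. matrix_inv (M x))"
proof -
  have c: "continuous_on S (\<lambda>x. M x $ i $ j)" for i j
    using assms(1) by (intro continuous_intros)
  have c': "continuous_on S (\<lambda>x. if b then e else M x $ k $ l)" for b e k l
    using c by (cases b) auto
  have "continuous_on S (\<lambda>x. (\<chi> i j. det (\<chi> k l. if l = i then axis j 1 $ k else M x $ k $ l) / det (M x)))"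
    by (intro continuous_on_vec_lambda continuous_on_divide continuous_on_det)
       (use assms(2) in \<open>auto simp: c c' invertible_det_nz\<close>)
  thus ?thesis
    by (rule continuous_on_eq) (simp add: vec_eq_iff matrix_inv_cramer assms(2))
qed

lemma holomorphic_on_matrix_inv:
  fixes M :: "complex \<Rightarrow> complex^'n^'n"
  assumes "\<And>i j. (\<lambda>x. M x $ i $ j) holomorphic_on S" "\<And>x. x \<in> S \<Longrightarrow> invertible (M x)"
  shows "(\<lambda>x. matrix_inv (M x) $ i $ j) holomorphic_on S"
proof -
  have h: "(\<lambda>x. if b then e else M x $ k $ l) holomorphic_on S" for b e k l
    using assms(1) by (cases b) auto
  have "(\<lambda>x. det (\<chi> k l. if l = i then axis j 1 $ k else M x $ k $ l) / det (M x)) holomorphic_on S"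
    by (intro holomorphic_on_divide holomorphic_on_det)
       (use assms in \<open>auto simp: h invertible_det_nz\<close>)
  thus ?thesis
    by (rule holomorphic_transform) (simp add: matrix_inv_cramer assms(2))
qed

lemma tendsto_matrix_inv:
  fixes M :: "'a \<Rightarrow> complex^'n^'n"
  assumes "(M \<longlongrightarrow> L) F" "invertible L"
  shows "((\<lambda>x. matrix_inv (M x)) \<longlongrightarrow> matrix_inv L) F"
proof -
  let ?S = "{M :: complex^'n^'n. det M \<noteq> 0}"
  have "open ?S"
    by (intro open_Collect_neq continuous_on_det continuous_intros)
  moreover have "continuous_on ?S matrix_inv"
    by (intro continuous_on_matrix_inv continuous_intros) (auto simp: invertible_det_nz)
  ultimately have "isCont matrix_inv L"
    using assms(2) by (simp add: continuous_on_eq_continuous_at invertible_det_nz)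
  thus ?thesis using assms(1) by (rule isCont_tendsto_compose)
qed

lemma pos_def_inverse: "pos_def (M :: complex^'k^'k) \<Longrightarrow> pos_def (matrix_inv M)"
proof -
  assume M: "pos_def M"
  note i = pos_def_invertible[OF M]
  have h: "hermitian (matrix_inv M)"
    using pos_def_hermitian[OF M] matrix_inv_adj[OF i] by (simp add: hermitian_def)
  have "pos_def ((matrix_inv M)\<dagger> ** M ** matrix_inv M)"
    using M invertible_inj[OF invertible_matrix_inv[OF i]] by (rule pos_def_sandwich)
  thus ?thesis
    using h by (simp add: hermitian_def matrix_inv_left[OF i])
qed


section \<open>Triangular factors\<close>

definition pos_diag :: "complex^'m^'m \<Rightarrow> bool" where
  "pos_diag L \<longleftrightarrow> (\<forall>i. L $ i $ i \<in> \<real> \<and> 0 < Re (L $ i $ i))"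

lemma gram_nth: "(L\<dagger> ** L) $ i $ k = (\<Sum>j\<in>UNIV. cnj (L$j$i) * L$j$k)"
  by (simp add: matrix_matrix_mult_def)

text \<open>In \<open>L\<^sup>* L\<close> with \<open>L\<close> lower triangular, row \<open>i\<close> of the product involves only the rows \<open>j \<ge> i\<close> of
  \<open>L\<close>. Hence the rows are determined one after the other from the last one upwards. The diagonal of
  one factor is only asked to be nonnegative: this survives limits, and the diagonal turns out to be
  positive by comparison with the other factor.\<close>

lemma triangular_factor_unique:
  fixes L L' :: "complex^('m::{finite,linorder})^('m::{finite,linorder})"
  assumes L: "lower_triangular L" "\<And>i. L $ i $ i \<in> \<real> \<and> 0 \<le> Re (L $ i $ i)"
    and L': "lower_triangular L'" "pos_diag L'"
    and eq: "L\<dagger> ** L = L'\<dagger> ** L'"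
  shows "L = L'"
proof -
  have "\<forall>k. L$i$k = L'$i$k" for i
  proof (induction i rule: measure_induct_rule[of "\<lambda>i. card {j. i < j}"])
    case (less i)
    have IH: "L$j$k = L'$j$k" if "i < j" for j k
    proof -
      have "{l. j < l} \<subset> {l. i < l}" using that by auto
      hence "card {l. j < l} < card {l. i < l}" by (simp add: psubset_card_mono)
      thus ?thesis using less by blast
    qed
    have split: "(M\<dagger> ** M) $ i $ k = cnj (M$i$i) * M$i$k + (\<Sum>j\<in>{j. i < j}. cnj (M$j$i) * M$j$k)"
      if "lower_triangular M" for M :: "complex^('m::{finite,linorder})^('m::{finite,linorder})" and k
    proof -
      have "(M\<dagger> ** M) $ i $ k = (\<Sum>j\<in>insert i {j. i < j}. cnj (M$j$i) * M$j$k)"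
        unfolding gram_nth by (rule sum.mono_neutral_right)
          (use that in \<open>auto simp: lower_triangular_def not_less\<close>)
      thus ?thesis by (subst (asm) sum.insert) auto
    qed
    have e: "cnj (L$i$i) * L$i$k = cnj (L'$i$i) * L'$i$k" for k
    proof -
      have "(\<Sum>j\<in>{j. i < j}. cnj (L$j$i) * L$j$k) = (\<Sum>j\<in>{j. i < j}. cnj (L'$j$i) * L'$j$k)"
        by (rule sum.cong) (auto simp: IH)
      thus ?thesis using eq split[OF L(1), of k] split[OF L'(1), of k] by simp
    qed
    obtain a b where ab: "L$i$i = of_real a" "L'$i$i = of_real b" "a \<ge> 0" "b > 0"
      using L(2) L'(2) unfolding pos_diag_def by (metis Reals_cases Re_complex_of_real)
    have "complex_of_real (a * a) = of_real (b * b)" using e[of i] by (simp add: ab)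
    hence "a * a = b * b" by (simp only: of_real_eq_iff)
    hence "a = b" using ab by (metis order_less_imp_le power2_eq_imp_eq power2_eq_square)
    thus ?case using e ab by auto
  qed
  thus ?thesis by (simp add: vec_eq_iff)
qed

lemma hermitian_diag: "hermitian N \<Longrightarrow> N $ i $ i = of_real (Re (N $ i $ i))"
proof -
  assume "hermitian N"
  hence "N\<dagger> $ i $ i = N $ i $ i" by (simp only: hermitian_def)
  thus ?thesis by (simp add: complex_eq_iff)
qed

lemma hermitian_nth: "hermitian N \<Longrightarrow> cnj (N $ i $ j) = N $ j $ i"
  unfolding hermitian_def by (metis adj_nth)

lemma inner_axis_complex: "axis l a \<bullet> (v::complex^'m) = Re (cnj a * v $ l)"
  by (simp add: inner_axis' inner_complex_Re)

lemma mv_axis_nth: "((N::complex^'m^'n) *v axis l a) $ i = N $ i $ l * a"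
  by (simp add: matrix_vector_mult_def axis_def if_distrib cong: if_cong)

text \<open>Completing the square: the Schur complement is the minimum of the form over the \<open>l\<close>-th coordinate.\<close>

lemma schur_complement_quad:
  fixes N :: "complex^'m^'m"
  assumes N: "hermitian N" and r: "r > 0" "N $ l $ l = of_real (r\<^sup>2)"
  shows "x \<bullet> ((N - dyad (\<chi> j. cnj (N $ l $ j / of_real r))) *v x)
    = (x - axis l ((N *v x) $ l / of_real (r\<^sup>2))) \<bullet> (N *v (x - axis l ((N *v x) $ l / of_real (r\<^sup>2))))"
proof -
  define s where "s = (N *v x) $ l"
  define a where "a = s / of_real (r\<^sup>2)"
  have sym: "x \<bullet> (N *v axis l a) = axis l a \<bullet> (N *v x)"
    using N inner_mv_adj[of x N "axis l a"] by (simp add: hermitian_def inner_commute)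
  have "(x - axis l a) \<bullet> (N *v (x - axis l a))
    = x \<bullet> (N *v x) - 2 * (axis l a \<bullet> (N *v x)) + axis l a \<bullet> (N *v axis l a)"
    by (simp add: matrix_vector_mult_diff_distrib inner_diff_left inner_diff_right sym)
  also have "axis l a \<bullet> (N *v x) = (norm s)\<^sup>2 / r\<^sup>2"
    by (simp add: inner_axis_complex s_def[symmetric] a_def cmod_power2) (simp add: power2_eq_square)
  also have "axis l a \<bullet> (N *v axis l a) = (norm s)\<^sup>2 / r\<^sup>2"
    using r(1) by (simp add: inner_axis_complex mv_axis_nth r(2) a_def cmod_power2) (simp add: power2_eq_square field_simps)
  also have "x \<bullet> (N *v x) - 2 * ((norm s)\<^sup>2 / r\<^sup>2) + (norm s)\<^sup>2 / r\<^sup>2 = x \<bullet> (N *v x) - (norm s)\<^sup>2 / r\<^sup>2"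
    by simp
  also have "(norm s)\<^sup>2 / r\<^sup>2 = x \<bullet> (dyad (\<chi> j. cnj (N $ l $ j / of_real r)) *v x)"
  proof -
    have "(\<Sum>j\<in>UNIV. N $ l $ j / of_real r * x $ j) = s / of_real r"
      by (simp add: s_def matrix_vector_mult_def sum_divide_distrib)
    thus ?thesis using r(1) by (simp add: quad_dyad norm_divide power_divide)
  qed
  finally show ?thesis
    unfolding s_def[symmetric] a_def[symmetric] by (simp only: mv_diff_left inner_diff_right)
qed

text \<open>Cholesky factorization with the factors in the order \<open>R\<^sup>* R\<close>. The induction splits off the largest
  index \<open>l\<close>: the last row of \<open>R\<close> is forced, and the remaining rows factor the Schur complement.\<close>

lemma triangular_factor_exists_on:
  fixes N :: "complex^('m::{finite,linorder})^('m::{finite,linorder})"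
  assumes "finite J" "hermitian N"
    and "\<And>x. x \<noteq> 0 \<Longrightarrow> (\<forall>i. i \<notin> J \<longrightarrow> x $ i = 0) \<Longrightarrow> 0 < x \<bullet> (N *v x)"
  shows "\<exists>R. lower_triangular R \<and> (\<forall>i\<in>J. R $ i $ i \<in> \<real> \<and> 0 < Re (R $ i $ i))
    \<and> (\<forall>i. i \<notin> J \<longrightarrow> R $ i = 0) \<and> (\<forall>j\<in>J. \<forall>k\<in>J. (R\<dagger> ** R) $ j $ k = N $ j $ k)"
  using assms
proof (induction J arbitrary: N rule: finite_linorder_max_induct)
  case empty
  show ?case by (intro exI[of _ 0]) (auto simp: lower_triangular_def)
next
  case (insert l J)
  define r where "r = sqrt (Re (N $ l $ l))"
  have "0 < axis l 1 \<bullet> (N *v axis l 1)"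
    by (rule insert.prems(2)) (auto simp: axis_def vec_eq_iff)
  hence pos: "0 < Re (N $ l $ l)" by (simp add: inner_axis_complex mv_axis_nth)
  hence r: "r > 0" "N $ l $ l = of_real (r\<^sup>2)"
    using hermitian_diag[OF insert.prems(1), of l] by (auto simp: r_def)
  define \<rho> where "\<rho> j = N $ l $ j / of_real r" for j
  define N' where "N' = N - dyad (\<chi> j. cnj (\<rho> j))"
  have "hermitian N'" unfolding N'_def by (intro hermitian_diff insert.prems hermitian_dyad)
  moreover have "0 < x \<bullet> (N' *v x)" if x: "x \<noteq> 0" "\<forall>i. i \<notin> J \<longrightarrow> x $ i = 0" for x
  proof -
    define y where "y = x - axis l ((N *v x) $ l / of_real (r\<^sup>2))"
    obtain i where i: "x $ i \<noteq> 0" using x(1) by (auto simp: vec_eq_iff)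
    hence "i \<in> J" using x(2) by auto
    hence "i \<noteq> l" using insert.hyps(2) by auto
    hence "y $ i = x $ i" by (simp add: y_def axis_def)
    hence "y \<noteq> 0" using i by auto
    moreover have "\<forall>i. i \<notin> insert l J \<longrightarrow> y $ i = 0" using x(2) by (auto simp: y_def axis_def)
    ultimately have "0 < y \<bullet> (N *v y)" by (rule insert.prems(2))
    thus ?thesis using schur_complement_quad[OF insert.prems(1) r, of x]
      unfolding N'_def \<rho>_def y_def by simp
  qed
  ultimately obtain R' where R': "lower_triangular R'" "\<And>i. i \<in> J \<Longrightarrow> R' $ i $ i \<in> \<real> \<and> 0 < Re (R' $ i $ i)"
    "\<And>i. i \<notin> J \<Longrightarrow> R' $ i = 0" "\<And>j k. j \<in> J \<Longrightarrow> k \<in> J \<Longrightarrow> (R'\<dagger> ** R') $ j $ k = N' $ j $ k"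
    using insert.IH[of N'] by blast
  have lJ: "l \<notin> J" using insert.hyps by auto
  define R :: "complex^('m::{finite,linorder})^('m::{finite,linorder})" where
    "R = (\<chi> i k. if i = l then (if k \<in> insert l J then \<rho> k else 0) else R' $ i $ k)"
  have Rl: "R $ l $ k = \<rho> k" if "k \<in> insert l J" for k using that by (simp add: R_def)
  have Ri: "R $ i = R' $ i" if "i \<noteq> l" for i using that by (simp add: R_def vec_eq_iff)
  have \<rho>l: "\<rho> l = of_real r" using r by (simp add: \<rho>_def power2_eq_square)
  have R'l: "R' $ i $ l = 0" for i
    using R'(1,3) insert.hyps(2) by (cases "i \<in> J") (auto simp: lower_triangular_def)
  have gram: "(R\<dagger> ** R) $ j $ k = cnj (\<rho> j) * \<rho> k + (R'\<dagger> ** R') $ j $ k"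
    if "j \<in> insert l J" "k \<in> insert l J" for j k
  proof -
    have "(R\<dagger> ** R) $ j $ k = cnj (R $ l $ j) * R $ l $ k + (\<Sum>i\<in>UNIV - {l}. cnj (R$i$j) * R$i$k)"
      unfolding gram_nth by (rule sum.remove) auto
    also have "(\<Sum>i\<in>UNIV - {l}. cnj (R$i$j) * R$i$k) = (\<Sum>i\<in>UNIV - {l}. cnj (R'$i$j) * R'$i$k)"
      by (rule sum.cong) (auto simp: Ri)
    also have "\<dots> = (R'\<dagger> ** R') $ j $ k"
      unfolding gram_nth by (rule sum.mono_neutral_left) (auto simp: R'(3) lJ)
    finally show ?thesis using that by (simp add: Rl)
  qed
  have "lower_triangular R"
    unfolding lower_triangular_def
  proof (intro allI impI)
    fix i j :: 'm assume "i < j"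
    thus "R $ i $ j = 0" using R'(1) insert.hyps(2)
      by (cases "i = l") (auto simp: R_def lower_triangular_def)
  qed
  moreover have "R $ i $ i \<in> \<real> \<and> 0 < Re (R $ i $ i)" if "i \<in> insert l J" for i
    using that r(1) R'(2) lJ by (cases "i = l") (auto simp: Rl \<rho>l Ri)
  moreover have "R $ i = 0" if "i \<notin> insert l J" for i
    using that R'(3) by (simp add: Ri)
  moreover have "(R\<dagger> ** R) $ j $ k = N $ j $ k" if jk: "j \<in> insert l J" "k \<in> insert l J" for j k
  proof -
    have g0: "(R'\<dagger> ** R') $ j $ k = 0" if "j = l \<or> k = l"
      using that by (auto simp: gram_nth R'l)
    consider "j = l" | "k = l" | "j \<in> J" "k \<in> J" using jk by auto
    thus ?thesis
    proof cases
      case 1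
      hence "(R\<dagger> ** R) $ j $ k = of_real r * \<rho> k" using gram[OF jk] g0 \<rho>l by simp
      thus ?thesis using 1 r(1) by (simp add: \<rho>_def)
    next
      case 2
      hence "(R\<dagger> ** R) $ j $ k = cnj (\<rho> j) * of_real r" using gram[OF jk] g0 \<rho>l by simp
      thus ?thesis using 2 r(1)
        by (simp add: \<rho>_def hermitian_nth[OF insert.prems(1)])
    next
      case 3 thus ?thesis using gram[OF jk] R'(4) by (simp add: N'_def dyad_def)
    qed
  qed
  ultimately show ?case by blast
qed

lemma triangular_factor_exists:
  fixes N :: "complex^('m::{finite,linorder})^('m::{finite,linorder})"
  assumes "pos_def N"
  obtains R where "lower_triangular R" "pos_diag R" "R\<dagger> ** R = N" "invertible R"
proof -
  obtain R where R: "lower_triangular R" "pos_diag R" "R\<dagger> ** R = N"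
    using triangular_factor_exists_on[of UNIV N] assms
    by (auto simp: pos_def_def pos_diag_def vec_eq_iff)
  have "R *v x = 0 \<Longrightarrow> x = 0" for x
    using invertible_inj[OF pos_def_invertible[OF assms], of x]
    by (simp add: R(3)[symmetric] matrix_vector_mul_assoc[symmetric])
  with R that inj_invertible show thesis by blast
qed

section \<open>Analytic matrix functions on the closed disc\<close>

text \<open>The coordinate on the disc is \<open>w = 1/z\<close>, so that functions analytic on the outside of the circle and at
  infinity become analytic on the closed disc, with \<open>\<infinity>\<close> at the centre.\<close>

definition disc_analytic :: "(complex \<Rightarrow> complex^'n^'m) \<Rightarrow> bool" where
  "disc_analytic F \<longleftrightarrow> (\<forall>i j. (\<lambda>w. F w $ i $ j) analytic_on cball 0 1)"

lemma disc_analytic_mult: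
  "disc_analytic F \<Longrightarrow> disc_analytic G \<Longrightarrow> disc_analytic (\<lambda>w. F w ** G w)"
  unfolding disc_analytic_def matrix_matrix_mult_def
  by (auto intro!: analytic_on_sum analytic_on_mult)

lemma disc_analytic_const: "disc_analytic (\<lambda>w. M)"
  by (simp add: disc_analytic_def)

lemma disc_analytic_continuous: "disc_analytic F \<Longrightarrow> continuous_on (cball 0 1) F"
  unfolding disc_analytic_def
  by (intro continuous_on_vec_lambda[of _ "\<lambda>i w. F w $ i", simplified]
        continuous_on_vec_lambda[of _ "\<lambda>j w. F w $ _ $ j", simplified])
     (simp add: analytic_imp_holomorphic holomorphic_on_imp_continuous_on)

text \<open>The finitely many entries share one open neighbourhood of the disc, and the determinant is nonzero
  on a smaller one.\<close>

lemma disc_analytic_inv: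
  fixes F :: "complex \<Rightarrow> complex^'n^'n"
  assumes "disc_analytic F" "\<And>w. w \<in> cball 0 1 \<Longrightarrow> invertible (F w)"
  shows "disc_analytic (\<lambda>w. matrix_inv (F w))"
  unfolding disc_analytic_def
proof (intro allI)
  fix i j
  have "\<exists>U. open U \<and> cball 0 1 \<subseteq> U \<and> (\<forall>i j. (\<lambda>w. F w $ i $ j) holomorphic_on U)"
  proof -
    have "\<forall>i j. \<exists>U. open U \<and> cball 0 1 \<subseteq> U \<and> (\<lambda>w. F w $ i $ j) holomorphic_on U"
      using assms(1) unfolding disc_analytic_def analytic_on_holomorphic by blast
    then obtain U where U: "\<And>i j. open (U i j) \<and> cball 0 1 \<subseteq> U i j \<and> (\<lambda>w. F w $ i $ j) holomorphic_on U i j"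
      by metis
    have "open (\<Inter>i. \<Inter>j. U i j)" using U by (intro open_INT) auto
    thus ?thesis using U
      by (intro exI[of _ "\<Inter>i. \<Inter>j. U i j"]) (auto intro: holomorphic_on_subset)
  qed
  then obtain U where U: "open U" "cball 0 1 \<subseteq> U" "\<And>i j. (\<lambda>w. F w $ i $ j) holomorphic_on U" by blast
  define V where "V = {w \<in> U. det (F w) \<noteq> 0}"
  have "continuous_on U (\<lambda>w. det (F w))"
    by (intro continuous_on_det holomorphic_on_imp_continuous_on U)
  hence "open ((\<lambda>w. det (F w)) -` (- {0}) \<inter> U)"
    using U(1) by (simp add: continuous_on_open_vimage open_Compl)
  moreover have "V = (\<lambda>w. det (F w)) -` (- {0}) \<inter> U" by (auto simp: V_def)
  ultimately have "open V" by simp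
  moreover have "cball 0 1 \<subseteq> V" using U(2) assms(2) by (auto simp: V_def invertible_det_nz)
  moreover have "(\<lambda>w. matrix_inv (F w) $ i $ j) holomorphic_on V"
    by (rule holomorphic_on_matrix_inv)
       (use U(3) in \<open>auto simp: V_def invertible_det_nz intro: holomorphic_on_subset\<close>)
  ultimately show "(\<lambda>w. matrix_inv (F w) $ i $ j) analytic_on cball 0 1"
    unfolding analytic_on_holomorphic by blast
qed

lemma norm_cinner_le: "norm (\<Sum>i\<in>UNIV. cnj ((x::complex^'n) $ i) * y $ i) \<le> norm x * norm y"
proof -
  have "norm (\<Sum>i\<in>UNIV. cnj (x$i) * y$i) \<le> (\<Sum>i\<in>UNIV. \<bar>norm (x$i)\<bar> * \<bar>norm (y$i)\<bar>)"
    by (rule sum_norm_le) (simp add: norm_mult)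
  also have "\<dots> \<le> L2_set (\<lambda>i. norm (x$i)) UNIV * L2_set (\<lambda>i. norm (y$i)) UNIV"
    by (rule L2_set_mult_ineq)
  finally show ?thesis by (simp add: norm_vec_def)
qed

lemma cinner_self: "(\<Sum>i\<in>UNIV. cnj ((x::complex^'n) $ i) * x $ i) = of_real ((norm x)\<^sup>2)"
  by (simp add: norm_sq_vec mult.commute[of "cnj _"] complex_norm_square[symmetric])

text \<open>The scalar maximum principle is applied to \<open>v \<mapsto> x\<^sup>* F(v) y\<close> with \<open>x = F(w) y\<close>, whose value at \<open>w\<close> is
  \<open>\<bar>F(w) y\<bar>\<^sup>2\<close>.\<close>

lemma maximum_modulus_matrix:
  fixes F :: "complex \<Rightarrow> complex^'n^'m"
  assumes F: "disc_analytic F" and b: "\<And>z y. z \<in> sphere 0 1 \<Longrightarrow> norm (F z *v y) \<le> c * norm y"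
    and w: "w \<in> cball 0 1"
  shows "norm (F w *v y) \<le> c * norm y"
proof (cases "F w *v y = 0")
  case True
  have "0 \<le> norm (F 1 *v y)" by simp
  also have "\<dots> \<le> c * norm y" by (rule b) auto
  finally show ?thesis using True by simp
next
  case False
  define x where "x = F w *v y"
  define f where "f v = (\<Sum>i\<in>UNIV. cnj (x $ i) * (F v *v y) $ i)" for v
  have an: "f analytic_on cball 0 1"
    unfolding f_def matrix_vector_mult_def vec_lambda_beta
    using F[unfolded disc_analytic_def] by (intro analytic_intros) auto
  have "norm (f w) \<le> norm x * (c * norm y)"
  proof (rule maximum_modulus_frontier[of f "cball 0 1"])
    show "f holomorphic_on interior (cball 0 1)"
      by (meson an analytic_imp_holomorphic holomorphic_on_subset interior_subset)
    show "continuous_on (closure (cball 0 1)) f"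
      using an by (simp add: analytic_imp_holomorphic holomorphic_on_imp_continuous_on)
    fix z :: complex assume "z \<in> frontier (cball 0 1)"
    hence z: "z \<in> sphere 0 1" by (simp add: frontier_cball)
    have "norm (f z) \<le> norm x * norm (F z *v y)" unfolding f_def by (rule norm_cinner_le)
    also have "\<dots> \<le> norm x * (c * norm y)" by (intro mult_left_mono b z) auto
    finally show "norm (f z) \<le> norm x * (c * norm y)" .
  qed (use w in auto)
  moreover have "norm (f w) = norm x * norm x"
    by (simp add: f_def x_def[symmetric] cinner_self power2_eq_square norm_mult)
  ultimately have "norm x \<le> c * norm y"
    using False by (simp add: x_def)
  thus ?thesis by (simp add: x_def)
qed


section \<open>Integration over the circle\<close>

definition circle_measurable :: "(complex \<Rightarrow> 'a::euclidean_space) \<Rightarrow> bool" where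
  "circle_measurable F \<longleftrightarrow> (\<lambda>t. F (cis t)) \<in> borel_measurable (lebesgue_on {0..2*pi})"

definition circle_integrable :: "(complex \<Rightarrow> 'a::euclidean_space) \<Rightarrow> bool" where
  "circle_integrable F \<longleftrightarrow> integrable (lebesgue_on {0..2*pi}) (\<lambda>t. F (cis t))"

lemma continuous_on_circle_cis:
  "continuous_on (sphere 0 1) F \<Longrightarrow> continuous_on S (\<lambda>t. F (cis t))"
  by (rule continuous_on_compose2[of "sphere 0 1" F]) (auto intro!: continuous_intros)

lemma circle_measurable_continuous: "continuous_on (sphere 0 1) F \<Longrightarrow> circle_measurable F"
  unfolding circle_measurable_def
  by (intro continuous_imp_measurable_on_sets_lebesgue continuous_on_circle_cis) auto

lemma circle_measurable_continuous_Pair: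
  fixes F :: "complex \<Rightarrow> 'a::euclidean_space" and G :: "complex \<Rightarrow> 'b::euclidean_space"
    and T :: "'a \<Rightarrow> 'b \<Rightarrow> 'c::euclidean_space"
  assumes "circle_measurable F" "circle_measurable G" "continuous_on UNIV (\<lambda>p. T (fst p) (snd p))"
  shows "circle_measurable (\<lambda>z. T (F z) (G z))"
  using assms unfolding circle_measurable_def by (rule borel_measurable_continuous_Pair)

lemma circle_measurable_mm:
  fixes F :: "complex \<Rightarrow> complex^'n^'m" and G :: "complex \<Rightarrow> complex^'k^'n"
  shows "circle_measurable F \<Longrightarrow> circle_measurable G \<Longrightarrow> circle_measurable (\<lambda>z. F z ** G z)"
  by (rule circle_measurable_continuous_Pair) (auto intro!: continuous_intros)

lemma circle_integrable_bounded:
  assumes "circle_measurable F" "\<And>z. z \<in> sphere 0 1 \<Longrightarrow> norm (F z) \<le> K"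
  shows "circle_integrable F"
  unfolding circle_integrable_def
proof (rule Bochner_Integration.integrable_bound[where f = "\<lambda>_. K"])
  show "integrable (lebesgue_on {0..2*pi}) (\<lambda>_. K)"
    by (rule finite_measure.integrable_const) (simp add: finite_measure_lebesgue_on)
  show "AE x in lebesgue_on {0..2*pi}. norm (F (cis x)) \<le> norm K"
  proof (rule AE_I2)
    fix x have "norm (F (cis x)) \<le> K" by (rule assms) simp
    thus "norm (F (cis x)) \<le> norm K" by simp
  qed
qed (use assms in \<open>simp add: circle_measurable_def\<close>)

lemma circle_integrable_continuous: "continuous_on (sphere 0 1) F \<Longrightarrow> circle_integrable F"
proof -
  assume F: "continuous_on (sphere 0 1) F"
  hence "compact (F ` sphere 0 1)" by (rule compact_continuous_image) simp
  then obtain K where "\<And>z. z \<in> sphere 0 1 \<Longrightarrow> norm (F z) \<le> K"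
    by (meson bounded_iff compact_imp_bounded imageI)
  thus ?thesis using F by (intro circle_integrable_bounded circle_measurable_continuous)
qed

lemma
  assumes "bounded_linear T" "circle_integrable F"
  shows circle_integrable_linear: "circle_integrable (\<lambda>z. T (F z))"
    and circle_integral_linear: "circle_integral (\<lambda>z. T (F z)) = T (circle_integral F)"
proof -
  interpret bounded_linear T by fact
  show "circle_integrable (\<lambda>z. T (F z))"
    using assms unfolding circle_integrable_def by (rule integrable_bounded_linear)
  show "circle_integral (\<lambda>z. T (F z)) = T (circle_integral F)"
    using assms unfolding circle_integral_def circle_integrable_def
    using integral_bounded_linear[of T "lebesgue_on {0..2*pi}" "\<lambda>t. F (cis t)"]
    by (simp add: scaleR)
qed

lemma circle_integrable_add: "circle_integrable F \<Longrightarrow> circle_integrable G \<Longrightarrow> circle_integrable (\<lambda>z. F z + G z)"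
  and circle_integrable_diff: "circle_integrable F \<Longrightarrow> circle_integrable G \<Longrightarrow> circle_integrable (\<lambda>z. F z - G z)"
  and circle_integral_add: "circle_integrable F \<Longrightarrow> circle_integrable G \<Longrightarrow>
    circle_integral (\<lambda>z. F z + G z) = circle_integral F + circle_integral G"
  and circle_integral_diff: "circle_integrable F \<Longrightarrow> circle_integrable G \<Longrightarrow>
    circle_integral (\<lambda>z. F z - G z) = circle_integral F - circle_integral G"
  by (simp_all add: circle_integrable_def circle_integral_def scaleR_add_right scaleR_diff_right)

lemma circle_integral_cong: "(\<And>z. z \<in> sphere 0 1 \<Longrightarrow> F z = G z) \<Longrightarrow> circle_integral F = circle_integral G"
  by (simp add: circle_integral_def)

lemma circle_integrable_const: "circle_integrable (\<lambda>_. c)"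
  by (rule circle_integrable_continuous) simp

lemma circle_integral_const: "circle_integral (\<lambda>_. c) = (c::'a::euclidean_space)"
  by (simp add: circle_integral_def measure_restrict_space)

lemma circle_integral_mono:
  fixes f g :: "complex \<Rightarrow> real"
  assumes "circle_integrable f" "circle_integrable g" "\<And>z. z \<in> sphere 0 1 \<Longrightarrow> f z \<le> g z"
  shows "circle_integral f \<le> circle_integral g"
  using assms unfolding circle_integral_def circle_integrable_def
  by (intro scaleR_left_mono integral_mono) auto

lemma circle_integral_nonneg:
  fixes f :: "complex \<Rightarrow> real"
  assumes "\<And>z. z \<in> sphere 0 1 \<Longrightarrow> 0 \<le> f z"
  shows "0 \<le> circle_integral f"
  using assms unfolding circle_integral_def by simp

lemma circle_integral_has_integral:
  assumes "circle_integrable F"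
  shows "((\<lambda>t. F (cis t)) has_integral (2 * pi) *\<^sub>R circle_integral F) {0..2*pi}"
proof -
  have "(\<lambda>t. F (cis t)) integrable_on {0..2*pi}"
    using assms unfolding circle_integrable_def by (intro integrable_on_lebesgue_on) auto
  moreover have "integral\<^sup>L (lebesgue_on {0..2*pi}) (\<lambda>t. F (cis t)) = integral {0..2*pi} (\<lambda>t. F (cis t))"
    using assms unfolding circle_integrable_def by (intro lebesgue_integral_eq_integral) auto
  ultimately show ?thesis
    by (simp add: circle_integral_def has_integral_iff)
qed

lemma circle_point:
  assumes "z \<in> sphere (0::complex) 1"
  obtains t where "t \<in> {0..2*pi}" "z = cis t"
proof
  show "Arg2pi z \<in> {0..2*pi}" using Arg2pi[of z] by auto
  show "z = cis (Arg2pi z)" using assms Arg2pi_eq[of z] by (simp add: cis_conv_exp)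
qed

lemma circle_integral_0_imp:
  fixes f :: "complex \<Rightarrow> real"
  assumes f: "continuous_on (sphere 0 1) f" "\<And>z. z \<in> sphere 0 1 \<Longrightarrow> 0 \<le> f z"
    and 0: "circle_integral f = 0" and z: "z \<in> sphere 0 1"
  shows "f z = 0"
proof -
  obtain t where t: "t \<in> {0..2*pi}" "z = cis t" using circle_point[OF z] .
  have "((\<lambda>t. f (cis t)) has_integral 0) (cbox 0 (2*pi))"
    using circle_integral_has_integral[OF circle_integrable_continuous[OF f(1)]] 0 by simp
  hence "f (cis t) = 0"
    by (intro has_integral_0_cbox_imp_0[of 0 "2*pi" "\<lambda>t. f (cis t)"])
       (use t f pi_gt_zero in \<open>auto intro!: continuous_on_circle_cis simp: not_le\<close>)
  thus ?thesis using t by simp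
qed

text \<open>Cauchy's formula at the centre, written in the angle.\<close>

lemma circle_integral_mean_value:
  assumes "f analytic_on cball 0 1"
  shows "circle_integral f = f 0"
proof -
  have hol: "f holomorphic_on cball 0 1" using assms by (rule analytic_imp_holomorphic)
  have "((\<lambda>u. f u / (u - 0)) has_contour_integral (2 * of_real pi * \<i> * f 0)) (circlepath 0 1)"
    by (rule Cauchy_integral_circlepath_simple[OF hol]) simp
  hence "((\<lambda>t. f (cis t) / cis t * \<i> * cis t) has_integral (2 * of_real pi * \<i> * f 0)) {0..2*pi}"
    unfolding circlepath_def by (subst (asm) has_contour_integral_part_circlepath_iff) auto
  hence "((\<lambda>t. f (cis t) * \<i> ) has_integral (2 * of_real pi * \<i> * f 0)) {0..2*pi}"
    by (simp add: field_simps)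
  hence "((\<lambda>t. f (cis t) * \<i> * - \<i>) has_integral (2 * of_real pi * \<i> * f 0) * - \<i>) {0..2*pi}"
    by (rule has_integral_mult_left)
  hence "((\<lambda>t. f (cis t)) has_integral (2 * of_real pi * f 0)) {0..2*pi}"
    by (simp add: algebra_simps)
  moreover have "((\<lambda>t. f (cis t)) has_integral (2 * pi) *\<^sub>R circle_integral f) {0..2*pi}"
    using hol by (intro circle_integral_has_integral circle_integrable_continuous)
      (meson holomorphic_on_imp_continuous_on holomorphic_on_subset sphere_cball)
  ultimately have "(2 * pi) *\<^sub>R circle_integral f = 2 * of_real pi * f 0"
    by (rule has_integral_unique[rotated])
  thus ?thesis by (simp add: scaleR_conv_of_real)
qed

lemma disc_analytic_continuous_circle: "disc_analytic F \<Longrightarrow> continuous_on (sphere 0 1) F"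
  using disc_analytic_continuous continuous_on_subset sphere_cball by blast

lemma bounded_linear_entry: "bounded_linear (\<lambda>M :: complex^'n^'m. M $ i $ j)"
  by (rule bounded_linear_compose[OF bounded_linear_vec_nth bounded_linear_vec_nth])

lemma circle_integral_disc_analytic:
  assumes "disc_analytic F"
  shows "circle_integral F = F 0"
proof -
  have int: "circle_integrable F"
    using assms by (intro circle_integrable_continuous disc_analytic_continuous_circle)
  have "circle_integral F $ i $ j = F 0 $ i $ j" for i j
    using circle_integral_linear[OF bounded_linear_entry[of i j] int, symmetric]
      circle_integral_mean_value[of "\<lambda>w. F w $ i $ j"] assms
    by (simp add: disc_analytic_def)
  thus ?thesis by (simp add: vec_eq_iff)
qed

section \<open>Resolvents and the Lyapunov equation\<close>

definition stable :: "complex^'n^'n \<Rightarrow> bool" where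
  "stable A \<longleftrightarrow> (\<forall>z. eigenvalue A z \<longrightarrow> norm z < 1)"

text \<open>With \<open>w = 1/z\<close> this is \<open>z (z I - A)\<^sup>-\<^sup>1\<close>, which stays finite at \<open>z = \<infinity>\<close>.\<close>

definition resolv :: "complex^'n^'n \<Rightarrow> complex \<Rightarrow> complex^'n^'n" where
  "resolv A w = matrix_inv (mat 1 - mat w ** A)"

lemma smult_eq_0: "c *s (x::complex^'n) = 0 \<longleftrightarrow> c = 0 \<or> x = 0"
  by (auto simp: vec_eq_iff)

lemma stableD:
  assumes "stable A" "norm w \<le> 1" "x = w *s (A *v x)"
  shows "x = 0"
proof (rule ccontr)
  assume x: "x \<noteq> 0"
  have w: "w \<noteq> 0" using assms(3) x by auto
  have "A *v x = inverse w *s (w *s (A *v x))" using w by (simp add: vector_smult_assoc)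
  hence "A *v x = inverse w *s x" using assms(3) by simp
  hence "norm (inverse w) < 1" using assms(1) x unfolding stable_def eigenvalue_def by blast
  thus False using assms(2) w one_le_inverse[of "norm w"] by (simp add: norm_inverse)
qed

lemma stable_invertible:
  assumes "stable A" "norm w \<le> 1"
  shows "invertible (mat 1 - mat w ** A)"
proof (rule inj_invertible)
  fix x assume "(mat 1 - mat w ** A) *v x = 0"
  hence "x = w *s (A *v x)"
    by (simp add: mv_diff_left matrix_vector_mul_assoc[symmetric] mat_mv)
  thus "x = 0" using assms stableD by blast
qed

lemma stable_adj: assumes "stable A" shows "stable (A\<dagger>)"
  unfolding stable_def
proof (intro allI impI)
  fix z assume "eigenvalue (A\<dagger>) z"
  then obtain v where v: "v \<noteq> 0" "A\<dagger> *v v = z *s v" by (auto simp: eigenvalue_def)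
  hence "(A - mat (cnj z))\<dagger> *v v = 0" by (simp add: adj_diff mv_diff_left mat_mv)
  hence "\<not> invertible ((A - mat (cnj z))\<dagger>)" using v invertible_inj by blast
  hence "\<not> invertible (A - mat (cnj z))" using invertible_adj by blast
  then obtain x where "(A - mat (cnj z)) *v x = 0" "x \<noteq> 0" using inj_invertible by blast
  hence "eigenvalue A (cnj z)" unfolding eigenvalue_def
    by (intro exI[of _ x]) (simp add: mv_diff_left mat_mv)
  thus "norm z < 1" using assms by (auto simp: stable_def)
qed

lemma resolv_right: "stable A \<Longrightarrow> norm w \<le> 1 \<Longrightarrow> mat w ** A ** resolv A w = resolv A w - mat 1"
  and resolv_left: "stable A \<Longrightarrow> norm w \<le> 1 \<Longrightarrow> mat w ** resolv A w ** A = resolv A w - mat 1"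
proof -
  assume a: "stable A" "norm w \<le> 1"
  have "(mat 1 - mat w ** A) ** resolv A w = mat 1"
    unfolding resolv_def by (rule matrix_inv_right[OF stable_invertible[OF a]])
  thus "mat w ** A ** resolv A w = resolv A w - mat 1" by (simp add: mm_diff_left algebra_simps)
  have "resolv A w ** (mat 1 - mat w ** A) = mat 1"
    unfolding resolv_def by (rule matrix_inv_left[OF stable_invertible[OF a]])
  hence "resolv A w ** (mat w ** A) = resolv A w - mat 1" by (simp add: mm_diff_right algebra_simps)
  thus "mat w ** resolv A w ** A = resolv A w - mat 1"
    by (metis mat_commute matrix_mul_assoc)
qed

lemma matrix_inv_mat1: "matrix_inv (mat 1 :: complex^'n^'n) = mat 1"
  by (rule matrix_inv_unique) simp

lemma mat_0_eq: "mat 0 = (0::complex^'n^'n)"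
  by (simp add: mat_def vec_eq_iff)

lemma resolv_0: "resolv A 0 = mat 1"
  by (simp add: resolv_def mat_0_eq matrix_inv_mat1)

lemma disc_analytic_pencil: "disc_analytic (\<lambda>w. mat 1 - mat w ** A)"
  by (simp add: disc_analytic_def mat_mm_nth) (auto intro!: analytic_intros)

lemma disc_analytic_resolv: "stable A \<Longrightarrow> disc_analytic (resolv A)"
  using disc_analytic_inv[OF disc_analytic_pencil[of A]] stable_invertible[of A]
  unfolding resolv_def by simp

lemma adj_resolv:
  assumes "stable A" "norm w \<le> 1"
  shows "(resolv A w)\<dagger> = resolv (A\<dagger>) (cnj w)"
  using matrix_inv_adj[OF stable_invertible[OF assms]]
  by (simp add: resolv_def adj_diff adj_mult mat_commute)

lemma continuous_resolv_cnj: "stable A \<Longrightarrow> continuous_on (sphere 0 1) (\<lambda>z. resolv A (cnj z))"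
  by (rule continuous_on_compose2[OF disc_analytic_continuous_circle[OF disc_analytic_resolv]])
     (auto intro!: continuous_intros)

text \<open>As a function of \<open>z\<close> on the circle the integrand is antianalytic in the disc; its adjoint is the
  resolvent of \<open>A\<^sup>*\<close> at \<open>z\<close>, to which the mean value property applies.\<close>

lemma circle_integral_resolv:
  assumes "stable A"
  shows "circle_integral (\<lambda>z. resolv A (cnj z)) = mat 1"
proof -
  have "circle_integral (\<lambda>z. resolv A (cnj z)) = circle_integral (\<lambda>z. (resolv (A\<dagger>) z)\<dagger>)"
    by (rule circle_integral_cong) (simp add: adj_resolv stable_adj assms)
  also have "\<dots> = (circle_integral (resolv (A\<dagger>)))\<dagger>"
    using disc_analytic_resolv[OF stable_adj[OF assms]]
    by (intro circle_integral_linear bounded_linear_adj circle_integrable_continuous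
        disc_analytic_continuous_circle)
  also have "\<dots> = mat 1"
    using disc_analytic_resolv[OF stable_adj[OF assms]]
    by (simp add: circle_integral_disc_analytic resolv_0)
  finally show ?thesis .
qed

lemma mat_unimodular_sandwich:
  assumes "norm c = 1"
  shows "(mat c ** X) ** M ** (mat c ** X)\<dagger> = X ** M ** X\<dagger>"
proof -
  have c: "c * cnj c = 1" using assms by (simp add: complex_norm_square[symmetric])
  have "(mat c ** X) ** M ** (mat c ** X)\<dagger> = mat c ** (X ** M ** X\<dagger> ** mat (cnj c))"
    by (simp add: adj_mult matrix_mul_assoc)
  also have "X ** M ** X\<dagger> ** mat (cnj c) = mat (cnj c) ** (X ** M ** X\<dagger>)"
    by (rule mat_commute[symmetric])
  also have "mat c ** (mat (cnj c) ** (X ** M ** X\<dagger>)) = mat (c * cnj c) ** (X ** M ** X\<dagger>)"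
    unfolding matrix_mul_assoc mat_mult_mat ..
  finally show ?thesis by (simp add: c)
qed

lemma circle_integral_resolv_terms:
  assumes "stable A"
  shows "circle_integrable (\<lambda>z. resolv A (cnj z) ** M)"
    "circle_integral (\<lambda>z. resolv A (cnj z) ** M) = M"
    "circle_integrable (\<lambda>z. M ** (resolv A (cnj z))\<dagger>)"
    "circle_integral (\<lambda>z. M ** (resolv A (cnj z))\<dagger>) = M"
proof -
  have i: "circle_integrable (\<lambda>z. resolv A (cnj z))"
    by (rule circle_integrable_continuous[OF continuous_resolv_cnj[OF assms]])
  have l1: "bounded_linear (\<lambda>X. X ** M)"
    by (rule bounded_bilinear.bounded_linear_left[OF bounded_bilinear_mm])
  have l2: "bounded_linear (\<lambda>X. M ** X\<dagger>)"
    using bounded_linear_compose[OF bounded_bilinear.bounded_linear_right[OF bounded_bilinear_mm] bounded_linear_adj] .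
  show "circle_integrable (\<lambda>z. resolv A (cnj z) ** M)"
    "circle_integrable (\<lambda>z. M ** (resolv A (cnj z))\<dagger>)"
    by (rule circle_integrable_linear[OF l1 i], rule circle_integrable_linear[OF l2 i])
  show "circle_integral (\<lambda>z. resolv A (cnj z) ** M) = M"
    "circle_integral (\<lambda>z. M ** (resolv A (cnj z))\<dagger>) = M"
    using circle_integral_linear[OF l1 i] circle_integral_linear[OF l2 i]
    by (simp_all add: circle_integral_resolv[OF assms])
qed

text \<open>The stationary covariance of \<open>x' = A x + u\<close> with white noise \<open>u\<close> of covariance \<open>M\<close>, in its
  frequency domain form.\<close>

definition lyapunov_integral :: "complex^'n^'n \<Rightarrow> complex^'n^'n \<Rightarrow> complex^'n^'n" where
  "lyapunov_integral A M = circle_integral (\<lambda>z. resolv A (cnj z) ** M ** (resolv A (cnj z))\<dagger>)"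

lemma circle_integrable_lyapunov:
  "stable A \<Longrightarrow> circle_integrable (\<lambda>z. resolv A (cnj z) ** M ** (resolv A (cnj z))\<dagger>)"
  by (intro circle_integrable_continuous continuous_intros continuous_resolv_cnj)

lemma lyapunov_expand:
  "(S - mat 1) ** M ** (S - mat 1)\<dagger> = S ** M ** S\<dagger> - S ** M - M ** S\<dagger> + (M::complex^'n^'n)"
  by (simp add: adj_diff mm_diff_left mm_diff_right matrix_mul_assoc)

text \<open>On the circle \<open>\<bar>w\<bar> = 1\<close>, so \<open>A S\<close> may be replaced by \<open>w A S = S - 1\<close> on both sides of \<open>M\<close>. The cross terms
  \<open>S M\<close> and \<open>M S\<^sup>*\<close> have mean \<open>M\<close>.\<close>

lemma lyapunov_integral_solves:
  assumes "stable A"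
  shows "lyapunov_integral A M = M + A ** lyapunov_integral A M ** A\<dagger>"
proof -
  let ?S = "\<lambda>z. resolv A (cnj z)"
  have i: "circle_integrable (\<lambda>z. ?S z ** M ** (?S z)\<dagger>)" by (rule circle_integrable_lyapunov[OF assms])
  note t = circle_integral_resolv_terms[OF assms, of M]
  have lin: "bounded_linear (\<lambda>X. A ** X ** A\<dagger>)"
    using bounded_linear_compose[OF bounded_bilinear.bounded_linear_left[OF bounded_bilinear_mm]
        bounded_bilinear.bounded_linear_right[OF bounded_bilinear_mm]] .
  have "A ** lyapunov_integral A M ** A\<dagger> = circle_integral (\<lambda>z. A ** (?S z ** M ** (?S z)\<dagger>) ** A\<dagger>)"
    unfolding lyapunov_integral_def by (rule circle_integral_linear[OF lin i, symmetric])
  also have "\<dots> = circle_integral (\<lambda>z. ?S z ** M ** (?S z)\<dagger> - ?S z ** M - M ** (?S z)\<dagger> + M)"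
  proof (rule circle_integral_cong)
    fix z :: complex assume z: "z \<in> sphere 0 1"
    have "A ** (?S z ** M ** (?S z)\<dagger>) ** A\<dagger> = (A ** ?S z) ** M ** (A ** ?S z)\<dagger>"
      by (simp add: adj_mult matrix_mul_assoc)
    also have "\<dots> = (mat (cnj z) ** (A ** ?S z)) ** M ** (mat (cnj z) ** (A ** ?S z))\<dagger>"
      using z by (simp add: mat_unimodular_sandwich)
    also have "mat (cnj z) ** (A ** ?S z) = ?S z - mat 1"
      using resolv_right[OF assms, of "cnj z"] z by (simp add: matrix_mul_assoc)
    finally show "A ** (?S z ** M ** (?S z)\<dagger>) ** A\<dagger> = ?S z ** M ** (?S z)\<dagger> - ?S z ** M - M ** (?S z)\<dagger> + M"
      by (simp only: lyapunov_expand)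
  qed
  also have "\<dots> = lyapunov_integral A M - M - M + M"
    by (simp add: circle_integral_add circle_integral_diff circle_integrable_add circle_integrable_diff
        i t circle_integrable_const circle_integral_const lyapunov_integral_def)
  finally show ?thesis by simp
qed

text \<open>The same substitution, read backwards: for a solution \<open>\<Sigma>\<close> of the Lyapunov equation the integrand
  collapses to \<open>S \<Sigma> + \<Sigma> S\<^sup>* - \<Sigma>\<close>.\<close>

lemma lyapunov_integral_of_solution:
  assumes "stable A" "\<Sigma> = M + A ** \<Sigma> ** A\<dagger>"
  shows "lyapunov_integral A M = \<Sigma>"
proof -
  let ?S = "\<lambda>z. resolv A (cnj z)"
  note t = circle_integral_resolv_terms[OF assms(1), of \<Sigma>]
  have M: "M = \<Sigma> - A ** \<Sigma> ** A\<dagger>" using assms(2) by (metis add_diff_cancel_right')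
  have "lyapunov_integral A M = circle_integral (\<lambda>z. ?S z ** \<Sigma> + \<Sigma> ** (?S z)\<dagger> - \<Sigma>)"
    unfolding lyapunov_integral_def
  proof (rule circle_integral_cong)
    fix z :: complex assume z: "z \<in> sphere 0 1"
    have "?S z ** M ** (?S z)\<dagger> = ?S z ** \<Sigma> ** (?S z)\<dagger> - (?S z ** A) ** \<Sigma> ** (?S z ** A)\<dagger>"
      by (simp add: M adj_mult matrix_mul_assoc mm_diff_left mm_diff_right)
    also have "(?S z ** A) ** \<Sigma> ** (?S z ** A)\<dagger> = (mat (cnj z) ** (?S z ** A)) ** \<Sigma> ** (mat (cnj z) ** (?S z ** A))\<dagger>"
      using z by (simp add: mat_unimodular_sandwich)
    also have "mat (cnj z) ** (?S z ** A) = ?S z - mat 1"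
      using resolv_left[OF assms(1), of "cnj z"] z by (simp add: matrix_mul_assoc)
    finally show "?S z ** M ** (?S z)\<dagger> = ?S z ** \<Sigma> + \<Sigma> ** (?S z)\<dagger> - \<Sigma>"
      by (simp only: lyapunov_expand) simp
  qed
  also have "\<dots> = \<Sigma>"
    by (simp add: circle_integral_add circle_integral_diff circle_integrable_add
        t circle_integrable_const circle_integral_const)
  finally show ?thesis .
qed

lemma quad_circle_integral:
  fixes F :: "complex \<Rightarrow> complex^'n^'n"
  assumes "circle_integrable F"
  shows "x \<bullet> (circle_integral F *v x) = circle_integral (\<lambda>z. x \<bullet> (F z *v x))"
    "circle_integrable (\<lambda>z. x \<bullet> (F z *v x))"
proof -
  have l: "bounded_linear (\<lambda>M. x \<bullet> (M *v x))"
    by (rule bounded_linear_compose[of "\<lambda>v. x \<bullet> v" "\<lambda>M. M *v x"])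
      (rule bounded_linear_inner_right, rule bounded_bilinear.bounded_linear_left[OF bounded_bilinear_mv])
  show "x \<bullet> (circle_integral F *v x) = circle_integral (\<lambda>z. x \<bullet> (F z *v x))"
    "circle_integrable (\<lambda>z. x \<bullet> (F z *v x))"
    by (rule circle_integral_linear[OF l assms, symmetric], rule circle_integrable_linear[OF l assms])
qed

lemma inner_circle_integral:
  assumes "circle_integrable F"
  shows "M \<bullet> circle_integral F = circle_integral (\<lambda>z. M \<bullet> F z)"
    "circle_integrable (\<lambda>z. M \<bullet> F z)"
  using circle_integral_linear[OF bounded_linear_inner_right assms]
    circle_integrable_linear[OF bounded_linear_inner_right assms] by auto

lemma hermitian_circle_integral:
  assumes "circle_integrable F" "\<And>z. z \<in> sphere 0 1 \<Longrightarrow> hermitian (F z)"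
  shows "hermitian (circle_integral F)"
  using circle_integral_linear[OF bounded_linear_adj assms(1)]
    circle_integral_cong[of F "\<lambda>z. (F z)\<dagger>"] assms(2)
  by (simp add: hermitian_def)


section \<open>Reachable pairs and the range of the moment operator\<close>

lemma adj_mv_nth: "((M::complex^'m^'n)\<dagger> *v x) $ i = (\<Sum>j\<in>UNIV. cnj (column i M $ j) * x $ j)"
  by (simp add: matrix_vector_mult_def column_def)

lemma nonneg_of_perturbation:
  fixes a b :: real
  assumes "\<And>\<delta>. \<delta> > 0 \<Longrightarrow> 0 \<le> a + \<delta> * b"
  shows "0 \<le> a"
proof (rule ccontr)
  assume "\<not> 0 \<le> a"
  hence "0 \<le> a + (- a / (2 * (\<bar>b\<bar> + 1))) * b" by (intro assms divide_pos_pos) auto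
  moreover have "(- a / (2 * (\<bar>b\<bar> + 1))) * b \<le> - a / 2"
  proof -
    have "(- a) * b \<le> (- a) * (\<bar>b\<bar> + 1)" using \<open>\<not> 0 \<le> a\<close> by (intro mult_left_mono) auto
    thus ?thesis by (simp add: field_simps)
  qed
  ultimately show False using \<open>\<not> 0 \<le> a\<close> by linarith
qed

lemma vec_dim_full_span:
  assumes "vec.dim S = CARD('n)" shows "vec.span (S :: (complex^'n) set) = UNIV"
  using assms vec.dim_eq_full[of S] by (simp add: vec.dimension_def card_cart_basis)

lemma full_rank_ker:
  fixes B :: "complex^'m^'n"
  assumes "rank B = CARD('m)" "B *v u = 0" shows "u = 0"
proof -
  have "vec.span (rows B) = UNIV"
    using assms(1) by (intro vec_dim_full_span) (simp add: row_rank_def_gen)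
  thus ?thesis using assms(2) matrix_left_invertible_span_rows_gen[of B] matrix_left_invertible_ker[of B] by blast
qed

locale reachable_pair =
  fixes A :: "complex^'n^'n" and B :: "complex^('m::{finite,linorder})^'n"
  assumes stable: "stable A"
    and full_rank: "B *v u = 0 \<Longrightarrow> u = 0"
    and reach: "reachable A B"
begin

text \<open>\<open>H(w) = z G(z)\<close> with \<open>w = 1/z\<close>. On the circle \<open>w\<close> is the conjugate of \<open>z\<close>, and the unimodular factor
  cancels in all expressions \<open>G \<Phi> G\<^sup>*\<close> and \<open>G\<^sup>* \<Lambda> G\<close>.\<close>

definition H :: "complex \<Rightarrow> complex^('m::{finite,linorder})^'n" where
  "H w = resolv A w ** B"

lemma H_0: "H 0 = B" by (simp add: H_def resolv_0)

lemma H_recurrence: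
  assumes "norm w \<le> 1" shows "mat w ** A ** H w = H w - B"
  using resolv_right[OF stable assms] by (simp add: H_def matrix_mul_assoc mm_diff_left)

lemma H_ker:
  assumes "norm w \<le> 1" "H w *v u = 0" shows "u = 0"
proof -
  have "B *v u = (H w - mat w ** A ** H w) *v u" using H_recurrence[OF assms(1)] by simp
  also have "\<dots> = 0" by (simp add: mv_diff_left matrix_vector_mul_assoc[symmetric] assms(2))
  finally show ?thesis by (rule full_rank)
qed

lemma disc_analytic_H: "disc_analytic H"
  unfolding H_def [abs_def]
  by (intro disc_analytic_mult disc_analytic_resolv disc_analytic_const stable)

lemma continuous_H: "continuous_on (cball 0 1) H"
  by (intro disc_analytic_continuous disc_analytic_H)

lemma continuous_H_cnj [continuous_intros]: "continuous_on (sphere 0 1) (\<lambda>z. H (cnj z))"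
  by (rule continuous_on_compose2[OF continuous_H]) (auto intro!: continuous_intros)

lemma H_bounded: obtains K where "K > 0" "\<And>w. w \<in> cball 0 1 \<Longrightarrow> norm (H w) \<le> K"
proof -
  have "compact (H ` cball 0 1)" by (intro compact_continuous_image continuous_H) simp
  then obtain K where "K > 0" "\<forall>x\<in>H ` cball 0 1. norm x \<le> K"
    using compact_imp_bounded bounded_pos by blast
  thus thesis by (intro that) auto
qed

lemma transfer_fun_eq_H:
  assumes "z \<noteq> 0" "invertible (mat 1 - mat (inverse z) ** A)"
  shows "transfer_fun A B z = mat (inverse z) ** H (inverse z)"
proof -
  have z: "mat z ** mat (inverse z) = (mat 1 :: complex^'n^'n)" using assms(1) by (simp add: mat_mult_mat)
  have "mat z - A = mat z ** (mat 1 - mat (inverse z) ** A)"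
    by (simp add: mm_diff_right matrix_mul_assoc z)
  moreover have "invertible (mat z :: complex^'n^'n)" "matrix_inv (mat z :: complex^'n^'n) = mat (inverse z)"
    using matrix_inv_unique[OF z] by auto
  ultimately have "matrix_inv (mat z - A) = resolv A (inverse z) ** mat (inverse z)"
    using assms(2) by (simp add: matrix_inv_mult resolv_def)
  thus ?thesis by (simp add: transfer_fun_def H_def mat_commute[of "inverse z"] matrix_mul_assoc)
qed

lemma transfer_fun_circle:
  assumes "z \<in> sphere 0 1" shows "transfer_fun A B z = mat (cnj z) ** H (cnj z)"
proof -
  have "z * cnj z = 1" using assms by (simp add: complex_norm_square[symmetric])
  hence "inverse z = cnj z" "z \<noteq> 0" using assms by (auto intro: inverse_unique)
  thus ?thesis using transfer_fun_eq_H[of z] stable_invertible[OF stable, of "cnj z"] assms by simp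
qed

lemma transfer_fun_sandwich:
  assumes "z \<in> sphere 0 1"
  shows "transfer_fun A B z ** M ** (transfer_fun A B z)\<dagger> = H (cnj z) ** M ** (H (cnj z))\<dagger>"
  using assms by (simp add: transfer_fun_circle mat_unimodular_sandwich)

lemma transfer_fun_gram:
  assumes "z \<in> sphere 0 1"
  shows "(transfer_fun A B z)\<dagger> ** M ** transfer_fun A B z = (H (cnj z))\<dagger> ** M ** H (cnj z)"
proof -
  have "(transfer_fun A B z)\<dagger> = mat z ** (H (cnj z))\<dagger>" "transfer_fun A B z = (mat z ** (H (cnj z))\<dagger>)\<dagger>"
    using assms by (simp_all add: transfer_fun_circle adj_mult mat_commute)
  thus ?thesis using mat_unimodular_sandwich[of z "(H (cnj z))\<dagger>" M] assms by simp
qed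

text \<open>The Hermitian form \<open>G\<^sup>* M G\<close> on the circle.\<close>

definition Q :: "complex^'n^'n \<Rightarrow> complex \<Rightarrow> complex^('m::{finite,linorder})^('m::{finite,linorder})" where
  "Q M z = (H (cnj z))\<dagger> ** M ** H (cnj z)"

lemma continuous_Q [continuous_intros]: "continuous_on (sphere 0 1) (Q M)"
  unfolding Q_def [abs_def] by (intro continuous_intros)

lemma Q_diff: "Q (M - N) z = Q M z - Q N z"
  and Q_add: "Q (M + N) z = Q M z + Q N z"
  and Q_scaleR: "Q (r *\<^sub>R M) z = r *\<^sub>R Q M z"
  by (simp_all add: Q_def mm_diff_left mm_diff_right mm_add_left matrix_add_ldistrib scaleR_mm_left scaleR_mm_right)

lemma hermitian_Q: "hermitian M \<Longrightarrow> hermitian (Q M z)"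
  unfolding Q_def by (rule hermitian_sandwich)

lemma inner_H_sandwich: "M \<bullet> (H (cnj z) ** X ** (H (cnj z))\<dagger>) = Q M z \<bullet> X"
  by (simp add: Q_def inner_sandwich)

lemma quad_Q: "x \<bullet> (Q M z *v x) = (H (cnj z) *v x) \<bullet> (M *v (H (cnj z) *v x))"
  by (simp add: Q_def quad_sandwich)

lemma pos_def_Q_identity:
  assumes "z \<in> sphere 0 1" shows "pos_def (Q (mat 1) z)"
  unfolding Q_def
proof (rule pos_def_sandwich)
  show "pos_def (mat 1 :: complex^'n^'n)" by (simp add: pos_def_def hermitian_mat1)
  show "x = 0" if "H (cnj z) *v x = 0" for x using H_ker[OF _ that] assms by simp
qed

lemma L_plus_iff: "\<Lambda> \<in> L_plus A B \<longleftrightarrow> hermitian \<Lambda> \<and> (\<forall>z\<in>sphere 0 1. pos_def (Q \<Lambda> z))"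
  unfolding L_plus_def by (simp add: Q_def transfer_fun_gram)

text \<open>Apply the maximum principle to \<open>x x\<^sup>* H(w)\<close>, which is analytic, unlike \<open>H(w)\<^sup>* x\<close>.\<close>

lemma annihilates_disc:
  assumes x: "\<And>z. z \<in> sphere 0 1 \<Longrightarrow> (H z)\<dagger> *v x = 0" and w: "w \<in> cball 0 1"
  shows "(H w)\<dagger> *v x = 0"
proof (cases "x = 0")
  case False
  have "norm ((dyad x ** H w) *v y) \<le> 0 * norm y" for y
  proof (rule maximum_modulus_matrix[OF _ _ w])
    show "disc_analytic (\<lambda>w. dyad x ** H w)"
      by (intro disc_analytic_mult disc_analytic_const disc_analytic_H)
    fix z :: complex and y assume z: "z \<in> sphere 0 1"
    have "(H z)\<dagger> ** dyad x = 0"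
      by (rule matrix_eq_0I)
        (simp add: matrix_vector_mul_assoc[symmetric] dyad_mv vec.scale x[OF z])
    hence "((H z)\<dagger> ** dyad x)\<dagger> = 0" by simp
    hence "dyad x ** H z = 0" using hermitian_dyad[of x] by (simp add: adj_mult hermitian_def)
    thus "norm ((dyad x ** H z) *v y) \<le> 0 * norm y" by simp
  qed
  hence "dyad x ** H w = 0" by (intro matrix_eq_0I) simp
  hence "(dyad x ** H w)\<dagger> = 0" by simp
  hence "(H w)\<dagger> ** dyad x = 0" using hermitian_dyad[of x] by (simp add: adj_mult hermitian_def)
  hence "(H w)\<dagger> *v (dyad x *v x) = 0" by (simp add: matrix_vector_mul_assoc)
  hence "of_real ((norm x)\<^sup>2) *s ((H w)\<dagger> *v x) = 0"
    by (simp add: dyad_mv cinner_self vec.scale)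
  thus ?thesis using False by (simp add: smult_eq_0)
qed simp

text \<open>At the centre of the disc the hypothesis gives \<open>B\<^sup>* x = 0\<close>; then the recurrence for \<open>H\<close> passes the hypothesis
  on from \<open>x\<close> to \<open>A\<^sup>* x\<close>.\<close>

lemma annihilates_powers:
  assumes "\<And>z. z \<in> sphere 0 1 \<Longrightarrow> (H z)\<dagger> *v x = 0"
  shows "((((**) A) ^^ k) B)\<dagger> *v x = 0"
  using assms
proof (induction k arbitrary: x)
  case 0
  thus ?case using annihilates_disc[of x 0] by (simp add: H_0)
next
  case (Suc k)
  have B0: "B\<dagger> *v x = 0" using annihilates_disc[OF Suc.prems, of 0] by (simp add: H_0)
  have "(H z)\<dagger> *v (A\<dagger> *v x) = 0" if z: "z \<in> sphere 0 1" for z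
  proof -
    have "(mat z ** A ** H z)\<dagger> *v x = (H z - B)\<dagger> *v x"
      using H_recurrence[of z] z by simp
    hence "(H z)\<dagger> *v (A\<dagger> *v (cnj z *s x)) = 0"
      using B0 Suc.prems[OF z] by (simp add: adj_mult adj_diff mv_diff_left matrix_vector_mul_assoc[symmetric] mat_mv)
    thus ?thesis using z by (auto simp: vec.scale smult_eq_0)
  qed
  from Suc.IH[OF this] show ?case
    by (simp add: adj_mult matrix_vector_mul_assoc[symmetric])
qed

text \<open>Reachability in frequency domain form: \<open>x\<close> is orthogonal to all columns of \<open>A\<^sup>k B\<close>.\<close>

lemma annihilates_circle:
  assumes "\<And>z. z \<in> sphere 0 1 \<Longrightarrow> (H z)\<dagger> *v x = 0"
  shows "x = 0"
proof -
  let ?U = "\<Union>k<CARD('n). columns ((((**) A) ^^ k) B)"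
  let ?V = "{v. (\<Sum>j\<in>UNIV. v$j * cnj (x$j)) = 0}"
  have "vec.subspace ?V"
    by (auto simp: vec.subspace_def distrib_right sum.distrib mult.assoc simp flip: sum_distrib_left)
  moreover have "?U \<subseteq> ?V"
  proof clarsimp
    fix v k assume "v \<in> columns ((((**) A) ^^ k) B)"
    then obtain i where "v = column i ((((**) A) ^^ k) B)" by (auto simp: columns_def)
    hence "(\<Sum>j\<in>UNIV. cnj (v$j) * x$j) = 0"
      using annihilates_powers[OF assms, of k] adj_mv_nth[of "((((**) A) ^^ k) B)" x i] by simp
    hence "cnj (\<Sum>j\<in>UNIV. cnj (v$j) * x$j) = 0" by simp
    thus "(\<Sum>j\<in>UNIV. v$j * cnj (x$j)) = 0" by simp
  qed
  ultimately have "vec.span ?U \<subseteq> ?V" by (intro vec.span_minimal)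
  moreover have "vec.span ?U = UNIV"
    using reach unfolding reachable_def by (rule vec_dim_full_span)
  ultimately have "x \<in> ?V" by blast
  hence "(\<Sum>j\<in>UNIV. cnj (x$j) * x$j) = 0" by (simp add: mult.commute)
  thus ?thesis by (simp add: cinner_self)
qed

definition moment :: "(complex \<Rightarrow> complex^('m::{finite,linorder})^('m::{finite,linorder})) \<Rightarrow> complex^'n^'n" where
  "moment \<Phi> = circle_integral (\<lambda>z. H (cnj z) ** \<Phi> z ** (H (cnj z))\<dagger>)"

lemma Gamma_op_eq_moment: "Gamma_op A B \<Phi> = moment \<Phi>"
  unfolding Gamma_op_def moment_def
  by (rule circle_integral_cong) (simp add: transfer_fun_sandwich)

lemma moment_integrable:
  assumes "circle_measurable \<Phi>" "\<And>z. z \<in> sphere 0 1 \<Longrightarrow> norm (\<Phi> z) \<le> K"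
  shows "circle_integrable (\<lambda>z. H (cnj z) ** \<Phi> z ** (H (cnj z))\<dagger>)"
proof -
  obtain L where L: "L > 0" "\<And>w. w \<in> cball 0 1 \<Longrightarrow> norm (H w) \<le> L" using H_bounded by blast
  show ?thesis
  proof (rule circle_integrable_bounded)
    show "circle_measurable (\<lambda>z. H (cnj z) ** \<Phi> z ** (H (cnj z))\<dagger>)"
      by (intro circle_measurable_mm assms circle_measurable_continuous continuous_intros)
    fix z :: complex assume z: "z \<in> sphere 0 1"
    have h: "norm (H (cnj z)) \<le> L" using z by (intro L) simp
    have "norm (H (cnj z) ** \<Phi> z ** (H (cnj z))\<dagger>) \<le> norm (H (cnj z)) * norm (\<Phi> z) * norm (H (cnj z))"
      using order_trans[OF norm_mm_le mult_right_mono[OF norm_mm_le norm_ge_zero]]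
      by (metis norm_adj)
    also have "\<dots> \<le> L * K * L"
      using h assms(2)[OF z] L(1) order_trans[OF norm_ge_zero assms(2)[OF z]]
      by (intro mult_mono mult_nonneg_nonneg) auto
    finally show "norm (H (cnj z) ** \<Phi> z ** (H (cnj z))\<dagger>) \<le> L * K * L" .
  qed
qed

lemma moment_integrable_continuous:
  "continuous_on (sphere 0 1) \<Phi> \<Longrightarrow> circle_integrable (\<lambda>z. H (cnj z) ** \<Phi> z ** (H (cnj z))\<dagger>)"
  by (intro circle_integrable_continuous continuous_intros)

lemma inner_moment:
  assumes "circle_integrable (\<lambda>z. H (cnj z) ** \<Phi> z ** (H (cnj z))\<dagger>)"
  shows "M \<bullet> moment \<Phi> = circle_integral (\<lambda>z. Q M z \<bullet> \<Phi> z)"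
  unfolding moment_def inner_circle_integral[OF assms] inner_H_sandwich ..

abbreviation S :: "(complex^'n^'n) set" where "S \<equiv> range_Gamma A B"

lemma S_iff: "X \<in> S \<longleftrightarrow> (\<exists>\<Phi>. X = moment \<Phi> \<and> continuous_on (sphere 0 1) \<Phi> \<and> (\<forall>z\<in>sphere 0 1. hermitian (\<Phi> z)))"
  by (auto simp: range_Gamma_def Gamma_op_eq_moment)

lemma momentI: "continuous_on (sphere 0 1) \<Phi> \<Longrightarrow> (\<And>z. z \<in> sphere 0 1 \<Longrightarrow> hermitian (\<Phi> z)) \<Longrightarrow> moment \<Phi> \<in> S"
  using S_iff by blast

lemma hermitian_S: "X \<in> S \<Longrightarrow> hermitian X"
  unfolding S_iff moment_def
  by (auto intro!: hermitian_circle_integral hermitian_sandwich' moment_integrable_continuous)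

lemma subspace_S: "subspace S"
  unfolding subspace_def
proof (intro conjI ballI allI)
  have "moment (\<lambda>_. 0) = 0" by (simp add: moment_def circle_integral_const)
  thus "0 \<in> S" using momentI[of "\<lambda>_. 0"] by (simp add: hermitian_0)
next
  fix X Y assume "X \<in> S" "Y \<in> S"
  then obtain \<Phi> \<Psi> where p: "X = moment \<Phi>" "continuous_on (sphere 0 1) \<Phi>" "\<forall>z\<in>sphere 0 1. hermitian (\<Phi> z)"
    "Y = moment \<Psi>" "continuous_on (sphere 0 1) \<Psi>" "\<forall>z\<in>sphere 0 1. hermitian (\<Psi> z)"
    unfolding S_iff by blast
  have "moment (\<lambda>z. \<Phi> z + \<Psi> z) = X + Y"
    unfolding p moment_def
    by (subst circle_integral_add[symmetric])
      (simp_all add: moment_integrable_continuous p mm_add_left matrix_add_ldistrib)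
  moreover have "moment (\<lambda>z. \<Phi> z + \<Psi> z) \<in> S"
    using p by (intro momentI continuous_intros hermitian_add) auto
  ultimately show "X + Y \<in> S" by simp
next
  fix c X assume "X \<in> S"
  then obtain \<Phi> where p: "X = moment \<Phi>" "continuous_on (sphere 0 1) \<Phi>" "\<forall>z\<in>sphere 0 1. hermitian (\<Phi> z)"
    unfolding S_iff by blast
  have "moment (\<lambda>z. c *\<^sub>R \<Phi> z) = c *\<^sub>R X"
    unfolding p moment_def
    by (subst circle_integral_linear[OF bounded_linear_scaleR_right, symmetric])
      (simp_all add: moment_integrable_continuous p scaleR_mm_left scaleR_mm_right)
  moreover have "moment (\<lambda>z. c *\<^sub>R \<Phi> z) \<in> S"
    using p by (intro momentI continuous_intros hermitian_scaleR) auto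
  ultimately show "c *\<^sub>R X \<in> S" by simp
qed

lemma S_orthogonal:
  assumes "\<And>z. z \<in> sphere 0 1 \<Longrightarrow> Q M z = 0" "X \<in> S"
  shows "M \<bullet> X = 0"
proof -
  obtain \<Phi> where p: "X = moment \<Phi>" "continuous_on (sphere 0 1) \<Phi>"
    using assms(2) unfolding S_iff by blast
  have "M \<bullet> X = circle_integral (\<lambda>z. Q M z \<bullet> \<Phi> z)"
    unfolding p by (intro inner_moment moment_integrable_continuous p)
  also have "\<dots> = circle_integral (\<lambda>z. 0)" by (rule circle_integral_cong) (simp add: assms)
  finally show ?thesis by (simp add: circle_integral_const)
qed

lemma S_inner_cong:
  assumes "\<And>z. z \<in> sphere 0 1 \<Longrightarrow> Q M z = Q N z" "X \<in> S"
  shows "M \<bullet> X = N \<bullet> X"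
  using S_orthogonal[of "M - N" X] assms by (simp add: Q_diff inner_diff_left)

text \<open>The density \<open>G\<^sup>* M G\<close> is itself admissible, and pairing \<open>M\<close> with its moment matrix gives the integral of
  \<open>\<bar>G\<^sup>* M G\<bar>\<^sup>2\<close>. Thus the orthogonal complement of the range within the Hermitian matrices consists
  of the multipliers that are invisible on the circle.\<close>

lemma orthogonal_S_imp:
  assumes "hermitian M" "\<And>X. X \<in> S \<Longrightarrow> M \<bullet> X = 0" "z \<in> sphere 0 1"
  shows "Q M z = 0"
proof -
  have "moment (Q M) \<in> S" by (intro momentI continuous_intros hermitian_Q assms)
  hence "circle_integral (\<lambda>z. Q M z \<bullet> Q M z) = 0"
    using assms(2) inner_moment[OF moment_integrable_continuous[OF continuous_Q], of M M] by simp
  hence "Q M z \<bullet> Q M z = 0"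
    by (intro circle_integral_0_imp[where f = "\<lambda>z. Q M z \<bullet> Q M z"] continuous_intros assms) auto
  thus ?thesis by simp
qed

lemma S_decomp:
  obtains Y Z where "Y \<in> S" "\<And>W. W \<in> S \<Longrightarrow> Z \<bullet> W = 0" "X = Y + Z"
  using orthogonal_subspace_decomp_exists[of S X] subspace_S
  by (metis orthogonal_def span_eq_iff)

text \<open>Every Hermitian multiplier has a representative in the range with the same form on the circle.\<close>

lemma S_projection:
  assumes "hermitian X"
  obtains Y where "Y \<in> S" "\<And>z. z \<in> sphere 0 1 \<Longrightarrow> Q Y z = Q X z"
proof -
  obtain Y Z where YZ: "Y \<in> S" "\<And>W. W \<in> S \<Longrightarrow> Z \<bullet> W = 0" "X = Y + Z" using S_decomp[of X] by blast
  have "hermitian Z" using YZ assms hermitian_diff[OF assms hermitian_S[OF YZ(1)]] by simp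
  hence "Q Z z = 0" if "z \<in> sphere 0 1" for z using YZ that by (intro orthogonal_S_imp)
  thus thesis using YZ by (intro that[of Y]) (auto simp: Q_add)
qed

text \<open>Densities that are only measurable and integrable lead to the same range as continuous ones: the
  component of the moment matrix orthogonal to the range is invisible on the circle, hence zero.\<close>

lemma moment_in_S:
  assumes int: "circle_integrable (\<lambda>z. H (cnj z) ** \<Phi> z ** (H (cnj z))\<dagger>)"
    and herm: "\<And>z. z \<in> sphere 0 1 \<Longrightarrow> hermitian (\<Phi> z)"
  shows "moment \<Phi> \<in> S"
proof -
  obtain Y Z where YZ: "Y \<in> S" "\<And>W. W \<in> S \<Longrightarrow> Z \<bullet> W = 0" "moment \<Phi> = Y + Z" using S_decomp[of "moment \<Phi>"] by blast
  have "hermitian (moment \<Phi>)"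
    unfolding moment_def by (intro hermitian_circle_integral int hermitian_sandwich' herm)
  hence hZ: "hermitian Z" using YZ hermitian_diff[OF _ hermitian_S[OF YZ(1)]] by (metis add_diff_cancel_left')
  have "Z \<bullet> moment \<Phi> = circle_integral (\<lambda>z. Q Z z \<bullet> \<Phi> z)" by (rule inner_moment[OF int])
  also have "\<dots> = circle_integral (\<lambda>z. 0)"
    by (rule circle_integral_cong) (simp add: orthogonal_S_imp[OF hZ YZ(2)])
  finally have "Z \<bullet> Z = 0" using YZ by (simp add: circle_integral_const inner_add_right)
  thus ?thesis using YZ by simp
qed

text \<open>Modulo the range of \<open>B\<close> the matrix \<open>A\<close> acts on \<open>G\<close> as multiplication by the unimodular \<open>z\<close>, which cancels.\<close>

lemma S_stein:
  assumes "\<Sigma> \<in> S" "J ** B = 0"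
  shows "J ** A ** \<Sigma> ** A\<dagger> ** J\<dagger> = J ** \<Sigma> ** J\<dagger>"
proof -
  obtain \<Phi> where p: "\<Sigma> = moment \<Phi>" "continuous_on (sphere 0 1) \<Phi>"
    using assms(1) unfolding S_iff by blast
  let ?F = "\<lambda>z. H (cnj z) ** \<Phi> z ** (H (cnj z))\<dagger>"
  have i: "circle_integrable ?F" by (rule moment_integrable_continuous[OF p(2)])
  have lin: "bounded_linear (\<lambda>X. P ** X ** P\<dagger>)" for P :: "complex^'n^'k"
    using bounded_linear_compose[OF bounded_bilinear.bounded_linear_left[OF bounded_bilinear_mm]
        bounded_bilinear.bounded_linear_right[OF bounded_bilinear_mm]] .
  have "(J ** A) ** \<Sigma> ** (J ** A)\<dagger> = circle_integral (\<lambda>z. (J ** A) ** ?F z ** (J ** A)\<dagger>)"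
    unfolding p(1) moment_def by (rule circle_integral_linear[OF lin i, symmetric])
  also have "\<dots> = circle_integral (\<lambda>z. J ** ?F z ** J\<dagger>)"
  proof (rule circle_integral_cong)
    fix z :: complex assume z: "z \<in> sphere 0 1"
    have "mat (cnj z) ** (J ** A ** H (cnj z)) = J ** (mat (cnj z) ** A ** H (cnj z))"
      by (metis mat_commute matrix_mul_assoc)
    also have "\<dots> = J ** H (cnj z)"
      using H_recurrence[of "cnj z"] z assms(2) by (simp add: mm_diff_right)
    finally have e: "mat (cnj z) ** (J ** A ** H (cnj z)) = J ** H (cnj z)" .
    have "(J ** A) ** ?F z ** (J ** A)\<dagger> = (J ** A ** H (cnj z)) ** \<Phi> z ** (J ** A ** H (cnj z))\<dagger>"
      by (simp add: adj_mult matrix_mul_assoc)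
    also have "\<dots> = (mat (cnj z) ** (J ** A ** H (cnj z))) ** \<Phi> z ** (mat (cnj z) ** (J ** A ** H (cnj z)))\<dagger>"
      using z by (simp add: mat_unimodular_sandwich)
    also have "\<dots> = J ** ?F z ** J\<dagger>"
      unfolding e by (simp add: adj_mult matrix_mul_assoc)
    finally show "(J ** A) ** ?F z ** (J ** A)\<dagger> = J ** ?F z ** J\<dagger>" .
  qed
  also have "\<dots> = J ** \<Sigma> ** J\<dagger>"
    unfolding p(1) moment_def by (rule circle_integral_linear[OF lin i])
  finally show ?thesis by (simp add: adj_mult matrix_mul_assoc)
qed

lemma moment_identity_pos_def:
  defines "\<Sigma> \<equiv> moment (\<lambda>_. mat 1)"
  shows "\<Sigma> \<in> S" "pos_def \<Sigma>"
proof -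
  show S: "\<Sigma> \<in> S" unfolding \<Sigma>_def by (intro momentI continuous_intros hermitian_mat1)
  have int: "circle_integrable (\<lambda>z. H (cnj z) ** mat 1 ** (H (cnj z))\<dagger>)"
    by (intro moment_integrable_continuous continuous_intros)
  have q: "x \<bullet> (\<Sigma> *v x) = circle_integral (\<lambda>z. (norm ((H (cnj z))\<dagger> *v x))\<^sup>2)" for x
    unfolding \<Sigma>_def moment_def quad_circle_integral(1)[OF int] quad_sandwich'
    by (simp add: power2_norm_eq_inner)
  show "pos_def \<Sigma>"
    unfolding pos_def_def
  proof (intro conjI allI impI hermitian_S[OF S])
    fix x :: "complex^'n" assume "x \<noteq> 0"
    have "x \<bullet> (\<Sigma> *v x) \<ge> 0" unfolding q by (rule circle_integral_nonneg) simp
    moreover have "x \<bullet> (\<Sigma> *v x) \<noteq> 0"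
    proof
      assume 0: "x \<bullet> (\<Sigma> *v x) = 0"
      have "(H z)\<dagger> *v x = 0" if z: "z \<in> sphere 0 1" for z
      proof -
        have "(norm ((H (cnj (cnj z)))\<dagger> *v x))\<^sup>2 = 0"
          using z 0[unfolded q]
          by (intro circle_integral_0_imp[where f = "\<lambda>z. (norm ((H (cnj z))\<dagger> *v x))\<^sup>2"] continuous_intros) auto
        thus ?thesis by simp
      qed
      thus False using annihilates_circle \<open>x \<noteq> 0\<close> by blast
    qed
    ultimately show "0 < x \<bullet> (\<Sigma> *v x)" by simp
  qed
qed

end


section \<open>Duality between the range and the positive multipliers\<close>

context reachable_pair
begin

lemma pos_def_B_gram:
  assumes "pos_def P" shows "pos_def (B\<dagger> ** P ** B)"
  using assms full_rank by (rule pos_def_sandwich)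

text \<open>The maximum entropy representation. For positive definite \<open>\<Sigma>\<close> in the range, let \<open>J\<close> be the projection
  along the range of \<open>B\<close> that is orthogonal for \<open>\<Sigma>\<^sup>-\<^sup>1\<close>, and let \<open>P\<close> be the complementary part of \<open>\<Sigma>\<close>. Then
  \<open>\<Sigma> = P + (J A) \<Sigma> (J A)\<^sup>*\<close>, and \<open>J A\<close> is a stable closed loop matrix: an eigenvalue outside the open disc
  would have a left eigenvector annihilated by \<open>P\<close>, on which \<open>J A\<close> and \<open>A\<close> agree. So \<open>\<Sigma>\<close> is
  the Lyapunov integral of \<open>J A\<close>. Its integrand has the form \<open>(H X) (H X)\<^sup>*\<close> since feedback does not
  change the range of the transfer function, and \<open>\<Lambda>\<close> pairs with it to the trace of \<open>X\<^sup>* (H\<^sup>* \<Lambda> H) X\<close>.\<close>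

lemma inner_nonneg_pos_def:
  assumes \<Sigma>: "\<Sigma> \<in> S" "pos_def \<Sigma>"
    and \<Lambda>: "\<And>z. z \<in> sphere 0 1 \<Longrightarrow> pos_semidef (Q \<Lambda> z)"
  shows "0 \<le> \<Lambda> \<bullet> \<Sigma>"
proof -
  define Si where "Si = matrix_inv \<Sigma>"
  note i = pos_def_invertible[OF \<Sigma>(2)]
  have Si: "\<Sigma> ** Si = mat 1" "Si ** \<Sigma> = mat 1" "Si\<dagger> = Si" "\<Sigma>\<dagger> = \<Sigma>"
    using matrix_inv_right[OF i] matrix_inv_left[OF i] pos_def_hermitian[OF pos_def_inverse[OF \<Sigma>(2)]]
      pos_def_hermitian[OF \<Sigma>(2)]
    by (auto simp: Si_def hermitian_def)
  define N where "N = B\<dagger> ** Si ** B"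
  have "pos_def N" unfolding N_def Si_def by (intro pos_def_B_gram pos_def_inverse \<Sigma>)
  then obtain R where R: "lower_triangular R" "pos_diag R" "R\<dagger> ** R = N" "invertible R"
    by (rule triangular_factor_exists)
  define E where "E = matrix_inv R"
  have RE: "R ** E = mat 1" unfolding E_def by (rule matrix_inv_right[OF R(4)])
  have ENE: "E\<dagger> ** N ** E = mat 1"
  proof -
    have "E\<dagger> ** N ** E = (R ** E)\<dagger> ** (R ** E)"
      by (simp add: R(3)[symmetric] adj_mult matrix_mul_assoc)
    thus ?thesis by (simp add: RE)
  qed
  have EEN: "E ** E\<dagger> ** N = mat 1"
  proof -
    have "(E\<dagger> ** N) ** E = mat 1" using ENE .
    hence "E ** (E\<dagger> ** N) = mat 1" using matrix_left_right_inverse by blast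
    thus ?thesis by (simp add: matrix_mul_assoc)
  qed
  define P where "P = B ** E ** E\<dagger> ** B\<dagger>"
  define J where "J = mat 1 - P ** Si"
  have P: "P\<dagger> = P" "P = (B ** E) ** (B ** E)\<dagger>" by (simp_all add: P_def adj_mult matrix_mul_assoc)
  have PSB: "P ** Si ** B = B"
  proof -
    have "P ** Si ** B = B ** (E ** E\<dagger> ** N)" by (simp add: P_def N_def matrix_mul_assoc)
    thus ?thesis by (simp add: EEN)
  qed
  have PSP: "P ** Si ** P = P"
  proof -
    have "P ** Si ** P = (P ** Si ** B) ** (E ** E\<dagger> ** B\<dagger>)" by (simp add: P_def matrix_mul_assoc)
    thus ?thesis unfolding PSB by (simp add: P_def matrix_mul_assoc)
  qed
  have JB: "J ** B = 0" by (simp add: J_def mm_diff_left PSB)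
  have J\<Sigma>: "J ** \<Sigma> = \<Sigma> - P"
    by (simp add: J_def mm_diff_left matrix_mul_assoc[symmetric] Si)
  have Jadj: "J\<dagger> = mat 1 - Si ** P" by (simp add: J_def adj_diff adj_mult Si P(1))
  have J\<Sigma>J: "J ** \<Sigma> ** J\<dagger> = \<Sigma> - P"
  proof -
    have "(\<Sigma> - P) ** (mat 1 - Si ** P) = \<Sigma> - P - (\<Sigma> ** Si ** P - P ** Si ** P)"
      by (simp add: mm_diff_left mm_diff_right matrix_mul_assoc)
    thus ?thesis by (simp add: J\<Sigma> Jadj Si PSP)
  qed
  define Ac where "Ac = J ** A"
  have stein: "\<Sigma> = P + Ac ** \<Sigma> ** Ac\<dagger>"
  proof -
    have "Ac ** \<Sigma> ** Ac\<dagger> = J ** A ** \<Sigma> ** A\<dagger> ** J\<dagger>"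
      by (simp add: Ac_def adj_mult matrix_mul_assoc)
    also have "\<dots> = \<Sigma> - P" using S_stein[OF \<Sigma>(1) JB] J\<Sigma>J by simp
    finally show ?thesis by simp
  qed
  have stab: "stable Ac"
  proof -
    have "stable (Ac\<dagger>)"
      unfolding stable_def
    proof (intro allI impI)
      fix z assume "eigenvalue (Ac\<dagger>) z"
      then obtain v where v: "v \<noteq> 0" "Ac\<dagger> *v v = z *s v" by (auto simp: eigenvalue_def)
      show "norm z < 1"
      proof (rule ccontr)
        assume z: "\<not> norm z < 1"
        have pv: "0 < v \<bullet> (\<Sigma> *v v)" by (rule pos_def_pos[OF \<Sigma>(2) v(1)])
        have "v \<bullet> (\<Sigma> *v v) = v \<bullet> (P *v v) + v \<bullet> ((Ac ** \<Sigma> ** Ac\<dagger>) *v v)"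
          by (subst stein) (simp add: matrix_vector_mult_add_rdistrib inner_add_right)
        also have "v \<bullet> (P *v v) = (norm ((B ** E)\<dagger> *v v))\<^sup>2"
          unfolding P(2) using quad_gram[of v "(B ** E)\<dagger>"] by simp
        also have "v \<bullet> ((Ac ** \<Sigma> ** Ac\<dagger>) *v v) = (norm z)\<^sup>2 * (v \<bullet> (\<Sigma> *v v))"
          unfolding quad_sandwich' v(2) by (rule quad_smult)
        finally have e: "v \<bullet> (\<Sigma> *v v) = (norm ((B ** E)\<dagger> *v v))\<^sup>2 + (norm z)\<^sup>2 * (v \<bullet> (\<Sigma> *v v))" .
        have "1 * (v \<bullet> (\<Sigma> *v v)) \<le> (norm z)\<^sup>2 * (v \<bullet> (\<Sigma> *v v))"
          using z pv by (intro mult_right_mono) (auto simp: one_le_power)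
        hence "(norm ((B ** E)\<dagger> *v v))\<^sup>2 \<le> 0" using e by linarith
        hence "(B ** E)\<dagger> *v v = 0" by simp
        hence "P *v v = 0" unfolding P(2) matrix_vector_mul_assoc[symmetric] by simp
        hence "J\<dagger> *v v = v" by (simp add: Jadj mv_diff_left matrix_vector_mul_assoc[symmetric])
        hence "Ac\<dagger> *v v = A\<dagger> *v v" by (simp add: Ac_def adj_mult matrix_vector_mul_assoc[symmetric])
        hence "eigenvalue (A\<dagger>) z" using v unfolding eigenvalue_def by metis
        thus False using z stable_adj[OF stable] by (auto simp: stable_def)
      qed
    qed
    from stable_adj[OF this] show ?thesis by simp
  qed
  have "lyapunov_integral Ac P = \<Sigma>" by (rule lyapunov_integral_of_solution[OF stab stein])
  hence "\<Lambda> \<bullet> \<Sigma> = circle_integral (\<lambda>z. \<Lambda> \<bullet> (resolv Ac (cnj z) ** P ** (resolv Ac (cnj z))\<dagger>))"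
    unfolding lyapunov_integral_def
    using inner_circle_integral(1)[OF circle_integrable_lyapunov[OF stab], of \<Lambda> P] by simp
  also have "\<dots> \<ge> 0"
  proof (rule circle_integral_nonneg)
    fix z :: complex assume z: "z \<in> sphere 0 1"
    define w where "w = cnj z"
    have w: "norm w \<le> 1" using z by (simp add: w_def)
    let ?T = "resolv Ac w"
    define K where "K = E ** E\<dagger> ** B\<dagger> ** Si ** A"
    have Ac: "Ac = A - B ** K"
      by (simp add: Ac_def J_def K_def P_def mm_diff_left matrix_mul_assoc)
    define Y where "Y = mat 1 - mat w ** K ** ?T ** B"
    have "mat w ** Ac ** ?T ** B = ?T ** B - B"
      using resolv_right[OF stab w] by (simp add: mm_diff_left)
    hence "mat w ** A ** ?T ** B - mat w ** B ** K ** ?T ** B = ?T ** B - B"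
      by (simp add: Ac mm_diff_left mm_diff_right matrix_mul_assoc)
    moreover have "mat w ** B ** K ** ?T ** B = B ** (mat w ** K ** ?T ** B)"
      by (simp only: mat_commute[of w B] matrix_mul_assoc)
    ultimately have "(mat 1 - mat w ** A) ** (?T ** B) = B ** Y"
      by (simp add: Y_def mm_diff_left mm_diff_right matrix_mul_assoc) (simp add: algebra_simps)
    hence "resolv A w ** ((mat 1 - mat w ** A) ** (?T ** B)) = H w ** Y"
      by (simp add: H_def matrix_mul_assoc)
    hence TB: "?T ** B = H w ** Y"
      using matrix_inv_left[OF stable_invertible[OF stable w]] by (simp add: resolv_def[of A] matrix_mul_assoc)
    have "?T ** P ** ?T\<dagger> = H w ** (Y ** E ** (Y ** E)\<dagger>) ** (H w)\<dagger>"
    proof -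
      have "?T ** P ** ?T\<dagger> = (?T ** B) ** E ** ((?T ** B) ** E)\<dagger>"
        by (simp add: P_def adj_mult matrix_mul_assoc)
      thus ?thesis unfolding TB by (simp add: adj_mult matrix_mul_assoc)
    qed
    hence "\<Lambda> \<bullet> (?T ** P ** ?T\<dagger>) = Q \<Lambda> z \<bullet> (Y ** E ** mat 1 ** (Y ** E)\<dagger>)"
      using inner_H_sandwich[of \<Lambda> z] by (simp add: w_def)
    also have "\<dots> = ((Y ** E)\<dagger> ** Q \<Lambda> z ** (Y ** E)) \<bullet> mat 1" by (rule inner_sandwich)
    also have "\<dots> \<ge> 0"
      unfolding inner_mat1 quad_sandwich
      using \<Lambda>[OF z] by (intro sum_nonneg) (simp add: pos_semidef_def)
    finally show "0 \<le> \<Lambda> \<bullet> (resolv Ac (cnj z) ** P ** (resolv Ac (cnj z))\<dagger>)" by (simp add: w_def)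
  qed
  finally show ?thesis .
qed

lemma inner_nonneg_psd:
  assumes \<Sigma>: "\<Sigma> \<in> S" "pos_semidef \<Sigma>"
    and \<Lambda>: "\<And>z. z \<in> sphere 0 1 \<Longrightarrow> pos_semidef (Q \<Lambda> z)"
  shows "0 \<le> \<Lambda> \<bullet> \<Sigma>"
proof (rule nonneg_of_perturbation)
  fix \<delta> :: real assume d: "\<delta> > 0"
  have "0 \<le> \<Lambda> \<bullet> (\<Sigma> + \<delta> *\<^sub>R moment (\<lambda>_. mat 1))"
    by (intro inner_nonneg_pos_def subspace_add subspace_S \<Sigma> subspace_scale moment_identity_pos_def
        pos_def_add_psd pos_def_scaleR d \<Lambda>)
  thus "0 \<le> \<Lambda> \<bullet> \<Sigma> + \<delta> * (\<Lambda> \<bullet> moment (\<lambda>_. mat 1))" by (simp add: inner_add_right)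
qed

text \<open>The positive multipliers form an open set. If the pairing were not positive, subtracting
  a small multiple of \<open>\<Sigma>\<close> from \<open>\<Lambda>\<close> would make it negative.\<close>

lemma inner_pos:
  assumes \<Sigma>: "\<Sigma> \<in> S" "pos_semidef \<Sigma>" "\<Sigma> \<noteq> 0" and \<Lambda>: "\<Lambda> \<in> L_plus A B"
  shows "0 < \<Lambda> \<bullet> \<Sigma>"
proof -
  obtain c where c: "c > 0" "\<And>z x. z \<in> sphere 0 1 \<Longrightarrow> c * (norm x)\<^sup>2 \<le> x \<bullet> (Q \<Lambda> z *v x)"
    using sphere_pos_def_bound[of "Q \<Lambda>"] continuous_Q \<Lambda> by (auto simp: L_plus_iff)
  obtain K where K: "K > 0" "\<And>w. w \<in> cball 0 1 \<Longrightarrow> norm (H w) \<le> K" using H_bounded by blast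
  \<comment> \<open>Small enough for the form of \<open>t \<Sigma>\<close> to stay below the lower bound \<open>c\<close> of the form of \<open>\<Lambda>\<close>.\<close>
  define t where "t = c / (K\<^sup>2 * (norm \<Sigma> + 1))"
  have t: "t > 0" using c K by (simp add: t_def add_nonneg_pos)
  have "0 \<le> (\<Lambda> - t *\<^sub>R \<Sigma>) \<bullet> \<Sigma>"
  proof (rule inner_nonneg_psd[OF \<Sigma>(1,2)])
    fix z :: complex assume z: "z \<in> sphere 0 1"
    show "pos_semidef (Q (\<Lambda> - t *\<^sub>R \<Sigma>) z)"
      unfolding pos_semidef_def
    proof (intro conjI allI)
      show "hermitian (Q (\<Lambda> - t *\<^sub>R \<Sigma>) z)"
        using \<Lambda> hermitian_S[OF \<Sigma>(1)]
        by (intro hermitian_Q hermitian_diff hermitian_scaleR) (auto simp: L_plus_iff)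
      fix x
      have "x \<bullet> (Q \<Sigma> z *v x) \<le> norm \<Sigma> * (norm (H (cnj z) *v x))\<^sup>2"
        unfolding quad_Q by (rule quad_le_norm)
      also have "\<dots> \<le> norm \<Sigma> * (K * norm x)\<^sup>2"
        using K(2)[of "cnj z"] z
        by (intro mult_left_mono power_mono order_trans[OF norm_mv_le] mult_right_mono) auto
      also have "\<dots> \<le> (norm \<Sigma> + 1) * (K * norm x)\<^sup>2" by (intro mult_right_mono) auto
      finally have "t * (x \<bullet> (Q \<Sigma> z *v x)) \<le> t * ((norm \<Sigma> + 1) * (K * norm x)\<^sup>2)"
        using t by simp
      also have "\<dots> = c * (norm x)\<^sup>2"
      proof -
        have "norm \<Sigma> + 1 \<noteq> 0" using norm_ge_zero[of \<Sigma>] by linarith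
        thus ?thesis using K(1) by (simp add: t_def power_mult_distrib)
      qed
      also have "\<dots> \<le> x \<bullet> (Q \<Lambda> z *v x)" by (rule c(2)[OF z])
      finally show "0 \<le> x \<bullet> (Q (\<Lambda> - t *\<^sub>R \<Sigma>) z *v x)"
        by (simp add: Q_diff Q_scaleR mv_diff_left scaleR_mv_left inner_diff_right)
    qed
  qed
  hence "t * (\<Sigma> \<bullet> \<Sigma>) \<le> \<Lambda> \<bullet> \<Sigma>" by (simp add: inner_diff_left)
  moreover have "0 < t * (\<Sigma> \<bullet> \<Sigma>)" using t \<Sigma>(3) by simp
  ultimately show ?thesis by linarith
qed

text \<open>The Kalman-Yakubovich-Popov lemma. Otherwise a hyperplane separates the coset of \<open>\<Lambda>\<close> modulo the
  complement of the range from the positive definite cone. Being bounded on the coset, its normal vector lies in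
  the range; being bounded below on the cone, it is positive semidefinite. It pairs with \<open>\<Lambda>\<close>
  nonpositively, which contradicts the positivity of the pairing.\<close>

lemma pos_def_representative:
  assumes \<Lambda>: "\<Lambda> \<in> L_plus A B"
  obtains M where "pos_def M" "\<And>z. z \<in> sphere 0 1 \<Longrightarrow> Q M z = Q \<Lambda> z"
proof (rule ccontr)
  assume notthesis: "\<not> thesis"
  define T where "T = {M. \<forall>X\<in>S. (M - \<Lambda>) \<bullet> X = 0}"
  define D where "D = {M :: complex^'n^'n. pos_def M}"
  have conv_T: "convex T"
  proof (rule convexI)
    fix M N :: "complex^'n^'n" and u v :: real
    assume a: "M \<in> T" "N \<in> T" "0 \<le> u" "0 \<le> v" "u + v = 1"
    have "u *\<^sub>R M + v *\<^sub>R N - \<Lambda> = u *\<^sub>R (M - \<Lambda>) + v *\<^sub>R (N - \<Lambda>)"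
      using a(5) by (simp add: algebra_simps) (metis scaleR_add_left scaleR_one)
    thus "u *\<^sub>R M + v *\<^sub>R N \<in> T" using a by (simp add: T_def inner_add_left)
  qed
  have conv_D: "convex D"
  proof (rule convexI)
    fix M N :: "complex^'n^'n" and u v :: real
    assume a: "M \<in> D" "N \<in> D" "0 \<le> u" "0 \<le> v" "u + v = 1"
    show "u *\<^sub>R M + v *\<^sub>R N \<in> D"
    proof (cases "u = 0")
      case True thus ?thesis using a by simp
    next
      case False
      have "pos_semidef (v *\<^sub>R N)"
        using a(2,4) pos_def_imp_psd[of N] by (auto simp: D_def pos_semidef_def hermitian_scaleR scaleR_mv_left)
      moreover have "pos_def (u *\<^sub>R M)" using a False by (auto simp: D_def intro: pos_def_scaleR)
      ultimately show ?thesis using pos_def_add_psd[of "v *\<^sub>R N" "u *\<^sub>R M"] by (simp add: D_def add.commute)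
    qed
  qed
  have mat1_D: "mat 1 \<in> D" by (auto simp: D_def pos_def_def hermitian_mat1)
  have disj: "T \<inter> D = {}"
  proof (rule ccontr)
    assume "T \<inter> D \<noteq> {}"
    then obtain M where M: "M \<in> T" "pos_def M" by (auto simp: D_def)
    have "Q (M - \<Lambda>) z = 0" if "z \<in> sphere 0 1" for z
      using M \<Lambda> that by (intro orthogonal_S_imp hermitian_diff) (auto simp: T_def L_plus_iff pos_def_hermitian)
    hence "Q M z = Q \<Lambda> z" if "z \<in> sphere 0 1" for z using that by (simp add: Q_diff)
    thus False using notthesis that M(2) by blast
  qed
  have "\<Lambda> \<in> T" by (simp add: T_def)
  then obtain a b where ab: "a \<noteq> 0" "\<forall>x\<in>T. a \<bullet> x \<le> b" "\<forall>x\<in>D. b \<le> a \<bullet> x"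
    using separating_hyperplane_sets[OF conv_T conv_D _ _ disj] mat1_D by blast
  have b: "b \<le> t * (a \<bullet> M)" if "pos_def M" "t > 0" for M t
    using ab(3) pos_def_scaleR[OF that] by (auto simp: D_def)
  have nonneg: "0 \<le> a \<bullet> M" if M: "pos_def M" for M
  proof (rule ccontr)
    assume n: "\<not> 0 \<le> a \<bullet> M"
    hence "b \<le> ((\<bar>b\<bar> + 1) / - (a \<bullet> M)) * (a \<bullet> M)" by (intro b M divide_pos_pos) auto
    also have "\<dots> = - (\<bar>b\<bar> + 1)" using n by (simp add: field_simps)
    finally show False by linarith
  qed
  have b0: "b \<le> 0"
  proof -
    have "0 \<le> - b + t * (a \<bullet> mat 1)" if "t > 0" for t
      using b[of "mat 1" t] mat1_D that by (simp add: D_def)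
    hence "0 \<le> - b" by (rule nonneg_of_perturbation)
    thus ?thesis by simp
  qed
  have aS: "a \<in> S"
  proof -
    obtain Y Z where YZ: "Y \<in> S" "\<And>W. W \<in> S \<Longrightarrow> Z \<bullet> W = 0" "a = Y + Z" using S_decomp[of a] by blast
    have ZY: "Z \<bullet> Y = 0" by (rule YZ(2)[OF YZ(1)])
    have bound: "a \<bullet> \<Lambda> + t * (Z \<bullet> Z) \<le> b" for t :: real
    proof -
      have "\<Lambda> + t *\<^sub>R Z \<in> T" using YZ(2) by (auto simp: T_def)
      hence "a \<bullet> (\<Lambda> + t *\<^sub>R Z) \<le> b" using ab(2) by blast
      thus ?thesis using ZY by (simp add: YZ(3) inner_add_right inner_add_left inner_commute)
    qed
    have "Z \<bullet> Z = 0"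
    proof (rule ccontr)
      assume "Z \<bullet> Z \<noteq> 0"
      hence "(b - a \<bullet> \<Lambda> + 1) / (Z \<bullet> Z) * (Z \<bullet> Z) = b - a \<bullet> \<Lambda> + 1" by (rule nonzero_divide_eq_eq[THEN iffD1, OF _ refl, symmetric])
      thus False using bound[of "(b - a \<bullet> \<Lambda> + 1) / (Z \<bullet> Z)"] by linarith
    qed
    thus ?thesis using YZ by simp
  qed
  have "pos_semidef a"
    unfolding pos_semidef_def
  proof (intro conjI allI hermitian_S aS)
    fix x :: "complex^'n"
    show "0 \<le> x \<bullet> (a *v x)"
    proof (rule nonneg_of_perturbation)
      fix \<delta> :: real assume "\<delta> > 0"
      have "pos_semidef (dyad x)" by (auto simp: pos_semidef_def hermitian_dyad quad_dyad)
      hence "pos_def (dyad x + \<delta> *\<^sub>R mat 1)"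
        using mat1_D \<open>\<delta> > 0\<close> by (intro pos_def_add_psd pos_def_scaleR) (auto simp: D_def)
      hence "0 \<le> a \<bullet> (dyad x + \<delta> *\<^sub>R mat 1)" by (rule nonneg)
      thus "0 \<le> x \<bullet> (a *v x) + \<delta> * (a \<bullet> mat 1)"
        using hermitian_S[OF aS] by (simp add: inner_add_right inner_dyad hermitian_def)
    qed
  qed
  hence "0 < \<Lambda> \<bullet> a" using inner_pos[OF aS _ ab(1) \<Lambda>] by blast
  moreover have "a \<bullet> \<Lambda> \<le> b" using ab(2) \<open>\<Lambda> \<in> T\<close> by blast
  ultimately show False using b0 by (simp add: inner_commute)
qed

end


section \<open>Spectral factors from the Riccati equation\<close>

context reachable_pair
begin

text \<open>The spectral factor is sought in the form \<open>W(z) = C H(1/z)\<close> with a constant matrix \<open>C\<close>; its value at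
  infinity is \<open>C B\<close>.\<close>

definition outer_factor :: "complex^'n^'n \<Rightarrow> complex^'n^('m::{finite,linorder}) \<Rightarrow> bool" where
  "outer_factor \<Lambda> C \<longleftrightarrow> (\<forall>w\<in>cball 0 1. invertible (C ** H w)) \<and> lower_triangular (C ** B)
    \<and> pos_diag (C ** B) \<and> (\<forall>z\<in>sphere 0 1. Q (C\<dagger> ** C) z = Q \<Lambda> z)"

lemma Q_gram: "Q (C\<dagger> ** C) z = (C ** H (cnj z))\<dagger> ** (C ** H (cnj z))"
  by (simp add: Q_def adj_mult matrix_mul_assoc)

definition gain :: "complex^'n^'n \<Rightarrow> complex^'n^('m::{finite,linorder})" where
  "gain P = matrix_inv (B\<dagger> ** P ** B) ** B\<dagger> ** P"

text \<open>The minimum of \<open>(y + B u)\<^sup>* P (y + B u)\<close> over \<open>u\<close>, as a form in \<open>y\<close>; the minimum is attained at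
  \<open>u = - gain P y\<close>.\<close>

definition schur :: "complex^'n^'n \<Rightarrow> complex^'n^'n" where
  "schur P = P - (B\<dagger> ** P)\<dagger> ** matrix_inv (B\<dagger> ** P ** B) ** (B\<dagger> ** P)"

lemma schur_facts:
  assumes P: "pos_def P"
  shows "schur P ** B = 0" "hermitian (schur P)"
    "schur P = (mat 1 - B ** gain P)\<dagger> ** P ** (mat 1 - B ** gain P)"
    "0 \<le> y \<bullet> (schur P *v y)" "y \<bullet> (schur P *v y) \<le> y \<bullet> (P *v y)"
proof -
  let ?N = "B\<dagger> ** P ** B"
  let ?Ni = "matrix_inv ?N"
  have N: "pos_def ?N" using P by (rule pos_def_B_gram)
  note i = pos_def_invertible[OF N]
  have PP: "P\<dagger> = P" using P by (simp add: pos_def_def hermitian_def)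
  have Ni: "?Ni\<dagger> = ?Ni" using pos_def_hermitian[OF pos_def_inverse[OF N]] by (simp add: hermitian_def)
  have NiN: "?Ni ** ?N = mat 1" by (rule matrix_inv_left[OF i])
  have s: "schur P = P - P ** B ** ?Ni ** B\<dagger> ** P"
    by (simp add: schur_def adj_mult PP matrix_mul_assoc)
  have "schur P ** B = P ** B - P ** B ** (?Ni ** ?N)"
    by (simp add: s mm_diff_left matrix_mul_assoc)
  thus sB: "schur P ** B = 0" by (simp add: NiN)
  show h: "hermitian (schur P)"
    by (simp add: s hermitian_def adj_diff adj_mult PP Ni matrix_mul_assoc)
  have adjB: "B\<dagger> ** schur P = 0"
  proof -
    have "(schur P ** B)\<dagger> = 0" by (simp add: sB)
    thus ?thesis using h by (simp add: adj_mult hermitian_def)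
  qed
  have "P ** (mat 1 - B ** gain P) = schur P"
    by (simp add: s gain_def mm_diff_right matrix_mul_assoc)
  hence "(mat 1 - B ** gain P)\<dagger> ** P ** (mat 1 - B ** gain P) = (mat 1 - (gain P)\<dagger> ** B\<dagger>) ** schur P"
    by (simp add: adj_diff adj_mult matrix_mul_assoc[symmetric])
  also have "\<dots> = schur P - (gain P)\<dagger> ** (B\<dagger> ** schur P)" by (simp add: mm_diff_left matrix_mul_assoc)
  finally show e: "schur P = (mat 1 - B ** gain P)\<dagger> ** P ** (mat 1 - B ** gain P)"
    by (simp add: adjB)
  show "0 \<le> y \<bullet> (schur P *v y)" unfolding e quad_sandwich by (rule pos_def_nonneg[OF P])
  show "y \<bullet> (schur P *v y) \<le> y \<bullet> (P *v y)"
    unfolding schur_def mv_diff_left inner_diff_right quad_sandwich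
    using pos_def_nonneg[OF pos_def_inverse[OF N]] by simp
qed

lemma continuous_schur:
  assumes "\<And>P. P \<in> D \<Longrightarrow> pos_def P"
  shows "continuous_on D schur"
  unfolding schur_def [abs_def]
  by (intro continuous_intros continuous_on_matrix_inv pos_def_invertible pos_def_B_gram assms)

text \<open>The right hand side of the Riccati equation lies between \<open>M\<close> and \<open>M + A\<^sup>* Y A\<close> when \<open>P\<close> lies between \<open>M\<close>
  and \<open>Y\<close>. With \<open>Y\<close> the solution of the Lyapunov equation the upper bound is \<open>Y\<close> again, so the order
  interval, which is convex and compact, is mapped into itself and Brouwer's theorem gives a fixed point.\<close>

lemma riccati_solution:
  assumes M: "pos_def M"
  obtains P where "pos_def P" "P = M + A\<dagger> ** schur P ** A"
proof -
  define Y where "Y = lyapunov_integral (A\<dagger>) M"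
  note sA = stable_adj[OF stable]
  have Y: "Y = M + A\<dagger> ** Y ** A"
    using lyapunov_integral_solves[OF sA, of M] by (simp add: Y_def)
  have Yh: "hermitian Y"
    unfolding Y_def lyapunov_integral_def
    by (intro hermitian_circle_integral circle_integrable_lyapunov sA hermitian_sandwich' pos_def_hermitian M)
  have Ypos: "0 \<le> x \<bullet> (Y *v x)" for x
    unfolding Y_def lyapunov_integral_def quad_circle_integral(1)[OF circle_integrable_lyapunov[OF sA]]
    by (intro circle_integral_nonneg) (simp add: quad_sandwich' pos_def_nonneg[OF M])
  define D where "D = {P. hermitian P \<and> (\<forall>x. x \<bullet> (M *v x) \<le> x \<bullet> (P *v x) \<and> x \<bullet> (P *v x) \<le> x \<bullet> (Y *v x))}"
  obtain c where c: "c > 0" "\<And>x. c * (norm x)\<^sup>2 \<le> x \<bullet> (M *v x)" using pos_def_bound[OF M] by blast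
  have pd: "pos_def P" if "P \<in> D" for P
    using that c by (intro pos_def_of_bound[of P c]) (auto simp: D_def intro: order_trans)
  have "M \<in> D"
  proof -
    have "x \<bullet> (M *v x) \<le> x \<bullet> (Y *v x)" for x
      by (subst Y) (simp add: matrix_vector_mult_add_rdistrib inner_add_right quad_sandwich Ypos)
    thus ?thesis using pos_def_hermitian[OF M] by (simp add: D_def)
  qed
  moreover have "convex D"
  proof (rule convexI)
    fix P P' and u v :: real
    assume a: "P \<in> D" "P' \<in> D" "0 \<le> u" "0 \<le> v" "u + v = 1"
    have uv: "u * r + v * r = r" for r using a(5) by (metis distrib_right mult_1)
    have "x \<bullet> (M *v x) \<le> x \<bullet> ((u *\<^sub>R P + v *\<^sub>R P') *v x) \<and> x \<bullet> ((u *\<^sub>R P + v *\<^sub>R P') *v x) \<le> x \<bullet> (Y *v x)" for x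
    proof -
      have "u * (x \<bullet> (M *v x)) \<le> u * (x \<bullet> (P *v x))" "v * (x \<bullet> (M *v x)) \<le> v * (x \<bullet> (P' *v x))"
        "u * (x \<bullet> (P *v x)) \<le> u * (x \<bullet> (Y *v x))" "v * (x \<bullet> (P' *v x)) \<le> v * (x \<bullet> (Y *v x))"
        using a by (auto simp: D_def intro!: mult_left_mono)
      thus ?thesis using uv[of "x \<bullet> (M *v x)"] uv[of "x \<bullet> (Y *v x)"]
        by (simp add: matrix_vector_mult_add_rdistrib inner_add_right scaleR_mv_left)
    qed
    moreover have "hermitian (u *\<^sub>R P + v *\<^sub>R P')"
      using a by (intro hermitian_add hermitian_scaleR) (auto simp: D_def)
    ultimately show "u *\<^sub>R P + v *\<^sub>R P' \<in> D" by (simp add: D_def)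
  qed
  moreover have "compact D"
  proof (rule compact_eq_bounded_closed[THEN iffD2], intro conjI)
    have "norm P \<le> real CARD('n) * norm Y" if P: "P \<in> D" for P
    proof (rule norm_le_of_operator_bound, rule psd_norm_mv[OF pos_def_imp_psd[OF pd[OF P]]])
      show "x \<bullet> (P *v x) \<le> norm Y * (norm x)\<^sup>2" for x
        using P quad_le_norm[of x Y] by (auto simp: D_def intro: order_trans)
    qed
    thus "bounded D" unfolding bounded_iff by blast
    have "D = (\<Inter>x. {P. conj_transpose P = P \<and> x \<bullet> (M *v x) \<le> x \<bullet> (P *v x) \<and> x \<bullet> (P *v x) \<le> x \<bullet> (Y *v x)})"
      by (auto simp: D_def hermitian_def)
    moreover have "closed {P. conj_transpose P = P \<and> x \<bullet> (M *v x) \<le> x \<bullet> (P *v x) \<and> x \<bullet> (P *v x) \<le> x \<bullet> (Y *v x)}" for x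
      by (intro closed_Collect_conj closed_Collect_eq closed_Collect_le continuous_intros)
    ultimately show "closed D" by (simp add: closed_INT)
  qed
  moreover have "continuous_on D (\<lambda>P. M + A\<dagger> ** schur P ** A)"
    by (intro continuous_intros continuous_schur pd)
  moreover have "(\<lambda>P. M + A\<dagger> ** schur P ** A) \<in> D \<rightarrow> D"
  proof (rule funcsetI)
    fix P assume P: "P \<in> D"
    note f = schur_facts[OF pd[OF P]]
    have "x \<bullet> ((A\<dagger> ** schur P ** A) *v x) \<le> x \<bullet> ((A\<dagger> ** Y ** A) *v x)" for x
      unfolding quad_sandwich using f(5)[of "A *v x"] P by (auto simp: D_def intro: order_trans)
    hence "x \<bullet> ((M + A\<dagger> ** schur P ** A) *v x) \<le> x \<bullet> (Y *v x)" for x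
      by (subst Y) (simp add: matrix_vector_mult_add_rdistrib inner_add_right)
    moreover have "x \<bullet> (M *v x) \<le> x \<bullet> ((M + A\<dagger> ** schur P ** A) *v x)" for x
      by (simp add: matrix_vector_mult_add_rdistrib inner_add_right quad_sandwich f(4))
    ultimately show "M + A\<dagger> ** schur P ** A \<in> D"
      using hermitian_add[OF pos_def_hermitian[OF M] hermitian_sandwich[OF f(2)]] by (simp add: D_def)
  qed
  ultimately obtain P where "P \<in> D" "M + A\<dagger> ** schur P ** A = P"
    using brouwer[of D "\<lambda>P. M + A\<dagger> ** schur P ** A"] by blast
  with pd that show thesis by metis
qed

text \<open>From a Riccati solution \<open>P\<close> for a positive definite representative \<open>M\<close> of \<open>\<Lambda>\<close>, take \<open>C\<close> with
  \<open>C\<^sup>* C = P - schur P\<close>. The identity \<open>w A H = H - B\<close> turns the Riccati equation into \<open>H\<^sup>* M H = H\<^sup>* C\<^sup>* C H\<close>. A zero of \<open>C H\<close>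
  in the closed disc would be a vector reproduced by the closed loop up to a factor of modulus at least one,
  while \<open>P\<close> decreases strictly along the closed loop.\<close>

lemma outer_factor_exists:
  assumes \<Lambda>: "\<Lambda> \<in> L_plus A B"
  obtains C where "outer_factor \<Lambda> C"
proof -
  obtain M where M: "pos_def M" "\<And>z. z \<in> sphere 0 1 \<Longrightarrow> Q M z = Q \<Lambda> z"
    using pos_def_representative[OF \<Lambda>] by blast
  obtain P where P: "pos_def P" "P = M + A\<dagger> ** schur P ** A" using riccati_solution[OF M(1)] by blast
  define N where "N = B\<dagger> ** P ** B"
  have N: "pos_def N" unfolding N_def by (rule pos_def_B_gram[OF P(1)])
  obtain R where R: "lower_triangular R" "pos_diag R" "R\<dagger> ** R = N" "invertible R"
    by (rule triangular_factor_exists[OF N])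
  define E where "E = matrix_inv R"
  have RE: "R ** E = mat 1" "E ** R = mat 1"
    unfolding E_def by (simp_all add: matrix_inv_right matrix_inv_left R(4))
  have REa: "E\<dagger> ** R\<dagger> = mat 1" "R\<dagger> ** E\<dagger> = mat 1"
    using RE by (simp_all add: adj_mult[symmetric])
  have EE: "matrix_inv N = E ** E\<dagger>"
  proof (rule matrix_inv_unique)
    have "N ** (E ** E\<dagger>) = R\<dagger> ** (R ** E) ** E\<dagger>" by (simp add: R(3)[symmetric] matrix_mul_assoc)
    thus "N ** (E ** E\<dagger>) = mat 1" by (simp add: RE REa)
  qed
  have PP: "P\<dagger> = P" using P(1) by (simp add: pos_def_def hermitian_def)
  define C where "C = E\<dagger> ** B\<dagger> ** P"
  have CB: "C ** B = R"
  proof -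
    have "C ** B = E\<dagger> ** N" by (simp add: C_def N_def matrix_mul_assoc)
    thus ?thesis by (simp add: R(3)[symmetric] matrix_mul_assoc REa)
  qed
  have CC: "C\<dagger> ** C = P - schur P"
    by (simp add: C_def schur_def N_def[symmetric] EE adj_mult PP matrix_mul_assoc)
  note f = schur_facts[OF P(1)]
  have BS: "B\<dagger> ** schur P = 0"
  proof -
    have "(schur P ** B)\<dagger> = 0" by (simp add: f(1))
    thus ?thesis using f(2) by (simp add: adj_mult hermitian_def)
  qed
  have "Q (C\<dagger> ** C) z = Q \<Lambda> z" if z: "z \<in> sphere 0 1" for z
  proof -
    let ?H = "H (cnj z)"
    have "Q (A\<dagger> ** schur P ** A) z = (A ** ?H)\<dagger> ** schur P ** ((A ** ?H)\<dagger>)\<dagger>"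
      by (simp add: Q_def adj_mult matrix_mul_assoc)
    also have "\<dots> = (mat z ** (A ** ?H)\<dagger>) ** schur P ** (mat z ** (A ** ?H)\<dagger>)\<dagger>"
      using z by (simp add: mat_unimodular_sandwich)
    also have "mat z ** (A ** ?H)\<dagger> = (mat (cnj z) ** A ** ?H)\<dagger>"
      by (simp only: matrix_mul_assoc[symmetric] adj_mult[of "mat (cnj z)"] adj_mat complex_cnj_cnj
          mat_commute[of z])
    also have "\<dots> = ?H\<dagger> - B\<dagger>"
      using H_recurrence[of "cnj z"] z by (simp add: adj_diff)
    also have "(?H\<dagger> - B\<dagger>) ** schur P ** (?H\<dagger> - B\<dagger>)\<dagger> = Q (schur P) z"
    proof -
      have "(?H\<dagger> - B\<dagger>) ** schur P = ?H\<dagger> ** schur P" by (simp add: mm_diff_left BS)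
      moreover have "?H\<dagger> ** schur P ** B = 0" by (simp add: matrix_mul_assoc[symmetric] f(1))
      ultimately show ?thesis by (simp add: Q_def adj_diff mm_diff_right)
    qed
    finally have "Q (A\<dagger> ** schur P ** A) z = Q (schur P) z" .
    moreover have "Q P z = Q M z + Q (A\<dagger> ** schur P ** A) z" by (subst P(2)) (simp add: Q_add)
    ultimately show ?thesis using M(2)[OF z] by (simp add: CC Q_diff)
  qed
  moreover have "invertible (C ** H w)" if w: "w \<in> cball 0 1" for w
  proof (rule inj_invertible)
    have w1: "norm w \<le> 1" using w by simp
    fix u assume u: "(C ** H w) *v u = 0"
    define x where "x = H w *v u"
    let ?J = "mat 1 - B ** gain P"
    have "C *v x = 0" using u by (simp add: x_def matrix_vector_mul_assoc)
    hence "R\<dagger> *v (C *v x) = 0" by simp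
    hence "(B\<dagger> ** P) *v x = 0" by (simp add: C_def matrix_vector_mul_assoc matrix_mul_assoc REa)
    hence "gain P *v x = 0" by (simp add: gain_def matrix_mul_assoc[symmetric] matrix_vector_mul_assoc[symmetric])
    hence Jx: "?J *v x = x" by (simp add: mv_diff_left matrix_vector_mul_assoc[symmetric])
    have JB: "?J ** B = 0"
    proof -
      have "gain P ** B = mat 1"
        using matrix_inv_left[OF pos_def_invertible[OF N]] by (simp add: gain_def N_def matrix_mul_assoc)
      thus ?thesis by (simp add: mm_diff_left matrix_mul_assoc[symmetric])
    qed
    have "x = w *s (A *v x) + B *v u"
    proof -
      have "(mat w ** A ** H w) *v u = (H w - B) *v u" using H_recurrence[OF w1] by simp
      thus ?thesis by (simp add: x_def mv_diff_left matrix_vector_mul_assoc[symmetric] mat_mv algebra_simps)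
    qed
    hence "?J *v x = ?J *v (w *s (A *v x)) + (?J ** B) *v u"
      by (metis matrix_vector_right_distrib matrix_vector_mul_assoc)
    hence xw: "x = w *s (?J *v (A *v x))" using JB by (simp add: Jx vec.scale)
    have "x = 0"
    proof (rule ccontr)
      assume x0: "x \<noteq> 0"
      let ?y = "?J *v (A *v x)"
      have "x \<bullet> (P *v x) = (norm w)\<^sup>2 * (?y \<bullet> (P *v ?y))"
        by (subst (1 2) xw) (rule quad_smult)
      also have "\<dots> \<le> 1 * (?y \<bullet> (P *v ?y))"
        using w1 by (intro mult_right_mono pos_def_nonneg[OF P(1)]) (simp add: power_le_one)
      also have "?y \<bullet> (P *v ?y) = x \<bullet> ((A\<dagger> ** schur P ** A) *v x)"
        unfolding f(3) quad_sandwich ..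
      also have "1 * \<dots> < x \<bullet> (P *v x)"
        using pos_def_pos[OF M(1) x0]
        by (subst (2) P(2)) (simp add: matrix_vector_mult_add_rdistrib inner_add_right)
      finally show False by simp
    qed
    thus "u = 0" using H_ker[OF w1] by (simp add: x_def)
  qed
  ultimately have "outer_factor \<Lambda> C" using R by (simp add: outer_factor_def CB)
  thus thesis by (rule that)
qed

end


section \<open>Uniqueness of the spectral factor\<close>

text \<open>The quotient is isometric on the circle.\<close>

lemma quotient_contraction:
  fixes F G :: "complex \<Rightarrow> complex^'m^'m"
  assumes an: "disc_analytic F" "disc_analytic G"
    and inv: "\<And>w. w \<in> cball 0 1 \<Longrightarrow> invertible (G w)"
    and gram: "\<And>z. z \<in> sphere 0 1 \<Longrightarrow> (F z)\<dagger> ** F z = (G z)\<dagger> ** G z"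
    and w: "w \<in> cball 0 1"
  shows "norm ((F w ** matrix_inv (G w)) *v y) \<le> norm y"
proof -
  have "norm ((F w ** matrix_inv (G w)) *v y) \<le> 1 * norm y"
  proof (rule maximum_modulus_matrix[OF _ _ w])
    show "disc_analytic (\<lambda>w. F w ** matrix_inv (G w))"
      by (intro disc_analytic_mult disc_analytic_inv an inv)
    fix z :: complex and y :: "complex^'m" assume z: "z \<in> sphere 0 1"
    have "invertible (G z)" using z by (intro inv) simp
    hence "G z *v (matrix_inv (G z) *v y) = y" by (simp add: matrix_vector_mul_assoc matrix_inv_right)
    thus "norm ((F z ** matrix_inv (G z)) *v y) \<le> 1 * norm y"
      using norm_of_gram_eq[OF gram[OF z], of "matrix_inv (G z) *v y"]
      by (simp add: matrix_vector_mul_assoc[symmetric])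
  qed
  thus ?thesis by simp
qed

text \<open>The quotient of two outer functions with the same Gram matrix on the circle is a contraction on the
  disc, and so is its inverse; hence it is unitary at the centre. The triangular normalization makes
  it the identity there. Its diagonal entries then attain the maximal modulus at the centre, so they
  are constantly one, and a column of norm at most one with a diagonal entry one is a unit vector.\<close>

lemma outer_functions_eq:
  fixes F G :: "complex \<Rightarrow> complex^('m::{finite,linorder})^('m::{finite,linorder})"
  assumes F: "disc_analytic F" "\<And>w. w \<in> cball 0 1 \<Longrightarrow> invertible (F w)" "lower_triangular (F 0)" "pos_diag (F 0)"
    and G: "disc_analytic G" "\<And>w. w \<in> cball 0 1 \<Longrightarrow> invertible (G w)" "lower_triangular (G 0)" "pos_diag (G 0)"
    and gram: "\<And>z. z \<in> sphere 0 1 \<Longrightarrow> (F z)\<dagger> ** F z = (G z)\<dagger> ** G z"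
    and w: "w \<in> ball 0 1"
  shows "F w = G w"
proof -
  let ?U = "\<lambda>w. F w ** matrix_inv (G w)"
  have FG: "norm (?U v *v y) \<le> norm y" if "v \<in> cball 0 1" for v y
    by (rule quotient_contraction[OF F(1) G(1) _ _ that]) (auto intro!: G(2) gram)
  have GF: "norm ((G v ** matrix_inv (F v)) *v y) \<le> norm y" if "v \<in> cball 0 1" for v y
    by (rule quotient_contraction[OF G(1) F(1) _ _ that]) (auto intro!: F(2) gram[symmetric])
  have le: "norm (F 0 *v x) \<le> norm (G 0 *v x)" "norm (G 0 *v x) \<le> norm (F 0 *v x)" for x
  proof -
    have c: "(0::complex) \<in> cball 0 1" by simp
    have "(?U 0) *v (G 0 *v x) = F 0 *v x" "(G 0 ** matrix_inv (F 0)) *v (F 0 *v x) = G 0 *v x"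
      using matrix_inv_left[OF F(2)[OF c]] matrix_inv_left[OF G(2)[OF c]]
      by (simp_all add: matrix_vector_mul_assoc matrix_mul_assoc[symmetric])
    thus "norm (F 0 *v x) \<le> norm (G 0 *v x)" "norm (G 0 *v x) \<le> norm (F 0 *v x)"
      using FG[OF c, of "G 0 *v x"] GF[OF c, of "F 0 *v x"] by simp_all
  qed
  have gram0: "(F 0)\<dagger> ** F 0 = (G 0)\<dagger> ** G 0"
  proof (rule hermitian_eq_of_quad[OF hermitian_gram hermitian_gram])
    fix x
    have "norm (F 0 *v x) = norm (G 0 *v x)" using le[of x] by (rule antisym)
    thus "x \<bullet> (((F 0)\<dagger> ** F 0) *v x) = x \<bullet> (((G 0)\<dagger> ** G 0) *v x)" by (simp add: quad_gram)
  qed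
  have F0: "F 0 = G 0"
    by (rule triangular_factor_unique[OF F(3) _ G(3,4) gram0]) (use F(4) in \<open>auto simp: pos_diag_def less_imp_le\<close>)
  have U0: "?U 0 = mat 1" using G(2)[of 0] by (simp add: F0 matrix_inv_right)
  have anU: "disc_analytic ?U" by (rule disc_analytic_mult[OF F(1) disc_analytic_inv[OF G(1,2)]])
  have Uw: "?U w *v axis i 1 = axis i 1" for i
  proof -
    let ?f = "\<lambda>w. ?U w $ i $ i"
    have col: "(?U v *v axis i 1) $ j = ?U v $ j $ i" for v j by (simp add: mv_axis_nth)
    have n1: "norm (?U v *v axis i 1) \<le> 1" if "v \<in> ball 0 1" for v
      using FG[of v "axis i 1"] that by simp
    have "?f constant_on ball 0 1"
    proof (rule maximum_modulus_principle[of ?f "ball 0 1" "ball 0 1" 0])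
      show "?f holomorphic_on ball 0 1"
        using anU unfolding disc_analytic_def
        by (meson analytic_imp_holomorphic ball_subset_cball holomorphic_on_subset)
      fix z :: complex assume z: "z \<in> ball 0 1"
      have "norm (?f z) \<le> norm (?U z *v axis i 1)"
        unfolding col[symmetric] by (rule Finite_Cartesian_Product.norm_nth_le)
      also have "\<dots> \<le> 1" by (rule n1[OF z])
      finally show "norm (?f z) \<le> norm (?f 0)" by (simp only: U0) (simp add: mat_def)
    qed auto
    hence "?f w = ?f 0" using w by (auto simp: constant_on_def)
    hence f1: "?f w = 1" by (simp only: U0) (simp add: mat_def)
    define c where "c = ?U w *v axis i 1"
    have ci: "c $ i = 1" using f1 by (simp add: c_def col)
    have "(norm c)\<^sup>2 \<le> 1" using n1[OF w] by (simp add: c_def power_le_one)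
    hence "(norm (c $ i))\<^sup>2 + (\<Sum>j\<in>UNIV - {i}. (norm (c $ j))\<^sup>2) \<le> 1"
      by (simp add: norm_sq_vec sum.remove[of UNIV i])
    hence "(\<Sum>j\<in>UNIV - {i}. (norm (c $ j))\<^sup>2) \<le> 0" by (simp add: ci)
    hence "(\<Sum>j\<in>UNIV - {i}. (norm (c $ j))\<^sup>2) = 0" by (intro antisym sum_nonneg) auto
    hence "c $ j = 0" if "j \<noteq> i" for j using that by (simp add: sum_nonneg_eq_0_iff)
    hence "c = axis i 1" using ci by (simp add: vec_eq_iff axis_def)
    thus ?thesis by (simp only: c_def)
  qed
  have "?U w $ j $ i = mat 1 $ j $ i" for i j
  proof -
    have "?U w $ j $ i = (?U w *v axis i 1) $ j" by (simp add: mv_axis_nth)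
    thus ?thesis unfolding Uw by (simp add: axis_def mat_def)
  qed
  hence U1: "?U w = mat 1" by (simp only: vec_eq_iff) simp
  have "F w = ?U w ** G w"
    using G(2)[of w] w by (simp add: matrix_mul_assoc[symmetric] matrix_inv_left)
  thus ?thesis by (simp add: U1)
qed

text \<open>Equality off the disc forces the two reduced fractions to agree up to a unit, including their poles,
  at which both functions take the value zero.\<close>

lemma rational_fun_eq:
  assumes f: "rational_fun f" and g: "rational_fun g" and eq: "\<And>z. norm z > 1 \<Longrightarrow> f z = g z"
  shows "f = g"
proof -
  obtain p q where pq: "q \<noteq> 0" "coprime p q" "\<And>z. f z = poly p z / poly q z"
    using f unfolding rational_fun_def by blast
  obtain r s where rs: "s \<noteq> 0" "coprime r s" "\<And>z. g z = poly r z / poly s z"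
    using g unfolding rational_fun_def by blast
  have "p * s = r * q"
  proof (rule ccontr)
    assume "p * s \<noteq> r * q"
    hence "finite ({z. poly (p * s - r * q) z = 0} \<union> {z. poly q z = 0} \<union> {z. poly s z = 0})"
      using pq(1) rs(1) by (intro finite_UnI poly_roots_finite) auto
    moreover have "{z. norm z > 1} \<subseteq> {z. poly (p * s - r * q) z = 0} \<union> {z. poly q z = 0} \<union> {z. poly s z = 0}"
    proof clarsimp
      fix z assume z: "1 < norm z" "poly s z \<noteq> 0" "poly q z \<noteq> 0"
      have "poly p z / poly q z = poly r z / poly s z" using eq[OF z(1)] by (simp add: pq(3) rs(3))
      thus "poly p z * poly s z = poly r z * poly q z" using z by (simp add: frac_eq_eq)
    qed
    ultimately have "finite {z::complex. norm z > 1}" by (rule finite_subset[rotated])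
    hence "finite (of_nat ` {2..} :: complex set)"
      by (rule finite_subset[rotated]) auto
    hence "finite {2::nat..}" by (rule finite_imageD) (auto simp: inj_on_def)
    thus False by (simp add: infinite_Ici)
  qed
  hence "q dvd p * s" "s dvd r * q" by (metis dvd_triv_right)+
  hence "q dvd s" "s dvd q"
    using pq(2) rs(2) by (auto simp: coprime_dvd_mult_right_iff coprime_dvd_mult_left_iff coprime_commute)
  then obtain c where c: "s = c * q" "c dvd 1" using pq(1)
    by (metis dvd_def dvd_times_right_cancel_iff mult.commute mult_1)
  have c0: "c \<noteq> 0" using c(2) by auto
  have "r * q = c * p * q" unfolding \<open>p * s = r * q\<close>[symmetric] c(1) by (simp only: ac_simps)
  hence r: "r = c * p" by (rule mult_right_cancel[OF pq(1), THEN iffD1])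
  have "poly c z \<noteq> 0" for z using c(2) by (metis poly_1 poly_mult dvdE mult_zero_left zero_neq_one)
  thus ?thesis by (auto simp: fun_eq_iff pq(3) rs(3) r c(1))
qed

lemma poly_det:
  fixes P :: "complex poly^'n^'n"
  shows "poly (det P) z = det (\<chi> i j. poly (P $ i $ j) z)"
  by (simp add: det_def poly_sum poly_prod)

lemma rational_fun_extension:
  assumes "q \<noteq> 0"
  obtains f where "rational_fun f" "\<And>z. poly q z \<noteq> 0 \<Longrightarrow> f z = poly p z / poly q z"
proof -
  have "gcd p q \<noteq> 0" using assms by simp
  then obtain p' q' where pq: "p = p' * gcd p q" "q = q' * gcd p q" "coprime p' q'"
    using gcd_coprime_exists by blast
  show thesis
  proof
    have "q' \<noteq> 0" using assms pq(2) by auto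
    thus "rational_fun (\<lambda>z. poly p' z / poly q' z)" unfolding rational_fun_def using pq(3) by blast
    fix z assume z: "poly q z \<noteq> 0"
    define g where "g = poly (gcd p q) z"
    have "poly p z = poly p' z * g" "poly q z = poly q' z * g"
      by (metis pq(1) poly_mult g_def, metis pq(2) poly_mult g_def)
    thus "poly p' z / poly q' z = poly p z / poly q z" using z by simp
  qed
qed

text \<open>The transport of a function on the outside of the circle to the disc by \<open>w = 1/z\<close>, with the value \<open>L\<close> at the
  centre.\<close>

definition inversion_extension :: "(complex \<Rightarrow> complex^'n^'m) \<Rightarrow> complex^'n^'m \<Rightarrow> complex \<Rightarrow> complex^'n^'m" where
  "inversion_extension F L w = (if w = 0 then L else F (inverse w))"

lemma analytic_outside_iff: "analytic_outside F L \<longleftrightarrow> disc_analytic (inversion_extension F L)"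
proof -
  have "(\<lambda>w. if w = 0 then L $ i $ j else F (inverse w) $ i $ j)
      = (\<lambda>w. inversion_extension F L w $ i $ j)" for i j
    by (auto simp: inversion_extension_def)
  thus ?thesis by (simp add: analytic_outside_def disc_analytic_def)
qed

lemma circle_inverse: "z \<in> sphere 0 1 \<Longrightarrow> inverse z = cnj z" for z :: complex
  by (rule inverse_unique) (simp add: complex_norm_square[symmetric])

context reachable_pair
begin

lemma spectral_factor_disc:
  assumes "is_spectral_factor A B \<Lambda> W"
  obtains L where "disc_analytic (inversion_extension W L)"
    "\<And>w. w \<in> cball 0 1 \<Longrightarrow> invertible (inversion_extension W L w)"
    "lower_triangular (inversion_extension W L 0)" "pos_diag (inversion_extension W L 0)"
    "\<And>z. z \<in> sphere 0 1 \<Longrightarrow> (inversion_extension W L z)\<dagger> ** inversion_extension W L z = Q \<Lambda> (cnj z)"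
proof -
  obtain L where L: "analytic_outside W L" "\<And>z. 1 \<le> norm z \<Longrightarrow> invertible (W z)" "invertible L"
     "lower_triangular L" "\<forall>i. L $ i $ i \<in> \<real> \<and> 0 < Re (L $ i $ i)"
    using assms unfolding is_spectral_factor_def by blast
  show thesis
  proof (rule that[of L])
    show "disc_analytic (inversion_extension W L)" using L(1) by (simp add: analytic_outside_iff)
    show "invertible (inversion_extension W L w)" if "w \<in> cball 0 1" for w
      using L(2)[of "inverse w"] L(3) that one_le_inverse[of "norm w"]
      by (auto simp: inversion_extension_def norm_inverse)
    show "lower_triangular (inversion_extension W L 0)" "pos_diag (inversion_extension W L 0)"
      using L by (simp_all add: inversion_extension_def pos_diag_def)
    fix z :: complex assume z: "z \<in> sphere 0 1"
    have "inversion_extension W L z = W (cnj z)"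
      using z circle_inverse[OF z] by (auto simp: inversion_extension_def)
    moreover have "cnj z \<in> sphere 0 1" using z by simp
    ultimately show "(inversion_extension W L z)\<dagger> ** inversion_extension W L z = Q \<Lambda> (cnj z)"
      using assms transfer_fun_gram[of "cnj z" \<Lambda>] unfolding is_spectral_factor_def Q_def by metis
  qed
qed

lemma is_spectral_factor_unique:
  assumes W: "is_spectral_factor A B \<Lambda> W" and V: "is_spectral_factor A B \<Lambda> V"
  shows "W = V"
proof -
  obtain L where L: "disc_analytic (inversion_extension W L)"
    "\<And>w. w \<in> cball 0 1 \<Longrightarrow> invertible (inversion_extension W L w)"
    "lower_triangular (inversion_extension W L 0)" "pos_diag (inversion_extension W L 0)"
    "\<And>z. z \<in> sphere 0 1 \<Longrightarrow> (inversion_extension W L z)\<dagger> ** inversion_extension W L z = Q \<Lambda> (cnj z)"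
    using spectral_factor_disc[OF W] by blast
  obtain M where M: "disc_analytic (inversion_extension V M)"
    "\<And>w. w \<in> cball 0 1 \<Longrightarrow> invertible (inversion_extension V M w)"
    "lower_triangular (inversion_extension V M 0)" "pos_diag (inversion_extension V M 0)"
    "\<And>z. z \<in> sphere 0 1 \<Longrightarrow> (inversion_extension V M z)\<dagger> ** inversion_extension V M z = Q \<Lambda> (cnj z)"
    using spectral_factor_disc[OF V] by blast
  have eq: "inversion_extension W L w = inversion_extension V M w" if "w \<in> ball 0 1" for w
    by (rule outer_functions_eq[OF L(1-4) M(1-4) _ that]) (simp_all add: L(5) M(5))
  have WV: "W z = V z" if "norm z > 1" for z
  proof -
    have "z \<noteq> 0" using that by auto
    moreover have "inverse z \<in> ball 0 1" using that by (simp add: norm_inverse inverse_less_1_iff)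
    ultimately show ?thesis using eq[of "inverse z"] by (simp add: inversion_extension_def)
  qed
  have "(\<lambda>z. W z $ i $ j) = (\<lambda>z. V z $ i $ j)" for i j
    using W V WV by (intro rational_fun_eq) (auto simp: is_spectral_factor_def rational_matrix_fun_def)
  thus ?thesis by (simp add: fun_eq_iff vec_eq_iff)
qed

definition charpoly_matrix :: "complex poly^'n^'n" where
  "charpoly_matrix = (\<chi> i j. if i = j then [:- A $ i $ j, 1:] else [:- A $ i $ j:])"

lemma poly_charpoly_matrix: "(\<chi> i j. poly (charpoly_matrix $ i $ j) z) = mat z - A"
  by (auto simp: charpoly_matrix_def vec_eq_iff mat_def)

text \<open>Evaluation of polynomials commutes with determinants, so Cramer's rule can be carried out over
  the polynomial ring.\<close>

lemma resolvent_rational: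
  obtains R where "\<And>z. poly (det charpoly_matrix) z \<noteq> 0 \<Longrightarrow>
    matrix_inv (mat z - A) $ i $ j = poly R z / poly (det charpoly_matrix) z"
proof
  let ?R = "det (\<chi> k l. if l = i then [:axis j 1 $ k:] else charpoly_matrix $ k $ l)"
  fix z assume z: "poly (det charpoly_matrix) z \<noteq> 0"
  have "det (mat z - A) \<noteq> 0" using z by (simp add: poly_det poly_charpoly_matrix)
  hence "matrix_inv (mat z - A) $ i $ j
      = det (\<chi> k l. if l = i then axis j 1 $ k else (mat z - A) $ k $ l) / det (mat z - A)"
    by (intro matrix_inv_cramer) (simp add: invertible_det_nz)
  also have "det (\<chi> k l. if l = i then axis j 1 $ k else (mat z - A) $ k $ l) = poly ?R z"
    unfolding poly_det poly_charpoly_matrix[symmetric]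
    by (rule arg_cong[of _ _ det]) (simp add: vec_eq_iff)
  finally show "matrix_inv (mat z - A) $ i $ j = poly ?R z / poly (det charpoly_matrix) z"
    by (simp add: poly_det poly_charpoly_matrix)
qed

lemma invertible_pencil_iff:
  assumes "z \<noteq> 0"
  shows "invertible (mat 1 - mat (inverse z) ** A) \<longleftrightarrow> poly (det charpoly_matrix) z \<noteq> 0"
proof -
  have e: "mat z - A = mat z ** (mat 1 - mat (inverse z) ** A)"
    using assms by (simp add: mm_diff_right matrix_mul_assoc mat_mult_mat)
  have "det (mat z :: complex^'n^'n) \<noteq> 0"
    using matrix_inv_unique(1)[of "mat z" "mat (inverse z) :: complex^'n^'n"] assms
    by (simp add: mat_mult_mat invertible_det_nz)
  thus ?thesis
    by (simp add: poly_det poly_charpoly_matrix e det_mul invertible_det_nz)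
qed

text \<open>The reduced representation only agrees with \<open>C H(1/z)\<close> away from the origin and the eigenvalues of
  \<open>A\<close>, all of which lie in the open disc.\<close>

lemma outer_function_rational:
  obtains W where "rational_matrix_fun W"
    "\<And>z. z \<noteq> 0 \<Longrightarrow> invertible (mat 1 - mat (inverse z) ** A) \<Longrightarrow> W z = C ** H (inverse z)"
proof -
  let ?q = "det charpoly_matrix"
  have "\<forall>i j. \<exists>R. \<forall>z. poly ?q z \<noteq> 0 \<longrightarrow> matrix_inv (mat z - A) $ i $ j = poly R z / poly ?q z"
    using resolvent_rational by blast
  then obtain R where R: "\<And>i j z. poly ?q z \<noteq> 0 \<Longrightarrow> matrix_inv (mat z - A) $ i $ j = poly (R i j) z / poly ?q z"
    by metis
  define p where "p i j = [:0, 1:] * (\<Sum>k\<in>UNIV. [:C $ i $ k:] * (\<Sum>l\<in>UNIV. R k l * [:B $ l $ j:]))" for i j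
  have q0: "?q \<noteq> 0"
  proof
    assume "?q = 0"
    thus False using invertible_pencil_iff[of 1] stable_invertible[OF stable, of 1] by simp
  qed
  have "\<forall>i j. \<exists>f. rational_fun f \<and> (\<forall>z. poly ?q z \<noteq> 0 \<longrightarrow> f z = poly (p i j) z / poly ?q z)"
    using rational_fun_extension[OF q0] by metis
  then obtain f where f: "\<And>i j. rational_fun (f i j)"
    "\<And>i j z. poly ?q z \<noteq> 0 \<Longrightarrow> f i j z = poly (p i j) z / poly ?q z" by metis
  show thesis
  proof
    show "rational_matrix_fun (\<lambda>z. \<chi> i j. f i j z)" using f(1) by (simp add: rational_matrix_fun_def)
    fix z :: complex assume z: "z \<noteq> 0" "invertible (mat 1 - mat (inverse z) ** A)"
    hence qz: "poly ?q z \<noteq> 0" by (simp add: invertible_pencil_iff)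
    have comm: "mat (inverse z) ** (C ** H (inverse z)) = C ** transfer_fun A B z"
      unfolding transfer_fun_eq_H[OF z] by (simp only: matrix_mul_assoc mat_commute[of "inverse z" C])
    have "mat z ** (mat (inverse z) ** (C ** H (inverse z))) = C ** H (inverse z)"
      unfolding matrix_mul_assoc[of "mat z" "mat (inverse z)"] mat_mult_mat using z(1) by simp
    hence e: "C ** H (inverse z) = mat z ** (C ** transfer_fun A B z)" by (simp only: comm)
    have "(C ** H (inverse z)) $ i $ j = f i j z" for i j
      unfolding e mat_mm_nth f(2)[OF qz]
      by (simp add: p_def transfer_fun_def matrix_matrix_mult_def R[OF qz] poly_sum sum_divide_distrib sum_distrib_left)
         (simp only: ac_simps)
    thus "(\<chi> i j. f i j z) = C ** H (inverse z)" by (simp add: vec_eq_iff)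
  qed
qed

lemma outer_factor_spectral_factor:
  assumes C: "outer_factor \<Lambda> C"
  obtains W where "is_spectral_factor A B \<Lambda> W" "\<And>z. z \<in> sphere 0 1 \<Longrightarrow> W z = C ** H (cnj z)"
proof -
  obtain W where W: "rational_matrix_fun W"
    "\<And>z. z \<noteq> 0 \<Longrightarrow> invertible (mat 1 - mat (inverse z) ** A) \<Longrightarrow> W z = C ** H (inverse z)"
    using outer_function_rational by blast
  have W1: "W z = C ** H (inverse z)" if "norm z \<ge> 1" for z
  proof -
    have "z \<noteq> 0" "norm (inverse z) \<le> 1" using that by (auto simp: norm_inverse inverse_le_1_iff)
    thus ?thesis using W(2) stable_invertible[OF stable] by blast
  qed
  have Wc: "W z = C ** H (cnj z)" if "z \<in> sphere 0 1" for z
    using W1[of z] circle_inverse[OF that] that by simp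
  note C' = C[unfolded outer_factor_def]
  have inv: "invertible (C ** H w)" if "w \<in> cball 0 1" for w using C' that by blast
  let ?V = "{w. det (mat 1 - mat w ** A) \<noteq> 0}"
  have "continuous_on UNIV (\<lambda>w. det (mat 1 - mat w ** A))"
  proof (rule continuous_on_det)
    show "continuous_on UNIV (\<lambda>w. (mat 1 - mat w ** A) $ i $ j)" for i j
      by (simp add: mat_mm_nth) (intro continuous_intros)
  qed
  hence openV: "open ?V" by (intro open_Collect_neq continuous_on_const)
  have near: "eventually (\<lambda>v. inversion_extension W (C ** B) v = C ** H v) (nhds w)" if "w \<in> cball 0 1" for w
  proof -
    have "w \<in> ?V" using stable_invertible[OF stable, of w] that by (simp add: invertible_det_nz)
    hence "eventually (\<lambda>v. v \<in> ?V) (nhds w)" by (rule eventually_nhds_in_open[OF openV])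
    thus ?thesis
      by eventually_elim
        (use W(2)[of "inverse _"] in \<open>auto simp: inversion_extension_def H_0 invertible_det_nz\<close>)
  qed
  have transfer: "disc_analytic G" if F: "disc_analytic F"
      and ev: "\<And>w. w \<in> cball 0 1 \<Longrightarrow> eventually (\<lambda>v. G v = F v) (nhds w)"
    for F G :: "complex \<Rightarrow> complex^('m::{finite,linorder})^('m::{finite,linorder})"
    unfolding disc_analytic_def
  proof (intro allI)
    fix i j
    have "(\<lambda>w. G w $ i $ j) analytic_on {w}" if w: "w \<in> cball 0 1" for w
    proof -
      have "(\<lambda>w. F w $ i $ j) analytic_on {w}"
        using F w unfolding disc_analytic_def by (meson analytic_on_subset empty_subsetI insert_subset)
      moreover have "eventually (\<lambda>v. G v $ i $ j = F v $ i $ j) (nhds w)"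
        using ev[OF w] by eventually_elim simp
      ultimately show ?thesis by (simp only: analytic_at_cong[OF _ refl])
    qed
    thus "(\<lambda>w. G w $ i $ j) analytic_on cball 0 1"
      using analytic_on_analytic_at by blast
  qed
  have CH: "disc_analytic (\<lambda>w. C ** H w)" by (intro disc_analytic_mult disc_analytic_const disc_analytic_H)
  have "analytic_outside W (C ** B)"
    unfolding analytic_outside_iff by (rule transfer[OF CH near])
  moreover have "analytic_outside (\<lambda>z. matrix_inv (W z)) (matrix_inv (C ** B))"
    unfolding analytic_outside_iff
  proof (rule transfer[OF disc_analytic_inv[OF CH inv]])
    fix w :: complex assume "w \<in> cball 0 1"
    from near[OF this]
    show "eventually (\<lambda>v. inversion_extension (\<lambda>z. matrix_inv (W z)) (matrix_inv (C ** B)) v = matrix_inv (C ** H v)) (nhds w)"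
      by eventually_elim (auto simp: inversion_extension_def split: if_splits)
  qed
  moreover have "invertible (W z)" if "1 \<le> norm z" for z
  proof -
    have "inverse z \<in> cball 0 1" using that by (auto simp: norm_inverse inverse_le_1_iff)
    thus ?thesis using W1[OF that] inv by simp
  qed
  moreover have "invertible (C ** B)" using inv[of 0] by (simp add: H_0)
  moreover have "(transfer_fun A B z)\<dagger> ** \<Lambda> ** transfer_fun A B z = (W z)\<dagger> ** W z" if z: "z \<in> sphere 0 1" for z
    using C' z unfolding transfer_fun_gram[OF z] Wc[OF z] Q_gram[symmetric] by (simp add: Q_def)
  ultimately have "is_spectral_factor A B \<Lambda> W"
    unfolding is_spectral_factor_def using W(1) C' unfolding pos_diag_def by blast
  thus thesis using Wc by (rule that)
qed

lemma spectral_factor_eq: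
  assumes "outer_factor \<Lambda> C" "z \<in> sphere 0 1"
  shows "spectral_factor A B \<Lambda> z = C ** H (cnj z)"
proof -
  obtain W where W: "is_spectral_factor A B \<Lambda> W" "\<And>z. z \<in> sphere 0 1 \<Longrightarrow> W z = C ** H (cnj z)"
    using outer_factor_spectral_factor[OF assms(1)] by blast
  have "spectral_factor A B \<Lambda> = W"
    unfolding spectral_factor_def using W(1) is_spectral_factor_unique by blast
  thus ?thesis using W(2) assms(2) by simp
qed

text \<open>The spectral factors agree, so \<open>C - C'\<close> annihilates \<open>H\<close> on the circle, and reachability applies to its
  rows.\<close>

lemma outer_factor_unique:
  assumes "outer_factor \<Lambda> C" "outer_factor \<Lambda> C'"
  shows "C = C'"
proof -
  have "(C - C') ** H z = 0" if "z \<in> sphere 0 1" for z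
    using spectral_factor_eq[OF assms(1), of "cnj z"] spectral_factor_eq[OF assms(2), of "cnj z"] that
    by (simp add: mm_diff_left)
  hence "(H z)\<dagger> *v ((C - C')\<dagger> *v x) = 0" if "z \<in> sphere 0 1" for z x
    using that by (metis adj_mult adj_0 matrix_vector_mul_assoc mv_zero_left)
  hence "(C - C')\<dagger> *v x = 0" for x by (rule annihilates_circle)
  hence "(C - C')\<dagger> = 0" by (rule matrix_eq_0I)
  hence "C - C' = 0" by (metis adj_adj adj_0)
  thus ?thesis by simp
qed

end


section \<open>Estimates uniform in the multiplier\<close>

lemma norm_cis_diff: "norm (cis t - cis s) \<le> \<bar>t - s\<bar>"
proof -
  have "(norm (cis t - cis s))\<^sup>2 = 2 - 2 * cos (t - s)"
    by (simp add: cmod_power2 cos_diff power2_diff algebra_simps)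
  also have "\<dots> = (2 * sin ((t - s) / 2))\<^sup>2"
    using cos_double_sin[of "(t - s) / 2"] by (simp add: power_mult_distrib)
  also have "\<dots> \<le> (t - s)\<^sup>2"
    unfolding abs_le_square_iff[symmetric] using abs_sin_x_le_abs_x[of "(t - s) / 2"] by simp
  also have "\<dots> = \<bar>t - s\<bar>\<^sup>2" by simp
  finally show ?thesis by (rule power2_le_imp_le) simp
qed

text \<open>The integral of the reciprocal of a function that grows at most linearly from its value at \<open>z0\<close> is at
  least of the order of the logarithm of the reciprocal of that value. The half circle used for the comparison is taken on the
  side of the angle \<open>s\<close> of \<open>z0\<close> that stays inside the parameter interval.\<close>

lemma circle_integral_reciprocal_ge:
  fixes h :: "complex \<Rightarrow> real"
  assumes cont: "continuous_on (sphere 0 1) h" and pos: "\<And>z. z \<in> sphere 0 1 \<Longrightarrow> 0 < h z"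
    and L: "L > 0" and z0: "z0 \<in> sphere 0 1"
    and lip: "\<And>t s. h (cis t) \<le> h (cis s) + L * \<bar>t - s\<bar>"
  shows "ln (L * pi) - ln (h z0) \<le> 2 * pi * L * circle_integral (\<lambda>z. 1 / h z)"
proof -
  obtain s where s: "s \<in> {0..2*pi}" "z0 = cis s" using circle_point[OF z0] .
  define a where "a = h z0"
  have a: "a > 0" using pos[OF z0] by (simp add: a_def)
  have hpos: "0 < h (cis t)" for t by (intro pos) simp
  have lower: "1 / (a + L * \<bar>t - s\<bar>) \<le> 1 / h (cis t)" for t
    using lip[of t s] hpos[of t] by (intro divide_left_mono mult_pos_pos) (auto simp: a_def s(2))
  have "continuous_on (sphere 0 1) (\<lambda>z. 1 / h z)"
    by (intro continuous_intros cont) (use pos in force)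
  hence int: "((\<lambda>t. 1 / h (cis t)) has_integral (2 * pi) *\<^sub>R circle_integral (\<lambda>z. 1 / h z)) {0..2*pi}"
    by (intro circle_integral_has_integral circle_integrable_continuous)
  define I where "I = (ln (a + L * pi) - ln a) / L"
  obtain p q where pq: "0 \<le> p" "p \<le> q" "q \<le> 2*pi"
    and half: "((\<lambda>t. 1 / (a + L * \<bar>t - s\<bar>)) has_integral I) {p..q}"
  proof (cases "s \<le> pi")
    case True
    have "((\<lambda>t. 1 / (a + L * (t - s))) has_integral
       (ln (a + L * ((s + pi) - s)) / L - ln (a + L * (s - s)) / L)) {s..s + pi}"
      using a L
      by (intro fundamental_theorem_of_calculus)
         (auto intro!: derivative_eq_intros simp: has_real_derivative_iff_has_vector_derivative[symmetric] add_pos_nonneg)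
    hence "((\<lambda>t. 1 / (a + L * (t - s))) has_integral I) {s..s + pi}"
      by (simp add: I_def diff_divide_distrib)
    hence "((\<lambda>t. 1 / (a + L * \<bar>t - s\<bar>)) has_integral I) {s..s + pi}"
      by (rule has_integral_eq[rotated]) auto
    moreover have "0 \<le> s" "s \<le> s + pi" "s + pi \<le> 2*pi" using s(1) True by auto
    ultimately show thesis by (rule that[rotated 3])
  next
    case False
    have "((\<lambda>t. 1 / (a + L * (s - t))) has_integral
       (- ln (a + L * (s - s)) / L - (- ln (a + L * (s - (s - pi))) / L))) {s - pi..s}"
      using a L
      by (intro fundamental_theorem_of_calculus)
         (auto intro!: derivative_eq_intros simp: has_real_derivative_iff_has_vector_derivative[symmetric] add_pos_nonneg)
    hence "((\<lambda>t. 1 / (a + L * (s - t))) has_integral I) {s - pi..s}"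
      by (simp add: I_def diff_divide_distrib)
    hence "((\<lambda>t. 1 / (a + L * \<bar>t - s\<bar>)) has_integral I) {s - pi..s}"
      by (rule has_integral_eq[rotated]) auto
    moreover have "0 \<le> s - pi" "s - pi \<le> s" "s \<le> 2*pi" using s(1) False by auto
    ultimately show thesis by (rule that[rotated 3])
  qed
  have int': "(\<lambda>t. 1 / h (cis t)) integrable_on {p..q}"
    by (rule integrable_on_subinterval[OF has_integral_integrable[OF int]]) (use pq in auto)
  have "I \<le> integral {p..q} (\<lambda>t. 1 / h (cis t))"
    by (rule has_integral_le[OF half integrable_integral[OF int']]) (rule lower)
  also have "\<dots> \<le> integral {0..2*pi} (\<lambda>t. 1 / h (cis t))"
    by (rule integral_subset_le[OF _ int' has_integral_integrable[OF int]])
      (use pq hpos in \<open>auto simp: less_imp_le\<close>)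
  also have "\<dots> = 2 * pi * circle_integral (\<lambda>z. 1 / h z)"
    using integral_unique[OF int] by simp
  finally have "I * L \<le> 2 * pi * circle_integral (\<lambda>z. 1 / h z) * L" using L by (intro mult_right_mono) auto
  moreover have "I * L = ln (a + L * pi) - ln a" using L by (simp add: I_def)
  moreover have "ln (L * pi) \<le> ln (a + L * pi)"
    using a L by (intro ln_mono) (auto intro: add_pos_pos)
  ultimately show ?thesis by (simp add: a_def ac_simps)
qed

text \<open>The Hartman-Stampacchia theorem: \<open>x\<close> is a fixed point of \<open>x \<mapsto> proj (x + v x)\<close>, and the conclusion is
  the obtuse angle property of the nearest point projection.\<close>

lemma variational_solution:
  fixes v :: "'a::euclidean_space \<Rightarrow> 'a"
  assumes "compact D" "convex D" "D \<noteq> {}" "continuous_on D v"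
  obtains x where "x \<in> D" "\<And>y. y \<in> D \<Longrightarrow> v x \<bullet> (y - x) \<le> 0"
proof -
  let ?f = "\<lambda>x. closest_point D (x + v x)"
  note cl = compact_imp_closed[OF assms(1)]
  have "continuous_on D ?f"
    using continuous_on_compose2[OF continuous_on_closest_point[OF assms(2) cl assms(3), of UNIV], of D "\<lambda>x. x + v x"]
    by (simp add: assms(4) continuous_on_add continuous_on_id)
  moreover have "?f \<in> D \<rightarrow> D" using closest_point_in_set[OF cl assms(3)] by auto
  ultimately obtain x where x: "x \<in> D" "?f x = x" using brouwer[OF assms(1-3)] by blast
  have "v x \<bullet> (y - x) \<le> 0" if "y \<in> D" for y
    using closest_point_dot[OF assms(2) cl that, of "x + v x"] x(2) by simp
  thus thesis using x(1) that by blast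
qed

context reachable_pair
begin

text \<open>By the resolvent identity.\<close>

lemma H_lipschitz:
  obtains D where "D > 0" "\<And>v w. v \<in> cball 0 1 \<Longrightarrow> w \<in> cball 0 1 \<Longrightarrow> norm (H v - H w) \<le> D * norm (v - w)"
proof -
  have "compact (resolv A ` cball 0 1)"
    by (intro compact_continuous_image disc_analytic_continuous disc_analytic_resolv stable) simp
  then obtain K where K: "K > 0" "\<forall>x\<in>resolv A ` cball 0 1. norm x \<le> K"
    using compact_imp_bounded bounded_pos by blast
  obtain K' where K': "K' > 0" "\<And>w. w \<in> cball 0 1 \<Longrightarrow> norm (H w) \<le> K'" using H_bounded by blast
  show thesis
  proof
    show "0 < K * (norm A + 1) * K'" using K K' by (intro mult_pos_pos) (auto intro: add_nonneg_pos)
    fix v w :: complex assume vw: "v \<in> cball 0 1" "w \<in> cball 0 1"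
    have v: "norm v \<le> 1" and w: "norm w \<le> 1" using vw by auto
    let ?E = "mat (v - w) ** (resolv A v ** A ** H w)"
    have "(mat 1 - mat v ** A) ** H v = B"
      using H_recurrence[OF v] by (simp add: mm_diff_left)
    moreover have "(mat 1 - mat v ** A) ** H w = B - mat (v - w) ** A ** H w"
    proof -
      have m: "mat (v - w) = mat v - (mat w :: complex^'n^'n)" by (simp add: vec_eq_iff mat_def)
      show ?thesis using H_recurrence[OF w] by (simp add: m mm_diff_left)
    qed
    ultimately have "(mat 1 - mat v ** A) ** (H v - H w) = mat (v - w) ** A ** H w"
      by (simp add: mm_diff_right)
    hence "resolv A v ** ((mat 1 - mat v ** A) ** (H v - H w)) = resolv A v ** (mat (v - w) ** A ** H w)"
      by simp
    hence "H v - H w = resolv A v ** (mat (v - w) ** A ** H w)"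
      using matrix_inv_left[OF stable_invertible[OF stable v]] by (simp add: resolv_def matrix_mul_assoc)
    also have "\<dots> = ?E" by (simp only: matrix_mul_assoc mat_commute[of "v - w" "resolv A v"])
    finally have "norm (H v - H w) = norm (v - w) * norm (resolv A v ** A ** H w)"
      by (simp add: norm_mat_mult)
    moreover have "norm (resolv A v ** A ** H w) \<le> K * (norm A + 1) * K'"
    proof -
      have "norm (resolv A v ** A ** H w) \<le> norm (resolv A v) * norm A * norm (H w)"
        by (rule order_trans[OF norm_mm_le mult_right_mono[OF norm_mm_le norm_ge_zero]])
      also have "\<dots> \<le> K * (norm A + 1) * K'"
        using K K'(2)[OF vw(2)] vw by (intro mult_mono mult_nonneg_nonneg) auto
      finally show ?thesis .
    qed
    ultimately show "norm (H v - H w) \<le> K * (norm A + 1) * K' * norm (v - w)"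
      by (simp add: mult_left_mono mult.commute[of _ "norm (v - w)"])
  qed
qed

lemma Q_lipschitz:
  obtains D where "D > 0" "\<And>\<Lambda> x t s. norm x = 1 \<Longrightarrow>
    x \<bullet> (Q \<Lambda> (cis t) *v x) \<le> x \<bullet> (Q \<Lambda> (cis s) *v x) + D * norm \<Lambda> * \<bar>t - s\<bar>"
proof -
  obtain D where D: "D > 0" "\<And>v w. v \<in> cball 0 1 \<Longrightarrow> w \<in> cball 0 1 \<Longrightarrow> norm (H v - H w) \<le> D * norm (v - w)"
    using H_lipschitz by blast
  obtain K where K: "K > 0" "\<And>w. w \<in> cball 0 1 \<Longrightarrow> norm (H w) \<le> K" using H_bounded by blast
  show thesis
  proof
    show "0 < 2 * K * D" using D K by simp
    fix \<Lambda> and x :: "complex^('m::{finite,linorder})" and t s :: real assume x: "norm x = 1"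
    define u where "u = H (cnj (cis t)) *v x"
    define v where "v = H (cnj (cis s)) *v x"
    have nu: "norm u \<le> K" "norm v \<le> K"
      unfolding u_def v_def using K(2) by (auto intro!: order_trans[OF norm_mv_le] simp: x)
    have "norm (u - v) \<le> norm (H (cnj (cis t)) - H (cnj (cis s))) * norm x"
      unfolding u_def v_def mv_diff_left[symmetric] by (rule norm_mv_le)
    also have "\<dots> \<le> D * norm (cnj (cis t) - cnj (cis s))" using D(2) by (simp add: x)
    also have "norm (cnj (cis t) - cnj (cis s)) = norm (cis t - cis s)"
      by (metis complex_cnj_diff complex_mod_cnj)
    also have "D * \<dots> \<le> D * \<bar>t - s\<bar>" using D by (intro mult_left_mono norm_cis_diff) auto
    finally have uv: "norm (u - v) \<le> D * \<bar>t - s\<bar>" .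
    have "u \<bullet> (\<Lambda> *v u) - v \<bullet> (\<Lambda> *v v) = (u - v) \<bullet> (\<Lambda> *v u) + v \<bullet> (\<Lambda> *v (u - v))"
      by (simp add: inner_diff_left inner_diff_right matrix_vector_mult_diff_distrib)
    also have "\<dots> \<le> norm (u - v) * (norm \<Lambda> * norm u) + norm v * (norm \<Lambda> * norm (u - v))"
      by (intro add_mono order_trans[OF norm_cauchy_schwarz] mult_left_mono norm_mv_le) auto
    also have "\<dots> = norm \<Lambda> * norm (u - v) * (norm u + norm v)" by (simp add: algebra_simps)
    also have "\<dots> \<le> norm \<Lambda> * (D * \<bar>t - s\<bar>) * (K + K)"
      using D nu uv by (intro mult_mono mult_nonneg_nonneg add_mono) auto
    finally show "x \<bullet> (Q \<Lambda> (cis t) *v x) \<le> x \<bullet> (Q \<Lambda> (cis s) *v x) + 2 * K * D * norm \<Lambda> * \<bar>t - s\<bar>"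
      by (simp add: quad_Q u_def v_def algebra_simps)
  qed
qed

definition uniformly_positive :: "real \<Rightarrow> complex^'n^'n \<Rightarrow> bool" where
  "uniformly_positive \<epsilon> \<Lambda> \<longleftrightarrow> (\<forall>z\<in>sphere 0 1. \<forall>x. \<epsilon> * (norm x)\<^sup>2 \<le> x \<bullet> (Q \<Lambda> z *v x))"

lemma uniformly_positive_L_plus:
  assumes "hermitian \<Lambda>" "\<epsilon> > 0" "uniformly_positive \<epsilon> \<Lambda>" shows "\<Lambda> \<in> L_plus A B"
  unfolding L_plus_iff
proof (intro conjI ballI assms(1))
  fix z :: complex assume "z \<in> sphere 0 1"
  thus "pos_def (Q \<Lambda> z)"
    using assms by (intro pos_def_of_bound[of _ \<epsilon>] hermitian_Q) (simp_all add: uniformly_positive_def)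
qed

lemma L_plus_uniformly_positive:
  assumes "\<Lambda> \<in> L_plus A B" obtains \<epsilon> where "\<epsilon> > 0" "uniformly_positive \<epsilon> \<Lambda>"
proof (rule sphere_pos_def_bound[OF continuous_Q[of \<Lambda>]])
  show "pos_def (Q \<Lambda> z)" if "z \<in> sphere 0 1" for z using assms that by (simp add: L_plus_iff)
qed (simp add: that uniformly_positive_def)

text \<open>The inverse of \<open>C H\<close> is analytic on the disc, so its bound on the circle holds inside as well.\<close>

lemma outer_factor_lower_bound:
  assumes C: "outer_factor \<Lambda> C" and e: "\<epsilon> > 0" "uniformly_positive \<epsilon> \<Lambda>" and w: "w \<in> cball 0 1"
  shows "\<epsilon> * (norm x)\<^sup>2 \<le> (norm ((C ** H w) *v x))\<^sup>2"
    "norm (matrix_inv (C ** H w) *v y) \<le> (1 / sqrt \<epsilon>) * norm y"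
proof -
  note C' = C[unfolded outer_factor_def]
  have inv: "invertible (C ** H w)" if "w \<in> cball 0 1" for w using C' that by blast
  have sq: "sqrt \<epsilon> > 0" using e by simp
  show 1: "norm (matrix_inv (C ** H w) *v y) \<le> (1 / sqrt \<epsilon>) * norm y" for y
  proof (rule maximum_modulus_matrix[OF _ _ w])
    show "disc_analytic (\<lambda>w. matrix_inv (C ** H w))"
      by (intro disc_analytic_inv disc_analytic_mult disc_analytic_const disc_analytic_H inv)
    fix z :: complex and y assume z: "z \<in> sphere 0 1"
    define x where "x = matrix_inv (C ** H z) *v y"
    have y: "(C ** H z) *v x = y"
      using inv[of z] z by (simp add: x_def matrix_vector_mul_assoc matrix_inv_right)
    have zc: "cnj z \<in> sphere 0 1" using z by simp
    have "\<epsilon> * (norm x)\<^sup>2 \<le> x \<bullet> (Q \<Lambda> (cnj z) *v x)" using e(2) zc unfolding uniformly_positive_def by blast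
    also have "Q \<Lambda> (cnj z) = (C ** H z)\<dagger> ** (C ** H z)"
      using C' zc Q_gram[of C "cnj z"] by simp
    also have "x \<bullet> (\<dots> *v x) = (norm y)\<^sup>2" by (simp only: quad_gram y)
    finally have "(sqrt \<epsilon> * norm x)\<^sup>2 \<le> (norm y)\<^sup>2" using e by (simp add: power_mult_distrib)
    hence "sqrt \<epsilon> * norm x \<le> norm y" by (rule power2_le_imp_le) simp
    thus "norm (matrix_inv (C ** H z) *v y) \<le> (1 / sqrt \<epsilon>) * norm y"
      using sq by (simp add: x_def[symmetric] field_simps)
  qed
  have "matrix_inv (C ** H w) *v ((C ** H w) *v x) = x"
    using inv[OF w] by (simp add: matrix_vector_mul_assoc matrix_inv_left)
  hence "norm x \<le> (1 / sqrt \<epsilon>) * norm ((C ** H w) *v x)" using 1[of "(C ** H w) *v x"] by simp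
  hence "sqrt \<epsilon> * norm x \<le> norm ((C ** H w) *v x)" using sq by (simp add: field_simps)
  hence "(sqrt \<epsilon> * norm x)\<^sup>2 \<le> (norm ((C ** H w) *v x))\<^sup>2" using sq by (intro power_mono) auto
  thus "\<epsilon> * (norm x)\<^sup>2 \<le> (norm ((C ** H w) *v x))\<^sup>2" using e by (simp add: power_mult_distrib)
qed

lemma outer_factor_inner:
  assumes "outer_factor \<Lambda> C" "X \<in> S"
  shows "\<Lambda> \<bullet> X = mat 1 \<bullet> (C ** X ** C\<dagger>)"
proof -
  have "\<Lambda> \<bullet> X = (C\<dagger> ** C) \<bullet> X"
    using assms by (intro S_inner_cong) (auto simp: outer_factor_def)
  thus ?thesis by (simp add: inner_sandwich)
qed

text \<open>The pairing of \<open>\<Lambda>\<close> with \<open>\<Sigma>\<close> is the trace of \<open>C \<Sigma> C\<^sup>*\<close>. This is what makes the slices of the cone of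
  positive multipliers by \<open>\<Lambda> \<bullet> \<Sigma> = const\<close> bounded.\<close>

lemma outer_factor_norm_bound:
  assumes C: "outer_factor \<Lambda> C" and \<Sigma>: "\<Sigma> \<in> S" and \<sigma>: "\<sigma> > 0" "\<And>x. \<sigma> * (norm x)\<^sup>2 \<le> x \<bullet> (\<Sigma> *v x)"
  shows "\<sigma> * (norm C)\<^sup>2 \<le> \<Lambda> \<bullet> \<Sigma>"
proof -
  have "\<sigma> * (norm C)\<^sup>2 = (\<Sum>j\<in>UNIV. \<sigma> * (norm (C\<dagger> *v axis j 1))\<^sup>2)"
    unfolding norm_adj[of C, symmetric] norm_sq_mat_columns[of "C\<dagger>"] by (rule sum_distrib_left)
  also have "\<dots> \<le> (\<Sum>j\<in>UNIV. axis j 1 \<bullet> ((C ** \<Sigma> ** C\<dagger>) *v axis j 1))"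
    unfolding quad_sandwich' by (intro sum_mono \<sigma>)
  also have "\<dots> = \<Lambda> \<bullet> \<Sigma>" by (simp add: outer_factor_inner[OF C \<Sigma>] inner_mat1_left)
  finally show ?thesis .
qed

lemma outer_factor_multiplier_bound:
  assumes C: "outer_factor \<Lambda> C" and "\<Lambda> \<in> S"
  shows "norm \<Lambda> \<le> (norm C)\<^sup>2"
proof -
  have "(norm \<Lambda>)\<^sup>2 = (C\<dagger> ** C) \<bullet> \<Lambda>"
    unfolding power2_norm_eq_inner
    using assms by (intro S_inner_cong) (auto simp: outer_factor_def)
  also have "\<dots> \<le> norm (C\<dagger> ** C) * norm \<Lambda>" by (rule norm_cauchy_schwarz)
  also have "\<dots> \<le> (norm C)\<^sup>2 * norm \<Lambda>"
    using norm_mm_le[of "C\<dagger>" C] by (intro mult_right_mono) (auto simp: norm_adj power2_eq_square)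
  finally show ?thesis by (cases "norm \<Lambda> = 0") (auto simp: power2_eq_square)
qed

text \<open>A function into a compact set is continuous if its graph is closed. The graph is cut out by closed
  conditions because invertibility of \<open>C H\<close> may be replaced by its uniform lower bound, and positivity of
  the diagonal of \<open>C B\<close> by nonnegativity: an invertible triangular matrix with nonnegative diagonal coincides
  with the triangular factor of its Gram matrix.\<close>

lemma continuous_outer_factor:
  assumes e: "\<epsilon> > 0" and D: "closed D" "\<And>\<Lambda>. \<Lambda> \<in> D \<Longrightarrow> uniformly_positive \<epsilon> \<Lambda>"
    and f: "\<And>\<Lambda>. \<Lambda> \<in> D \<Longrightarrow> outer_factor \<Lambda> (f \<Lambda>)" and bd: "\<And>\<Lambda>. \<Lambda> \<in> D \<Longrightarrow> norm (f \<Lambda>) \<le> K"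
  shows "continuous_on D f"
proof (rule continuous_from_closed_graph[of "cball 0 K"])
  show "f \<in> D \<rightarrow> cball 0 K" using bd by auto
  define G1 where "G1 = (\<Inter>z\<in>sphere 0 1. {p :: (complex^'n^'n) \<times> (complex^'n^('m::{finite,linorder})). Q ((snd p)\<dagger> ** snd p) z = Q (fst p) z})"
  define G2 where "G2 = (\<Inter>w\<in>cball 0 1. \<Inter>x. {p :: (complex^'n^'n) \<times> (complex^'n^('m::{finite,linorder})). \<epsilon> * (norm x)\<^sup>2 \<le> (norm ((snd p ** H w) *v x))\<^sup>2})"
  define G3 where "G3 = (\<Inter>i. \<Inter>j\<in>{j. i < j}. {p :: (complex^'n^'n) \<times> (complex^'n^('m::{finite,linorder})). (snd p ** B) $ i $ j = 0})"
  define G4 where "G4 = (\<Inter>i. {p :: (complex^'n^'n) \<times> (complex^'n^('m::{finite,linorder})). Im ((snd p ** B) $ i $ i) = 0 \<and> 0 \<le> Re ((snd p ** B) $ i $ i)})"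
  have "closed G1" unfolding G1_def Q_def
    by (intro closed_INT ballI closed_Collect_eq continuous_intros)
  moreover have "closed G2" unfolding G2_def
    by (intro closed_INT ballI closed_Collect_le continuous_intros)
  moreover have "closed G3" unfolding G3_def
    by (intro closed_INT ballI closed_Collect_eq continuous_intros)
  moreover have "closed G4" unfolding G4_def
    by (intro closed_INT ballI closed_Collect_conj closed_Collect_eq closed_Collect_le continuous_intros)
  moreover have "closed (D \<times> (UNIV :: (complex^'n^('m::{finite,linorder})) set))" by (intro closed_Times D) simp
  ultimately have "closed (D \<times> UNIV \<inter> G1 \<inter> G2 \<inter> G3 \<inter> G4)" by (intro closed_Int)
  moreover have "(\<lambda>x. (x, f x)) ` D = D \<times> UNIV \<inter> G1 \<inter> G2 \<inter> G3 \<inter> G4"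
  proof (intro set_eqI iffI)
    fix p assume "p \<in> (\<lambda>x. (x, f x)) ` D"
    then obtain \<Lambda> where p: "\<Lambda> \<in> D" "p = (\<Lambda>, f \<Lambda>)" by auto
    note C = f[OF p(1)]
    note C' = C[unfolded outer_factor_def]
    have "p \<in> G1" using C' by (simp add: p G1_def)
    moreover have "p \<in> G2" using outer_factor_lower_bound(1)[OF C e D(2)[OF p(1)]] by (simp add: p G2_def)
    moreover have "p \<in> G3" using C' by (simp add: p G3_def lower_triangular_def)
    moreover have "p \<in> G4" using C' by (auto simp: p G4_def pos_diag_def complex_is_Real_iff less_imp_le)
    ultimately show "p \<in> D \<times> UNIV \<inter> G1 \<inter> G2 \<inter> G3 \<inter> G4" using p by simp
  next
    fix p assume a: "p \<in> D \<times> UNIV \<inter> G1 \<inter> G2 \<inter> G3 \<inter> G4"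
    obtain \<Lambda> C where p: "p = (\<Lambda>, C)" by (cases p)
    have \<Lambda>: "\<Lambda> \<in> D" using a p by simp
    have lb: "\<epsilon> * (norm x)\<^sup>2 \<le> (norm ((C ** H w) *v x))\<^sup>2" if "w \<in> cball 0 1" for w x
      using a that by (auto simp: p G2_def)
    have ker: "x = 0" if "w \<in> cball 0 1" "(C ** H w) *v x = 0" for w x
    proof -
      have "\<epsilon> * (norm x)\<^sup>2 \<le> 0" using lb[OF that(1), of x] by (simp add: that(2))
      hence "(norm x)\<^sup>2 \<le> 0" using e by (simp add: mult_le_0_iff)
      thus ?thesis by simp
    qed
    have inv: "invertible (C ** H w)" if "w \<in> cball 0 1" for w
      using ker[OF that] by (rule inj_invertible)
    have CB: "x = 0" if "(C ** B) *v x = 0" for x using ker[of 0 x] that by (simp add: H_0)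
    have "pos_def ((C ** B)\<dagger> ** mat 1 ** (C ** B))"
      by (rule pos_def_sandwich) (use CB in \<open>auto simp: pos_def_def hermitian_mat1\<close>)
    hence "pos_def ((C ** B)\<dagger> ** (C ** B))" by simp
    then obtain R where R: "lower_triangular R" "pos_diag R" "R\<dagger> ** R = (C ** B)\<dagger> ** (C ** B)" "invertible R"
      by (rule triangular_factor_exists)
    have low: "lower_triangular (C ** B)" using a by (auto simp: p G3_def lower_triangular_def)
    have "C ** B = R"
      by (rule triangular_factor_unique[OF low _ R(1,2) R(3)[symmetric]])
        (use a in \<open>auto simp: p G4_def complex_is_Real_iff\<close>)
    hence "outer_factor \<Lambda> C"
      unfolding outer_factor_def using a inv R low by (auto simp: p G1_def)
    hence "C = f \<Lambda>" by (rule outer_factor_unique[OF _ f[OF \<Lambda>]])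
    thus "p \<in> (\<lambda>x. (x, f x)) ` D" using \<Lambda> p by auto
  qed
  ultimately show "closed ((\<lambda>x. (x, f x)) ` D)" by simp
qed simp

end


section \<open>The moment map of a spectral density\<close>

locale moment_problem = reachable_pair A B
  for A :: "complex^'n^'n" and B :: "complex^('m::{finite,linorder})^'n" +
  fixes \<Psi> :: "complex \<Rightarrow> complex^('m::{finite,linorder})^('m::{finite,linorder})"
  assumes \<Psi>: "\<Psi> \<in> spectral_densities"
begin

lemma \<Psi>_measurable: "circle_measurable \<Psi>"
  using \<Psi> by (simp add: spectral_densities_def circle_measurable_def)

lemma pos_def_\<Psi>: "z \<in> sphere 0 1 \<Longrightarrow> pos_def (\<Psi> z)"
  using \<Psi> unfolding spectral_densities_def by blast

lemma \<Psi>_lower: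
  obtains c where "c > 0" "\<And>z x. z \<in> sphere 0 1 \<Longrightarrow> c * (norm x)\<^sup>2 \<le> x \<bullet> (\<Psi> z *v x)"
proof -
  obtain c where c: "0 < c" "\<And>z. z \<in> sphere 0 1 \<Longrightarrow> loewner_le (mat (complex_of_real c)) (\<Psi> z)"
    using \<Psi> unfolding spectral_densities_def by blast
  show thesis
    by (rule that[OF c(1)])
      (use c(2) in \<open>simp add: loewner_le_def pos_semidef_def mv_diff_left inner_diff_right quad_scalar_matrix\<close>)
qed

lemma \<Psi>_upper:
  obtains K where "K > 0" "\<And>z. z \<in> sphere 0 1 \<Longrightarrow> norm (\<Psi> z) \<le> K"
proof -
  obtain c C where C: "0 < c" "c \<le> C"
    and le: "\<And>z. z \<in> sphere 0 1 \<Longrightarrow> loewner_le (\<Psi> z) (mat (complex_of_real C))"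
    using \<Psi> unfolding spectral_densities_def by blast
  have up: "x \<bullet> (\<Psi> z *v x) \<le> C * (norm x)\<^sup>2" if "z \<in> sphere 0 1" for z x
    using le[OF that] by (simp add: loewner_le_def pos_semidef_def mv_diff_left inner_diff_right quad_scalar_matrix)
  show thesis
  proof
    show "0 < real CARD('m) * C" using C by simp
    fix z :: complex assume z: "z \<in> sphere 0 1"
    show "norm (\<Psi> z) \<le> real CARD('m) * C"
      by (rule norm_le_of_operator_bound, rule psd_norm_mv[OF pos_def_imp_psd[OF pos_def_\<Psi>[OF z]] up[OF z]])
  qed
qed

text \<open>The density \<open>W\<^sup>-\<^sup>1 \<Psi> W\<^sup>-\<^sup>*\<close> for \<open>W(z) = C H(1/z)\<close>.\<close>

definition density :: "complex^'n^('m::{finite,linorder}) \<Rightarrow> complex \<Rightarrow> complex^('m::{finite,linorder})^('m::{finite,linorder})" where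
  "density C z = matrix_inv (C ** H (cnj z)) ** \<Psi> z ** (matrix_inv (C ** H (cnj z)))\<dagger>"

definition mass :: real where "mass = circle_integral (\<lambda>z. mat 1 \<bullet> \<Psi> z)"

lemma mass_pos: "mass > 0"
proof -
  obtain c where c: "c > 0" "\<And>z x. z \<in> sphere 0 1 \<Longrightarrow> c * (norm x)\<^sup>2 \<le> x \<bullet> (\<Psi> z *v x)"
    using \<Psi>_lower by blast
  obtain K where K: "K > 0" "\<And>z. z \<in> sphere 0 1 \<Longrightarrow> norm (\<Psi> z) \<le> K" using \<Psi>_upper by blast
  have "c * real CARD('m) \<le> mat 1 \<bullet> \<Psi> z" if "z \<in> sphere 0 1" for z
  proof -
    have "(\<Sum>j\<in>(UNIV::'m set). c) \<le> mat 1 \<bullet> \<Psi> z"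
      unfolding inner_mat1_left
      by (rule sum_mono) (use c(2)[OF that, of "axis _ 1"] in simp)
    thus ?thesis by (simp add: mult.commute)
  qed
  moreover have "circle_integrable \<Psi>" by (rule circle_integrable_bounded[OF \<Psi>_measurable K(2)])
  ultimately have "circle_integral (\<lambda>_. c * real CARD('m)) \<le> mass"
    unfolding mass_def by (intro circle_integral_mono circle_integrable_const inner_circle_integral(2)) auto
  moreover have "0 < c * real CARD('m)" using c(1) by simp
  ultimately show ?thesis by (simp add: circle_integral_const)
qed

lemma outer_function_inverse:
  assumes "outer_factor \<Lambda> C" "z \<in> sphere 0 1"
  shows "invertible (C ** H (cnj z))"
  using assms by (simp add: outer_factor_def)

lemma density_measurable:
  assumes C: "outer_factor \<Lambda> C"
  shows "circle_measurable (density C)"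
  unfolding density_def [abs_def]
  by (intro circle_measurable_mm \<Psi>_measurable circle_measurable_continuous adj_continuous
      continuous_on_matrix_inv mm_continuous continuous_on_const continuous_H_cnj outer_function_inverse[OF C])

lemma density_bound:
  assumes e: "\<epsilon> > 0"
  obtains K where "\<And>\<Lambda> C z. outer_factor \<Lambda> C \<Longrightarrow> uniformly_positive \<epsilon> \<Lambda> \<Longrightarrow> z \<in> sphere 0 1 \<Longrightarrow> norm (density C z) \<le> K"
proof -
  obtain K where K: "K > 0" "\<And>z. z \<in> sphere 0 1 \<Longrightarrow> norm (\<Psi> z) \<le> K" using \<Psi>_upper by blast
  define J where "J = real CARD('m) * (1 / sqrt \<epsilon>)"
  have J: "J \<ge> 0" using e by (simp add: J_def)
  show thesis
  proof
    fix \<Lambda> C and z :: complex assume a: "outer_factor \<Lambda> C" "uniformly_positive \<epsilon> \<Lambda>" "z \<in> sphere 0 1"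
    let ?V = "matrix_inv (C ** H (cnj z))"
    have V: "norm ?V \<le> J"
      unfolding J_def by (intro norm_le_of_operator_bound outer_factor_lower_bound(2)[OF a(1) e a(2)]) (use a(3) in simp)
    have "norm (density C z) \<le> norm ?V * norm (\<Psi> z) * norm (?V\<dagger>)"
      unfolding density_def by (rule order_trans[OF norm_mm_le mult_right_mono[OF norm_mm_le norm_ge_zero]])
    also have "\<dots> \<le> J * K * J"
      unfolding norm_adj using V K(2)[OF a(3)] J K(1) by (intro mult_mono mult_nonneg_nonneg) auto
    finally show "norm (density C z) \<le> J * K * J" .
  qed
qed

lemma density_integrable:
  assumes C: "outer_factor \<Lambda> C" and "\<Lambda> \<in> L_plus A B"
  shows "circle_integrable (\<lambda>z. H (cnj z) ** density C z ** (H (cnj z))\<dagger>)"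
proof -
  obtain \<epsilon> where e: "\<epsilon> > 0" "uniformly_positive \<epsilon> \<Lambda>" using L_plus_uniformly_positive[OF assms(2)] by blast
  obtain K where "\<And>\<Lambda> C z. outer_factor \<Lambda> C \<Longrightarrow> uniformly_positive \<epsilon> \<Lambda> \<Longrightarrow> z \<in> sphere 0 1 \<Longrightarrow> norm (density C z) \<le> K"
    using density_bound[OF e(1)] by blast
  thus ?thesis using C e by (intro moment_integrable[of _ K] density_measurable) auto
qed

lemma omega_eq_moment:
  assumes "outer_factor \<Lambda> C"
  shows "omega A B \<Psi> \<Lambda> = moment (density C)"
  unfolding omega_def moment_def
proof (rule circle_integral_cong)
  fix z :: complex assume z: "z \<in> sphere 0 1"
  show "transfer_fun A B z ** matrix_inv (spectral_factor A B \<Lambda> z) ** \<Psi> z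
      ** (matrix_inv (spectral_factor A B \<Lambda> z))\<dagger> ** (transfer_fun A B z)\<dagger>
    = H (cnj z) ** density C z ** (H (cnj z))\<dagger>"
    unfolding spectral_factor_eq[OF assms z] transfer_fun_sandwich[OF z, of "density C z", symmetric]
    by (simp add: density_def matrix_mul_assoc)
qed

lemma hermitian_density: "z \<in> sphere 0 1 \<Longrightarrow> hermitian (density C z)"
  unfolding density_def by (intro hermitian_sandwich' pos_def_hermitian pos_def_\<Psi>)

lemma omega_in_S:
  assumes "\<Lambda> \<in> L_plus A B" shows "omega A B \<Psi> \<Lambda> \<in> S"
proof (rule outer_factor_exists[OF assms])
  fix C assume C: "outer_factor \<Lambda> C"
  show ?thesis
    unfolding omega_eq_moment[OF C]
    by (rule moment_in_S[OF density_integrable[OF C assms] hermitian_density])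
qed

lemma inner_omega:
  assumes "outer_factor \<Lambda> C" "\<Lambda> \<in> L_plus A B"
  shows "M \<bullet> omega A B \<Psi> \<Lambda> = circle_integral (\<lambda>z. Q M z \<bullet> density C z)"
  unfolding omega_eq_moment[OF assms(1)] by (rule inner_moment[OF density_integrable[OF assms]])

text \<open>The spectral factors cancel in the pairing of \<open>\<Lambda>\<close> with its image: \<open>tr (W\<^sup>* W W\<^sup>-\<^sup>1 \<Psi> W\<^sup>-\<^sup>*) = tr \<Psi>\<close>. So the map \<open>\<omega>\<close>
  takes each \<open>\<Lambda>\<close> to the hyperplane of those \<open>\<Sigma>\<close> with \<open>\<Lambda> \<bullet> \<Sigma> = mass\<close>.\<close>

lemma inner_omega_self:
  assumes "\<Lambda> \<in> L_plus A B"
  shows "\<Lambda> \<bullet> omega A B \<Psi> \<Lambda> = mass"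
proof -
  obtain C where C: "outer_factor \<Lambda> C" by (rule outer_factor_exists[OF assms])
  show ?thesis
    unfolding inner_omega[OF C assms] mass_def
  proof (rule circle_integral_cong)
    fix z :: complex assume z: "z \<in> sphere 0 1"
    let ?W = "C ** H (cnj z)" let ?V = "matrix_inv ?W"
    have W: "?W ** ?V = mat 1" by (rule matrix_inv_right[OF outer_function_inverse[OF C z]])
    have "Q \<Lambda> z = ?W\<dagger> ** ?W" using C z Q_gram[of C z] by (simp add: outer_factor_def)
    hence "Q \<Lambda> z \<bullet> density C z = (?V\<dagger> ** (?W\<dagger> ** ?W) ** ?V) \<bullet> \<Psi> z"
      unfolding density_def by (simp only: inner_sandwich)
    also have "?V\<dagger> ** (?W\<dagger> ** ?W) ** ?V = (?W ** ?V)\<dagger> ** (?W ** ?V)"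
      by (simp only: adj_mult[of ?W ?V] matrix_mul_assoc)
    finally show "Q \<Lambda> z \<bullet> density C z = mat 1 \<bullet> \<Psi> z" by (simp add: W)
  qed
qed

text \<open>A null vector of the image would be annihilated by \<open>G\<^sup>*\<close> on the whole circle.\<close>

lemma pos_def_omega:
  assumes \<Lambda>: "\<Lambda> \<in> L_plus A B"
  shows "pos_def (omega A B \<Psi> \<Lambda>)"
  unfolding pos_def_def
proof (intro conjI allI impI hermitian_S omega_in_S \<Lambda>)
  fix x :: "complex^'n" assume x: "x \<noteq> 0"
  obtain c where c: "c > 0" "\<And>z x. z \<in> sphere 0 1 \<Longrightarrow> c * (norm x)\<^sup>2 \<le> x \<bullet> (\<Psi> z *v x)" using \<Psi>_lower by blast
  obtain C where C: "outer_factor \<Lambda> C" by (rule outer_factor_exists[OF \<Lambda>])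
  let ?V = "\<lambda>z. matrix_inv (C ** H (cnj z))"
  let ?v = "\<lambda>z. (?V z)\<dagger> *v ((H (cnj z))\<dagger> *v x)"
  let ?g = "\<lambda>z. c * (norm (?v z))\<^sup>2"
  have contV: "continuous_on (sphere 0 1) ?V"
    by (intro continuous_on_matrix_inv mm_continuous continuous_on_const continuous_H_cnj outer_function_inverse[OF C])
  have contg: "continuous_on (sphere 0 1) ?g"
    by (intro continuous_intros contV)
  note int = density_integrable[OF C \<Lambda>]
  have eq: "x \<bullet> (omega A B \<Psi> \<Lambda> *v x) = circle_integral (\<lambda>z. ?v z \<bullet> (\<Psi> z *v ?v z))"
    unfolding omega_eq_moment[OF C] moment_def quad_circle_integral(1)[OF int]
    by (rule circle_integral_cong) (simp add: quad_sandwich' density_def)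
  have int_quad: "circle_integrable (\<lambda>z. ?v z \<bullet> (\<Psi> z *v ?v z))"
    using quad_circle_integral(2)[OF int, of x] by (simp add: quad_sandwich' density_def)
  have le: "circle_integral ?g \<le> x \<bullet> (omega A B \<Psi> \<Lambda> *v x)"
    unfolding eq by (rule circle_integral_mono[OF circle_integrable_continuous[OF contg] int_quad c(2)])
  have "circle_integral ?g \<noteq> 0"
  proof
    assume 0: "circle_integral ?g = 0"
    have "(H z)\<dagger> *v x = 0" if z: "z \<in> sphere 0 1" for z
    proof -
      have zc: "cnj z \<in> sphere 0 1" using z by simp
      have "?g (cnj z) = 0"
        by (rule circle_integral_0_imp[OF contg _ 0 zc]) (use c(1) in simp)
      hence "?v (cnj z) = 0" using c(1) by simp
      thus ?thesis
        using invertible_inj[OF invertible_adj[OF invertible_matrix_inv[OF outer_function_inverse[OF C zc]]]] by simp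
    qed
    thus False using annihilates_circle x by blast
  qed
  moreover have "0 \<le> circle_integral ?g" using c(1) by (intro circle_integral_nonneg) simp
  ultimately show "0 < x \<bullet> (omega A B \<Psi> \<Lambda> *v x)" using le by linarith
qed

text \<open>From \<open>H x = (H W\<^sup>-\<^sup>1) (W x)\<close> and \<open>\<bar>W x\<bar>\<^sup>2 = x\<^sup>* (H\<^sup>* \<Lambda> H) x\<close> the Frobenius norm of \<open>H W\<^sup>-\<^sup>1\<close> is bounded below by
  the reciprocal of the form in each fixed direction \<open>x\<close>, and the trace of \<open>\<omega>(\<Lambda>)\<close> dominates its mean square.\<close>

lemma trace_omega_ge:
  obtains c where "c > 0" "\<And>\<Lambda> x. \<Lambda> \<in> L_plus A B \<Longrightarrow> norm x = 1 \<Longrightarrow>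
    c * circle_integral (\<lambda>z. 1 / (x \<bullet> (Q \<Lambda> z *v x))) \<le> mat 1 \<bullet> omega A B \<Psi> \<Lambda>"
proof -
  obtain c where c: "c > 0" "\<And>z x. z \<in> sphere 0 1 \<Longrightarrow> c * (norm x)\<^sup>2 \<le> x \<bullet> (\<Psi> z *v x)" using \<Psi>_lower by blast
  obtain g where g: "g > 0" "\<And>z x. z \<in> sphere 0 1 \<Longrightarrow> g * (norm x)\<^sup>2 \<le> x \<bullet> (Q (mat 1) z *v x)"
    using sphere_pos_def_bound[OF continuous_Q pos_def_Q_identity] by blast
  show thesis
  proof
    show "c * g > 0" using c g by simp
    fix \<Lambda> and x :: "complex^('m::{finite,linorder})" assume \<Lambda>: "\<Lambda> \<in> L_plus A B" and x: "norm x = 1"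
    obtain C where C: "outer_factor \<Lambda> C" by (rule outer_factor_exists[OF \<Lambda>])
    have pos: "0 < x \<bullet> (Q \<Lambda> z *v x)" if "z \<in> sphere 0 1" for z
      using \<Lambda> that x by (intro pos_def_pos) (auto simp: L_plus_iff)
    have cont1: "continuous_on (sphere 0 1) (\<lambda>z. 1 / (x \<bullet> (Q \<Lambda> z *v x)))"
      by (intro continuous_intros) (use pos in force)
    hence cont: "continuous_on (sphere 0 1) (\<lambda>z. c * g * (1 / (x \<bullet> (Q \<Lambda> z *v x))))"
      by (rule continuous_on_mult_left)
    have "circle_integral (\<lambda>z. c * g * (1 / (x \<bullet> (Q \<Lambda> z *v x)))) \<le> circle_integral (\<lambda>z. Q (mat 1) z \<bullet> density C z)"
    proof (rule circle_integral_mono[OF circle_integrable_continuous[OF cont]])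
      show "circle_integrable (\<lambda>z. Q (mat 1) z \<bullet> density C z)"
        using inner_circle_integral(2)[OF density_integrable[OF C \<Lambda>], of "mat 1"] by (simp add: inner_H_sandwich)
      fix z :: complex assume z: "z \<in> sphere 0 1"
      let ?W = "C ** H (cnj z)" let ?X = "H (cnj z) ** matrix_inv ?W"
      have XW: "?X ** ?W = H (cnj z)"
        using matrix_inv_left[OF outer_function_inverse[OF C z]] by (simp add: matrix_mul_assoc[symmetric])
      have W: "(norm (?W *v x))\<^sup>2 = x \<bullet> (Q \<Lambda> z *v x)"
        using C z Q_gram[of C z] quad_gram[of x ?W] by (simp add: outer_factor_def)
      have "g \<le> (norm (H (cnj z) *v x))\<^sup>2"
        using g(2)[OF z, of x] x by (simp add: quad_Q power2_norm_eq_inner)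
      also have "H (cnj z) *v x = ?X *v (?W *v x)" by (simp only: matrix_vector_mul_assoc XW)
      also have "(norm \<dots>)\<^sup>2 \<le> (norm ?X * norm (?W *v x))\<^sup>2" by (intro power_mono norm_mv_le) simp
      also have "\<dots> = (norm ?X)\<^sup>2 * (x \<bullet> (Q \<Lambda> z *v x))" by (simp only: power_mult_distrib W)
      finally have "g * (1 / (x \<bullet> (Q \<Lambda> z *v x))) \<le> (norm ?X)\<^sup>2" using pos[OF z] by (simp add: field_simps)
      hence "c * g * (1 / (x \<bullet> (Q \<Lambda> z *v x))) \<le> c * (norm ?X)\<^sup>2"
        using c(1) by (simp only: mult.assoc) (rule mult_left_mono, auto)
      also have "\<dots> = (\<Sum>j\<in>UNIV. c * (norm (?X\<dagger> *v axis j 1))\<^sup>2)"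
        unfolding norm_adj[of ?X, symmetric] norm_sq_mat_columns[of "?X\<dagger>"] by (rule sum_distrib_left)
      also have "\<dots> \<le> (\<Sum>j\<in>UNIV. axis j 1 \<bullet> ((?X ** \<Psi> z ** ?X\<dagger>) *v axis j 1))"
        unfolding quad_sandwich' by (intro sum_mono c(2)[OF z])
      also have "\<dots> = mat 1 \<bullet> (?X ** \<Psi> z ** ?X\<dagger>)" by (simp only: inner_mat1_left)
      also have "?X ** \<Psi> z ** ?X\<dagger> = H (cnj z) ** density C z ** (H (cnj z))\<dagger>"
        by (simp only: density_def adj_mult matrix_mul_assoc)
      finally show "c * g * (1 / (x \<bullet> (Q \<Lambda> z *v x))) \<le> Q (mat 1) z \<bullet> density C z" by (simp add: inner_H_sandwich)
    qed
    also have "circle_integral (\<lambda>z. c * g * (1 / (x \<bullet> (Q \<Lambda> z *v x)))) = c * g * circle_integral (\<lambda>z. 1 / (x \<bullet> (Q \<Lambda> z *v x)))"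
      by (rule circle_integral_linear[OF bounded_linear_mult_right circle_integrable_continuous[OF cont1]])
    finally show "c * g * circle_integral (\<lambda>z. 1 / (x \<bullet> (Q \<Lambda> z *v x))) \<le> mat 1 \<bullet> omega A B \<Psi> \<Lambda>"
      by (simp add: inner_omega[OF C \<Lambda>])
  qed
qed

text \<open>The image blows up at the boundary of the cone: by the logarithmic estimate a form that comes close
  to zero somewhere on the circle would make the trace of the image large. The Lipschitz constant is uniform
  because the multipliers are bounded.\<close>

lemma uniform_positivity_of_trace_bound:
  obtains \<delta> where "\<delta> > 0" "\<And>\<Lambda>. \<Lambda> \<in> L_plus A B \<Longrightarrow> norm \<Lambda> \<le> r \<Longrightarrow> mat 1 \<bullet> omega A B \<Psi> \<Lambda> \<le> T \<Longrightarrow>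
    uniformly_positive \<delta> \<Lambda>"
proof -
  obtain c where c: "c > 0" "\<And>\<Lambda> x. \<Lambda> \<in> L_plus A B \<Longrightarrow> norm x = 1 \<Longrightarrow>
    c * circle_integral (\<lambda>z. 1 / (x \<bullet> (Q \<Lambda> z *v x))) \<le> mat 1 \<bullet> omega A B \<Psi> \<Lambda>" using trace_omega_ge by blast
  obtain D where D: "D > 0" "\<And>\<Lambda> x t s. norm x = 1 \<Longrightarrow>
    x \<bullet> (Q \<Lambda> (cis t) *v x) \<le> x \<bullet> (Q \<Lambda> (cis s) *v x) + D * norm \<Lambda> * \<bar>t - s\<bar>" using Q_lipschitz by blast
  define L where "L = D * (\<bar>r\<bar> + 1)"
  have L: "L > 0" using D by (simp add: L_def)
  define M where "M = 2 * pi * L * (T / c)"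
  define \<delta> where "\<delta> = exp (ln (L * pi) - M)"
  show thesis
  proof
    show "\<delta> > 0" by (simp add: \<delta>_def)
    fix \<Lambda> assume \<Lambda>: "\<Lambda> \<in> L_plus A B" "norm \<Lambda> \<le> r" "mat 1 \<bullet> omega A B \<Psi> \<Lambda> \<le> T"
    have unit: "\<delta> \<le> x \<bullet> (Q \<Lambda> z *v x)" if z: "z \<in> sphere 0 1" and x: "norm x = 1" for z x
    proof -
      let ?h = "\<lambda>z. x \<bullet> (Q \<Lambda> z *v x)"
      have pos: "0 < ?h v" if "v \<in> sphere 0 1" for v
        using \<Lambda>(1) that x by (intro pos_def_pos) (auto simp: L_plus_iff)
      have "D * norm \<Lambda> \<le> L" unfolding L_def using D \<Lambda>(2) by (intro mult_left_mono) auto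
      hence "D * norm \<Lambda> * \<bar>t - s\<bar> \<le> L * \<bar>t - s\<bar>" for t s by (rule mult_right_mono) simp
      hence lip: "?h (cis t) \<le> ?h (cis s) + L * \<bar>t - s\<bar>" for t s
        using D(2)[OF x, of \<Lambda> t s] by (meson add_left_mono order_trans)
      have "ln (L * pi) - ln (?h z) \<le> 2 * pi * L * circle_integral (\<lambda>z. 1 / ?h z)"
        by (rule circle_integral_reciprocal_ge[OF _ pos L z lip]) (intro continuous_intros)
      also have "\<dots> \<le> M"
        unfolding M_def
      proof (rule mult_left_mono)
        have "c * circle_integral (\<lambda>z. 1 / ?h z) \<le> T" using c(2)[OF \<Lambda>(1) x] \<Lambda>(3) by linarith
        thus "circle_integral (\<lambda>z. 1 / ?h z) \<le> T / c" using c(1) by (simp add: field_simps)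
      qed (use L in simp)
      finally have "ln (L * pi) - M \<le> ln (?h z)" by simp
      hence "\<delta> \<le> exp (ln (?h z))" by (simp add: \<delta>_def)
      thus ?thesis using pos[OF z] by simp
    qed
    show "uniformly_positive \<delta> \<Lambda>"
      unfolding uniformly_positive_def
    proof (intro ballI allI)
      fix z :: complex and x assume z: "z \<in> sphere 0 1"
      show "\<delta> * (norm x)\<^sup>2 \<le> x \<bullet> (Q \<Lambda> z *v x)" by (rule quad_bound_of_unit) (rule unit[OF z])
    qed
  qed
qed

text \<open>Continuity of the factor, continuity of the inverse and dominated convergence; the densities have
  a common bound by the common lower bound of the forms.\<close>

lemma continuous_omega:
  assumes e: "\<epsilon> > 0" and D: "closed D" "\<And>\<Lambda>. \<Lambda> \<in> D \<Longrightarrow> hermitian \<Lambda> \<and> uniformly_positive \<epsilon> \<Lambda>"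
    and bd: "\<And>\<Lambda> C. \<Lambda> \<in> D \<Longrightarrow> outer_factor \<Lambda> C \<Longrightarrow> norm C \<le> K"
  shows "continuous_on D (omega A B \<Psi>)"
proof -
  have LD: "\<Lambda> \<in> L_plus A B" if "\<Lambda> \<in> D" for \<Lambda>
    using uniformly_positive_L_plus[OF _ e] D(2)[OF that] by blast
  define f where "f \<Lambda> = (SOME C. outer_factor \<Lambda> C)" for \<Lambda>
  have f: "outer_factor \<Lambda> (f \<Lambda>)" if "\<Lambda> \<in> D" for \<Lambda>
    unfolding f_def using outer_factor_exists[OF LD[OF that]] by (metis someI_ex)
  have cf: "continuous_on D f"
    by (rule continuous_outer_factor[OF e D(1) _ f bd[OF _ f]]) (use D(2) in auto)
  obtain J where J: "\<And>\<Lambda> C z. outer_factor \<Lambda> C \<Longrightarrow> uniformly_positive \<epsilon> \<Lambda> \<Longrightarrow> z \<in> sphere 0 1 \<Longrightarrow> norm (density C z) \<le> J"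
    using density_bound[OF e] by blast
  obtain N where N: "N > 0" "\<And>w. w \<in> cball 0 1 \<Longrightarrow> norm (H w) \<le> N" using H_bounded by blast
  show ?thesis
  proof (rule continuous_on_sequentiallyI)
    fix u a assume u: "\<forall>n. u n \<in> D" and a: "a \<in> D" and lim: "u \<longlonglongrightarrow> a"
    have "(\<lambda>n. f (u n)) \<longlonglongrightarrow> f a"
      using cf u a lim unfolding continuous_on_sequentially by (auto simp: o_def)
    let ?F = "\<lambda>C z. H (cnj z) ** density C z ** (H (cnj z))\<dagger>"
    let ?\<mu> = "lebesgue_on {0..2*pi}"
    have meas: "(\<lambda>t. ?F (f \<Lambda>) (cis t)) \<in> borel_measurable ?\<mu>" if "\<Lambda> \<in> D" for \<Lambda>
      using density_integrable[OF f[OF that] LD[OF that]] unfolding circle_integrable_def by (rule borel_measurable_integrable)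
    have "(\<lambda>n. integral\<^sup>L ?\<mu> (\<lambda>t. ?F (f (u n)) (cis t))) \<longlonglongrightarrow> integral\<^sup>L ?\<mu> (\<lambda>t. ?F (f a) (cis t))"
    proof (rule integral_dominated_convergence[where w = "\<lambda>_. N * J * N"])
      show "integrable ?\<mu> (\<lambda>_. N * J * N)"
        by (rule finite_measure.integrable_const) (simp add: finite_measure_lebesgue_on)
      show "AE t in ?\<mu>. (\<lambda>n. ?F (f (u n)) (cis t)) \<longlonglongrightarrow> ?F (f a) (cis t)"
      proof (rule AE_I2)
        fix t
        have "invertible (f a ** H (cnj (cis t)))" by (rule outer_function_inverse[OF f[OF a]]) simp
        thus "(\<lambda>n. ?F (f (u n)) (cis t)) \<longlonglongrightarrow> ?F (f a) (cis t)"
          unfolding density_def using \<open>(\<lambda>n. f (u n)) \<longlonglongrightarrow> f a\<close>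
          by (intro mm_tendsto adj_tendsto tendsto_matrix_inv tendsto_const)
      qed
      fix n
      show "AE t in ?\<mu>. norm (?F (f (u n)) (cis t)) \<le> N * J * N"
      proof (rule AE_I2)
        fix t
        have z: "cis t \<in> sphere 0 1" by simp
        have h: "norm (H (cnj (cis t))) \<le> N" by (rule N(2)) simp
        have d: "norm (density (f (u n)) (cis t)) \<le> J" using J[OF f _ z] D(2) u by blast
        have "norm (?F (f (u n)) (cis t)) \<le> norm (H (cnj (cis t))) * norm (density (f (u n)) (cis t)) * norm ((H (cnj (cis t)))\<dagger>)"
          by (rule order_trans[OF norm_mm_le mult_right_mono[OF norm_mm_le norm_ge_zero]])
        also have "\<dots> \<le> N * J * N"
          unfolding norm_adj using h d N(1) order_trans[OF norm_ge_zero d]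
          by (intro mult_mono mult_nonneg_nonneg) auto
        finally show "norm (?F (f (u n)) (cis t)) \<le> N * J * N" .
      qed
    qed (use meas u a in auto)
    hence "(\<lambda>n. (1 / (2 * pi)) *\<^sub>R integral\<^sup>L ?\<mu> (\<lambda>t. ?F (f (u n)) (cis t)))
        \<longlonglongrightarrow> (1 / (2 * pi)) *\<^sub>R integral\<^sup>L ?\<mu> (\<lambda>t. ?F (f a) (cis t))"
      by (intro tendsto_scaleR tendsto_const)
    moreover have "omega A B \<Psi> \<Lambda> = (1 / (2 * pi)) *\<^sub>R integral\<^sup>L ?\<mu> (\<lambda>t. ?F (f \<Lambda>) (cis t))" if "\<Lambda> \<in> D" for \<Lambda>
      unfolding omega_eq_moment[OF f[OF that]] moment_def circle_integral_def ..
    ultimately show "(\<lambda>n. omega A B \<Psi> (u n)) \<longlonglongrightarrow> omega A B \<Psi> a" using u a by simp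
  qed
qed

section \<open>Surjectivity\<close>

text \<open>A variational inequality for \<open>v(\<Lambda>) = \<omega>(\<Lambda>) - \<Sigma>\<close> on the compact convex set \<open>D\<close> of multipliers in the range
  with \<open>\<Lambda> \<bullet> \<Sigma> = mass\<close> and form at least \<open>\<epsilon>\<close>. By homogeneity \<open>v(\<Lambda>)\<close> is orthogonal to \<open>\<Lambda>\<close>. Testing the solution
  with a representative \<open>Y\<close> of the identity, scaled into \<open>D\<close>, bounds the trace of \<open>\<omega>(\<Lambda>)\<close> by the trace of \<open>\<Sigma>\<close>,
  independently of \<open>\<epsilon>\<close>. So the form is at least some \<open>\<delta> > \<epsilon>\<close>, the solution is interior to \<open>D\<close> relative to the slice, and
  \<open>v(\<Lambda>)\<close> is a multiple of \<open>\<Sigma>\<close>; pairing with \<open>\<Lambda>\<close> shows that it vanishes.\<close>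

lemma omega_surjective:
  assumes \<Sigma>: "\<Sigma> \<in> S" "pos_def \<Sigma>"
  obtains \<Lambda> where "\<Lambda> \<in> L_plus A B" "\<Lambda> \<in> S" "omega A B \<Psi> \<Lambda> = \<Sigma>"
proof -
  obtain \<sigma> where \<sigma>: "\<sigma> > 0" "\<And>x. \<sigma> * (norm x)\<^sup>2 \<le> x \<bullet> (\<Sigma> *v x)" using pos_def_bound[OF \<Sigma>(2)] by blast
  define T where "T = mat 1 \<bullet> \<Sigma>"
  have T: "T > 0" unfolding T_def by (rule trace_pos[OF \<Sigma>(2)])
  define r where "r = mass / \<sigma>"
  have factor_bound: "(norm C)\<^sup>2 \<le> r" if "outer_factor \<Lambda> C" "\<Lambda> \<bullet> \<Sigma> = mass" for \<Lambda> C
    using outer_factor_norm_bound[OF that(1) \<Sigma>(1) \<sigma>] that(2) \<sigma>(1) by (simp add: r_def field_simps)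
  have norm_bound: "norm \<Lambda> \<le> r" if "\<Lambda> \<in> L_plus A B" "\<Lambda> \<in> S" "\<Lambda> \<bullet> \<Sigma> = mass" for \<Lambda>
  proof -
    note a = that
    obtain C where C: "outer_factor \<Lambda> C" by (rule outer_factor_exists[OF a(1)])
    show ?thesis using outer_factor_multiplier_bound[OF C a(2)] factor_bound[OF C a(3)] by linarith
  qed
  \<comment> \<open>The base point: the projection of the identity, scaled into the slice.\<close>
  obtain Y where Y: "Y \<in> S" "\<And>z. z \<in> sphere 0 1 \<Longrightarrow> Q Y z = Q (mat 1) z"
    using S_projection[OF hermitian_mat1] by blast
  have YX: "Y \<bullet> X = mat 1 \<bullet> X" if "X \<in> S" for X using S_inner_cong[OF Y(2) that] .
  have "Y \<in> L_plus A B" using Y hermitian_S pos_def_Q_identity by (simp add: L_plus_iff)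
  then obtain \<eta> where \<eta>: "\<eta> > 0" "uniformly_positive \<eta> Y" using L_plus_uniformly_positive by blast
  define s where "s = mass / T"
  have s: "s > 0" using mass_pos T by (simp add: s_def)
  obtain \<delta> where \<delta>: "\<delta> > 0" "\<And>\<Lambda>. \<Lambda> \<in> L_plus A B \<Longrightarrow> norm \<Lambda> \<le> r \<Longrightarrow> mat 1 \<bullet> omega A B \<Psi> \<Lambda> \<le> T \<Longrightarrow> uniformly_positive \<delta> \<Lambda>"
    using uniform_positivity_of_trace_bound[of r T] by blast
  define \<epsilon> where "\<epsilon> = min (\<delta> / 2) (s * \<eta>)"
  have e: "\<epsilon> > 0" "\<epsilon> \<le> s * \<eta>" "\<epsilon> \<le> \<delta> / 2" using \<delta>(1) \<eta>(1) s by (auto simp: \<epsilon>_def)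
  define D where "D = {\<Lambda> \<in> S. \<Lambda> \<bullet> \<Sigma> = mass \<and> uniformly_positive \<epsilon> \<Lambda>}"
  have LD: "\<Lambda> \<in> L_plus A B" if "\<Lambda> \<in> D" for \<Lambda>
    using that uniformly_positive_L_plus[OF hermitian_S e(1)] by (auto simp: D_def)
  have closed_D: "closed D"
  proof -
    have "D = S \<inter> {\<Lambda>. \<Lambda> \<bullet> \<Sigma> = mass} \<inter> (\<Inter>z\<in>sphere 0 1. \<Inter>x. {\<Lambda>. \<epsilon> * (norm x)\<^sup>2 \<le> x \<bullet> (Q \<Lambda> z *v x)})"
      by (auto simp: D_def uniformly_positive_def)
    moreover have "closed \<dots>"
      unfolding Q_def
      by (intro closed_Int closed_INT ballI closed_Collect_eq closed_Collect_le continuous_intros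
          closed_subspace subspace_S)
    ultimately show ?thesis by simp
  qed
  have bounded_D: "bounded D"
    unfolding bounded_iff using norm_bound LD by (auto simp: D_def)
  have compact_D: "compact D" using closed_D bounded_D by (simp add: compact_eq_bounded_closed)
  have convex_D: "convex D"
  proof (rule convexI)
    fix M N and u v :: real
    assume a: "M \<in> D" "N \<in> D" "0 \<le> u" "0 \<le> v" "u + v = 1"
    have uv: "u * q + v * q = q" for q using a(5) by (metis distrib_right mult_1)
    have "u *\<^sub>R M + v *\<^sub>R N \<in> S"
      using a by (intro subspace_add subspace_scale subspace_S) (auto simp: D_def)
    moreover have "(u *\<^sub>R M + v *\<^sub>R N) \<bullet> \<Sigma> = mass"
      using a uv[of mass] by (simp add: D_def inner_add_left)
    moreover have "uniformly_positive \<epsilon> (u *\<^sub>R M + v *\<^sub>R N)"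
      unfolding uniformly_positive_def
    proof (intro ballI allI)
      fix z :: complex and x :: "complex^('m::{finite,linorder})" assume z: "z \<in> sphere 0 1"
      have "u * (\<epsilon> * (norm x)\<^sup>2) \<le> u * (x \<bullet> (Q M z *v x))" "v * (\<epsilon> * (norm x)\<^sup>2) \<le> v * (x \<bullet> (Q N z *v x))"
        using a z by (auto simp: D_def uniformly_positive_def intro!: mult_left_mono)
      thus "\<epsilon> * (norm x)\<^sup>2 \<le> x \<bullet> (Q (u *\<^sub>R M + v *\<^sub>R N) z *v x)"
        using uv[of "\<epsilon> * (norm x)\<^sup>2"]
        by (simp add: Q_add Q_scaleR matrix_vector_mult_add_rdistrib scaleR_mv_left inner_add_right)
    qed
    ultimately show "u *\<^sub>R M + v *\<^sub>R N \<in> D" by (simp add: D_def)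
  qed
  have base: "s *\<^sub>R Y \<in> D"
  proof -
    have "(s *\<^sub>R Y) \<bullet> \<Sigma> = mass" using T by (simp add: YX[OF \<Sigma>(1)] T_def[symmetric] s_def)
    moreover have "uniformly_positive \<epsilon> (s *\<^sub>R Y)"
      unfolding uniformly_positive_def
    proof (intro ballI allI)
      fix z :: complex and x :: "complex^('m::{finite,linorder})" assume z: "z \<in> sphere 0 1"
      have "\<epsilon> * (norm x)\<^sup>2 \<le> (s * \<eta>) * (norm x)\<^sup>2" by (intro mult_right_mono e) simp
      also have "\<dots> \<le> s * (x \<bullet> (Q Y z *v x))"
        using \<eta>(2) z s by (simp add: uniformly_positive_def mult.assoc)
      finally show "\<epsilon> * (norm x)\<^sup>2 \<le> x \<bullet> (Q (s *\<^sub>R Y) z *v x)" by (simp add: Q_scaleR scaleR_mv_left)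
    qed
    ultimately show ?thesis using Y(1) by (simp add: D_def subspace_scale subspace_S)
  qed
  have cont: "continuous_on D (omega A B \<Psi>)"
  proof (rule continuous_omega[OF e(1) closed_D])
    show "hermitian \<Lambda> \<and> uniformly_positive \<epsilon> \<Lambda>" if "\<Lambda> \<in> D" for \<Lambda>
      using that hermitian_S by (simp add: D_def)
    show "norm C \<le> sqrt r" if "\<Lambda> \<in> D" "outer_factor \<Lambda> C" for \<Lambda> C
      using factor_bound[OF that(2)] that(1) by (intro real_le_rsqrt) (simp add: D_def)
  qed
  define v where "v \<Lambda> = omega A B \<Psi> \<Lambda> - \<Sigma>" for \<Lambda>
  have "continuous_on D v" unfolding v_def by (intro continuous_intros cont)
  then obtain \<Lambda> where \<Lambda>: "\<Lambda> \<in> D" "\<And>X. X \<in> D \<Longrightarrow> v \<Lambda> \<bullet> (X - \<Lambda>) \<le> 0"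
    using variational_solution[OF compact_D convex_D] base by blast
  have \<Lambda>S: "\<Lambda> \<in> S" "\<Lambda> \<bullet> \<Sigma> = mass" using \<Lambda>(1) by (auto simp: D_def)
  note \<Lambda>L = LD[OF \<Lambda>(1)]
  have vS: "v \<Lambda> \<in> S" unfolding v_def by (intro subspace_diff subspace_S omega_in_S \<Lambda>L \<Sigma>)
  have v\<Lambda>: "v \<Lambda> \<bullet> \<Lambda> = 0"
    using inner_omega_self[OF \<Lambda>L] \<Lambda>S(2) by (simp add: v_def inner_diff_right inner_commute[of _ \<Lambda>])
  \<comment> \<open>Testing with the base point bounds the trace, so the solution is not on the boundary of the slice.\<close>
  have "v \<Lambda> \<bullet> (s *\<^sub>R Y) \<le> 0" using \<Lambda>(2)[OF base] v\<Lambda> by (simp add: inner_diff_right)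
  hence "s * (v \<Lambda> \<bullet> Y) \<le> 0" by simp
  hence "v \<Lambda> \<bullet> Y \<le> 0" using s by (simp add: mult_le_0_iff)
  hence "mat 1 \<bullet> omega A B \<Psi> \<Lambda> \<le> T"
    using YX[OF vS] by (simp add: T_def v_def inner_commute[of _ Y] inner_diff_right)
  hence up: "uniformly_positive \<delta> \<Lambda>" using \<delta>(2) \<Lambda>L norm_bound \<Lambda>S by blast
  have orth: "v \<Lambda> \<bullet> X = 0" if X: "X \<in> S" "X \<bullet> \<Sigma> = 0" for X
  proof -
    obtain K where K: "K > 0" "\<And>w. w \<in> cball 0 1 \<Longrightarrow> norm (H w) \<le> K" using H_bounded by blast
    \<comment> \<open>The step \<open>t\<close> changes the form by at most \<open>\<delta> / 2\<close>, in either direction along \<open>X\<close>.\<close>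
    define k where "k = norm X + 1"
    define t where "t = \<delta> / (2 * k * K\<^sup>2)"
    have nX: "k > 0" "norm X \<le> k" unfolding k_def by (rule add_nonneg_pos) auto
    have t: "t > 0" using \<delta>(1) K(1) nX by (simp add: t_def)
    have small: "\<bar>q\<bar> * (norm X * (K * norm x)\<^sup>2) \<le> \<delta> / 2 * (norm x)\<^sup>2" if "\<bar>q\<bar> = t" for q and x :: "complex^('m::{finite,linorder})"
    proof -
      have "t * (norm X * (K * norm x)\<^sup>2) \<le> t * (k * (K * norm x)\<^sup>2)"
        using t nX(2) by (intro mult_left_mono mult_right_mono) auto
      also have "\<dots> = \<delta> / 2 * (norm x)\<^sup>2" using nX(1) K(1) by (simp add: t_def power_mult_distrib)
      finally show ?thesis using that by simp
    qed
    have mem: "\<Lambda> + q *\<^sub>R X \<in> D" if q: "\<bar>q\<bar> = t" for q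
    proof -
      have "uniformly_positive \<epsilon> (\<Lambda> + q *\<^sub>R X)"
        unfolding uniformly_positive_def
      proof (intro ballI allI)
        fix z :: complex and x :: "complex^('m::{finite,linorder})" assume z: "z \<in> sphere 0 1"
        have "\<bar>x \<bullet> (Q X z *v x)\<bar> \<le> norm (H (cnj z) *v x) * norm (X *v (H (cnj z) *v x))"
          unfolding quad_Q by (rule Cauchy_Schwarz_ineq2)
        also have "\<dots> \<le> norm (H (cnj z) *v x) * (norm X * norm (H (cnj z) *v x))"
          by (intro mult_left_mono norm_mv_le) auto
        also have "\<dots> = norm X * (norm (H (cnj z) *v x))\<^sup>2" by (simp add: power2_eq_square)
        also have "\<dots> \<le> norm X * (K * norm x)\<^sup>2"
          using K(2)[of "cnj z"] z
          by (intro mult_left_mono power_mono order_trans[OF norm_mv_le] mult_right_mono) auto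
        finally have "\<bar>q * (x \<bullet> (Q X z *v x))\<bar> \<le> \<bar>q\<bar> * (norm X * (K * norm x)\<^sup>2)"
          by (simp add: abs_mult mult_left_mono)
        hence "- (\<delta> / 2 * (norm x)\<^sup>2) \<le> q * (x \<bullet> (Q X z *v x))" using small[OF q, of x] by linarith
        moreover have "\<delta> * (norm x)\<^sup>2 \<le> x \<bullet> (Q \<Lambda> z *v x)" using up z by (simp add: uniformly_positive_def)
        moreover have "\<epsilon> * (norm x)\<^sup>2 \<le> \<delta> / 2 * (norm x)\<^sup>2" by (intro mult_right_mono e) simp
        ultimately show "\<epsilon> * (norm x)\<^sup>2 \<le> x \<bullet> (Q (\<Lambda> + q *\<^sub>R X) z *v x)"
          by (simp add: Q_add Q_scaleR matrix_vector_mult_add_rdistrib scaleR_mv_left inner_add_right)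
      qed
      thus ?thesis
        using X \<Lambda>S by (simp add: D_def subspace_add subspace_scale subspace_S inner_add_left)
    qed
    have "t * (v \<Lambda> \<bullet> X) \<le> 0" "- t * (v \<Lambda> \<bullet> X) \<le> 0"
      using \<Lambda>(2)[OF mem[of t]] \<Lambda>(2)[OF mem[of "- t"]] t by simp_all
    thus ?thesis using t by (simp add: mult_le_0_iff zero_le_mult_iff)
  qed
  have \<Sigma>0: "\<Sigma> \<bullet> \<Sigma> \<noteq> 0" using \<Lambda>S(2) mass_pos by auto
  define q where "q = (v \<Lambda> \<bullet> \<Sigma>) / (\<Sigma> \<bullet> \<Sigma>)"
  define X where "X = v \<Lambda> - q *\<^sub>R \<Sigma>"
  have X: "X \<in> S" "X \<bullet> \<Sigma> = 0"
    unfolding X_def q_def using \<Sigma>0 vS \<Sigma>(1)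
    by (auto intro!: subspace_diff subspace_scale subspace_S simp: inner_diff_left)
  have "X \<bullet> X = 0" using orth[OF X] X(2) by (simp add: X_def inner_diff_left inner_diff_right inner_commute)
  hence vq: "v \<Lambda> = q *\<^sub>R \<Sigma>" by (simp add: X_def)
  hence "q * mass = 0" using v\<Lambda> \<Lambda>S(2) by (simp add: inner_commute[of \<Sigma>])
  hence "q = 0" using mass_pos by simp
  hence "omega A B \<Psi> \<Lambda> = \<Sigma>" using vq by (simp add: v_def)
  thus thesis using that \<Lambda>L \<Lambda>S(1) by blast
qed

end

theorem theorem1:
  fixes A :: "complex^'n^'n"
    and B :: "complex^('m::{finite,linorder})^'n"
    and \<Psi> :: "complex \<Rightarrow> complex^('m::{finite,linorder})^('m::{finite,linorder})"
  assumes "CARD('m) \<le> CARD('n)"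
    and "\<And>z. eigenvalue A z \<Longrightarrow> norm z < 1"
    and "rank B = CARD('m)"
    and "reachable A B"
    and "\<Psi> \<in> spectral_densities"
  shows "omega A B \<Psi> ` L_plus_Gamma A B = range_Gamma_plus A B"
proof -
  interpret moment_problem A B \<Psi>
    by unfold_locales (use assms full_rank_ker in \<open>auto simp: stable_def\<close>)
  show ?thesis
  proof (intro equalityI subsetI)
    fix \<Sigma> assume "\<Sigma> \<in> omega A B \<Psi> ` L_plus_Gamma A B"
    thus "\<Sigma> \<in> range_Gamma_plus A B"
      using omega_in_S pos_def_omega by (auto simp: L_plus_Gamma_def range_Gamma_plus_def)
  next
    fix \<Sigma> assume "\<Sigma> \<in> range_Gamma_plus A B"
    hence "\<Sigma> \<in> range_Gamma A B" "pos_def \<Sigma>" by (auto simp: range_Gamma_plus_def)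
    then obtain \<Lambda> where "\<Lambda> \<in> L_plus A B" "\<Lambda> \<in> range_Gamma A B" "omega A B \<Psi> \<Lambda> = \<Sigma>"
      by (rule omega_surjective)
    thus "\<Sigma> \<in> omega A B \<Psi> ` L_plus_Gamma A B" by (auto simp: L_plus_Gamma_def)
  qed
qed

end
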